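(* Let $W_n$, $n\in\mathbb{N}_0$, be the intrinsic martingale of a supercritical weighted branching process normalized by $m(1)=1$, with almost sure limit $W$, as described in the context, and suppose $\mathbb{P}\{W_1=1\}<1$. Let $a>0$ and $p\ge2$. Then the series $$A:=\sum_{n\ge 0}e^{an}(W-W_n)$$ converges in $L_p$ if, and only if, $$\mathbb{E}W_1^p<\infty\quad\text{and}\quad e^a\big(m^{1/2}(2)\vee m^{1/p}(p)\big)<1,$$ and in this case $A$ converges also almost surely.
   Context: Let $\mathbb{N}_0=\{0,1,2,\dots\}$, $\mathbb{N}=\{1,2,\dots\}$, and let $\mathbf{V}=\bigcup_{n\ge0}\mathbb{N}^n$ be the infinite Ulam-Harris tree of finite sequences $v=v_1\dots v_n$ with root $\varnothing$ ($\mathbb{N}^0=\{\varnothing\}$); $|v|$ is the length of $v$, and $vi$, $i\in\mathbb{N}$, are the successors of $v$. With each edge $(v,vi)$ a nonnegative random variable $L_i(v)$ (weight) is associated. The sequences $(L_i(v))_{i\in\mathbb{N}}$, $v\in\mathbf{V}$, are independent and identically distributed (arbitrary dependence among the weights $L_i(v)$, $i\in\mathbb{N}$, for the same $v$ is allowed). Define $L_\varnothing:=1$ and $L_{vi}:=L_i(v)L_v$. The point process $\sum_{i:\,L_i(\varnothing)>0}\delta_{\log L_i(\varnothing)}$ on $\mathbb{R}$ is locally finite, and its total number of points $J:=\#\{i\in\mathbb{N}:L_i(\varnothing)>0\}$ may be infinite with positive probability. For $n\in\mathbb{N}_0$ and $r>0$ put $Z_n:=\sum_{|v|=n}L_v$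 and $m(r):=\mathbb{E}\sum_{|v|=1}L_v^r\in[0,\infty]$; $m^{1/r}(r)$ means $(m(r))^{1/r}$, and $x\vee y=\max(x,y)$. Standing assumptions: $\mathbb{E}J>1$ (supercriticality) and $m(1)=1$. With $\mathcal{F}_0$ trivial and $\mathcal{F}_n=\sigma(L_i(v):i\in\mathbb{N},|v|<n)$, the sequence $W_n:=Z_n/m^n(1)=Z_n$ is a nonnegative mean-one martingale with respect to $(\mathcal{F}_n)_{n\ge0}$ (the intrinsic martingale), and $W$ denotes its almost sure limit. Convergence of a series in $L_p$ (or a.s.) means convergence of its partial sums in $L_p$ (or a.s.). *)

theory Defs
  imports "HOL-Probability.Probability"
begin

(* Powers with a positive exponent on the extended half-line; the library has powr only on
   types where an infinite base does not occur. *)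
definition ennreal_powr :: "ennreal \<Rightarrow> real \<Rightarrow> ennreal" where
  "ennreal_powr x r = (if x = \<infinity> then \<infinity> else ennreal (enn2real x powr r))"

definition in_Lp :: "'a measure \<Rightarrow> real \<Rightarrow> ('a \<Rightarrow> real) \<Rightarrow> bool" where
  "in_Lp M p f \<longleftrightarrow> f \<in> borel_measurable M \<and> integrable M (\<lambda>\<omega>. \<bar>f \<omega>\<bar> powr p)"

definition converges_in_Lp :: "'a measure \<Rightarrow> real \<Rightarrow> (nat \<Rightarrow> 'a \<Rightarrow> real) \<Rightarrow> bool" where
  "converges_in_Lp M p S \<longleftrightarrow>
     (\<forall>N. in_Lp M p (S N)) \<and>
     (\<exists>X. in_Lp M p X \<and>
          (\<lambda>N. (\<integral>\<omega>. \<bar>S N \<omega> - X \<omega>\<bar> powr p \<partial>M) powr (1 / p)) \<longlonglongrightarrow> 0)"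

definition series_converges_in_Lp :: "'a measure \<Rightarrow> real \<Rightarrow> (nat \<Rightarrow> 'a \<Rightarrow> real) \<Rightarrow> bool" where
  "series_converges_in_Lp M p f \<longleftrightarrow> converges_in_Lp M p (\<lambda>N \<omega>. \<Sum>n<N. f n \<omega>)"

(* A node v_1 ... v_n of the Ulam-Harris tree is the list [v_1, ..., v_n]; the successors of v
   are the lists v @ [i]. Labels start at 0 instead of 1. L v i is the weight of the edge
   from v to v @ [i]. *)
type_synonym 'a weights = "nat list \<Rightarrow> nat \<Rightarrow> 'a \<Rightarrow> real"

(* The weight of a node is the product of the edge weights along the path from the root;
   the recursion is node_weight_Nil, node_weight_snoc below. *)
definition node_weight :: "'a weights \<Rightarrow> nat list \<Rightarrow> 'a \<Rightarrow> real" where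
  "node_weight L v \<omega> = (\<Prod>k<length v. L (take k v) (v ! k) \<omega>)"

lemma node_weight_Nil: "node_weight L [] \<omega> = 1"
  by (simp add: node_weight_def)

lemma node_weight_snoc: "node_weight L (v @ [i]) \<omega> = L v i \<omega> * node_weight L v \<omega>"
proof -
  have "(\<Prod>k<length v. L (take k (v @ [i])) ((v @ [i]) ! k) \<omega>) = node_weight L v \<omega>"
    unfolding node_weight_def by (rule prod.cong) (auto simp: nth_append)
  then show ?thesis
    by (simp add: node_weight_def mult.commute)
qed

definition generation_sum :: "'a weights \<Rightarrow> nat \<Rightarrow> 'a \<Rightarrow> ennreal" where
  "generation_sum L n \<omega> = (\<Sum>\<^sub>\<infinity>v\<in>{v. length v = n}. ennreal (node_weight L v \<omega>))"

(* Since 0 powr r = 0, nodes of weight 0 do not contribute. *)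
definition moment_fun :: "'a measure \<Rightarrow> 'a weights \<Rightarrow> real \<Rightarrow> ennreal" where
  "moment_fun M L r =
     (\<integral>\<^sup>+\<omega>. (\<Sum>\<^sub>\<infinity>v\<in>{v. length v = 1}. ennreal (node_weight L v \<omega> powr r)) \<partial>M)"

(* The number of i with L_i(root) > 0, counted with value \<infinity> if there are infinitely many. *)
definition offspring_number :: "'a weights \<Rightarrow> 'a \<Rightarrow> ennreal" where
  "offspring_number L \<omega> = emeasure (count_space UNIV) {i. L [] i \<omega> > 0}"

locale weighted_branching_process = prob_space M for M :: "'a measure" +
  fixes L :: "'a weights"
  assumes weights_nonneg: "\<And>v i \<omega>. \<omega> \<in> space M \<Longrightarrow> 0 \<le> L v i \<omega>"
    and weights_indep:
      "indep_vars (\<lambda>_. \<Pi>\<^sub>M i\<in>UNIV. (borel :: real measure)) (\<lambda>v \<omega> i. L v i \<omega>) UNIV"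
    and weights_ident:
      "\<And>v. distr M (\<Pi>\<^sub>M i\<in>UNIV. (borel :: real measure)) (\<lambda>\<omega> i. L v i \<omega>) =
            distr M (\<Pi>\<^sub>M i\<in>UNIV. (borel :: real measure)) (\<lambda>\<omega> i. L [] i \<omega>)"
    and locally_finite:
      "AE \<omega> in M. \<forall>K. compact K \<longrightarrow> finite {i. L [] i \<omega> > 0 \<and> ln (L [] i \<omega>) \<in> K}"

locale normalized_supercritical_wbp = weighted_branching_process +
  assumes supercritical: "(\<integral>\<^sup>+\<omega>. offspring_number L \<omega> \<partial>M) > 1"
    and normalized: "moment_fun M L 1 = 1"

(* W_n = Z_n / m(1)^n = Z_n under the normalization m(1) = 1. The real-valued version below
   differs from Z_n only where Z_n = \<infinity>, which is a null event because E Z_n = 1. *)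
definition intrinsic_martingale :: "'a weights \<Rightarrow> nat \<Rightarrow> 'a \<Rightarrow> real" where
  "intrinsic_martingale L n \<omega> = enn2real (generation_sum L n \<omega>)"

(* The pointwise limit, which exists almost surely since W_n is a nonnegative martingale; on the
   null event where it does not exist the value is arbitrary. *)
definition martingale_limit :: "'a weights \<Rightarrow> 'a \<Rightarrow> real" where
  "martingale_limit L \<omega> = lim (\<lambda>n. intrinsic_martingale L n \<omega>)"

definition fluctuation_term :: "'a weights \<Rightarrow> real \<Rightarrow> nat \<Rightarrow> 'a \<Rightarrow> real" where
  "fluctuation_term L a n \<omega> =
     exp (a * real n) * (martingale_limit L \<omega> - intrinsic_martingale L n \<omega>)"

end

theory Submission
  imports Defs
begin

text \<open>
  Grouping the weights of generation \<open>n + 1\<close> by their parents gives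
  \<open>W\<^sub>n\<^sub>+\<^sub>1 - W\<^sub>n = \<Sum>\<^bsub>|v| = n\<^esub> L\<^sub>v (B\<^sub>v - 1)\<close> with \<open>B\<^sub>v = \<Sum>\<^sub>i L\<^sub>i(v)\<close>. Given the first \<open>n\<close>
  generations this is a sum of independent centered variables. The expansion of \<open>|x + y|\<^sup>p\<close> to first
  order in \<open>y\<close>, with a remainder of at least \<open>2 |y/2|\<^sup>p\<close> and at most a multiple of
  \<open>|x|\<^bsup>p-2\<^esup> y\<^sup>2 + |y|\<^sup>p\<close>, bounds its moments from both sides. The lower bound, for the exponents
  \<open>2\<close> and \<open>p\<close>, shows that \<open>E|W\<^sub>n\<^sub>+\<^sub>1 - W\<^sub>n|\<^sup>r\<close> is at least a multiple of \<open>m(r)\<^sup>n\<close>, hence necessity.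
  For sufficiency the upper bound (Rosenthal's inequality) leaves the moments
  \<open>E(\<Sum>\<^bsub>|v| = n\<^esub> L\<^sub>v\<^sup>2)\<^bsup>p/2\<^esup>\<close>. They satisfy a linear recursion in \<open>n\<close> with leading factor
  arbitrarily close to \<open>m(2)\<^bsup>p/2\<^esup>\<close> and inhomogeneity of order \<open>m(p)\<^sup>n\<close>, so the increments of
  \<open>W\<^sub>n\<close> decay geometrically in \<open>L\<^sub>p\<close>, at a rate faster than \<open>e\<^bsup>-an\<^esup>\<close>.
\<close>

section \<open>Power inequalities\<close>

text \<open>A node may have infinitely many children, whereas the moment inequalities concern finite
  sums. Every estimate is therefore proved for the finite tree with labels below \<open>k\<close>,
  with constants independent of \<open>k\<close>, and \<open>k\<close> is then sent to infinity.
  Upper bounds survive by Fatou's lemma; lower bounds use dominated convergence and hence moments of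
  all \<open>W_n\<close>, which in the necessity part come from the assumed convergence.
  Conditioning is Fubini's theorem for two independent blocks of weights. The delicate point of
  sufficiency is the leading factor of the recursion: a fixed multiple of m(2)^(p/2) would change
  the geometric rate and spoil the sharp criterion. Rosenthal's inequality, with its large
  constants, may thus be used only once per increment, while the iteration rests on a bound for
  nonnegative sums in which the power of the mean carries a factor near 1. In the necessity part a
  combination of two consecutive terms of the series cancels W and leaves a scaled
  increment.\<close>

lemma powr_tangent:
  fixes u v r :: real
  assumes "r \<ge> 1" "u \<ge> 0" "v \<ge> 0"
  shows "v powr r + r * v powr (r - 1) * (u - v) \<le> u powr r"
proof -
  \<comment> \<open>Convexity gives the tangent bound on the open half-line only. At
    \<open>v = 0\<close> the left side vanishes because \<open>0 powr x = 0\<close>; at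
    \<open>u = 0\<close> it equals \<open>(1 - r) * v powr r\<close>.\<close>
  consider "v = 0" | "u = 0" "v > 0" | "u > 0" "v > 0"
    using assms by fastforce
  then show ?thesis
  proof cases
    case 1
    then show ?thesis by simp
  next
    case 2
    have "v powr (r - 1) * v = v powr r"
      using 2 by (simp add: powr_diff)
    then have "v powr r + r * v powr (r - 1) * (u - v) = (1 - r) * v powr r"
      using 2 by (simp add: algebra_simps)
    also have "\<dots> \<le> 0"
      using assms by (simp add: mult_nonpos_nonneg)
    finally show ?thesis using 2 by simp
  next
    case 3
    have "r * v powr (r - 1) * (u - v) \<le> u powr r - v powr r"
    proof (rule convex_on_imp_above_tangent[OF powr_convex[OF assms(1)]])
      show "((\<lambda>x. x powr r) has_real_derivative r * v powr (r - 1)) (at v within {0<..})"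
        using 3 by (auto intro!: derivative_eq_intros)
    qed (use 3 in \<open>auto simp: interior_open connected_Ioi\<close>)
    then show ?thesis by simp
  qed
qed

lemma powr_mult_self: "0 \<le> x \<Longrightarrow> x powr (r - 1) * x = x powr (r::real)"
  by (cases "x = 0") (auto simp: powr_diff)

text \<open>Split \<open>t powr r\<close> into \<open>t powr (r - 1) * t\<close>; the first factor
  is monotone in \<open>t\<close> because \<open>r \<ge> 1\<close>.\<close>

lemma powr_add_superadditive:
  fixes u v r :: real
  assumes "r \<ge> 1" "u \<ge> 0" "v \<ge> 0"
  shows "u powr r + v powr r \<le> (u + v) powr r"
proof -
  have "u powr r + v powr r = u powr (r - 1) * u + v powr (r - 1) * v"
    using assms by (simp add: powr_mult_self)
  also have "\<dots> \<le> (u + v) powr (r - 1) * u + (u + v) powr (r - 1) * v"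
    using assms by (intro add_mono mult_right_mono powr_mono2) auto
  also have "\<dots> = (u + v) powr r"
    using assms by (simp add: powr_mult_self flip: distrib_left)
  finally show ?thesis .
qed

lemma powr_sum_superadditive:
  fixes r :: real
  assumes "r \<ge> 1" "\<And>i. i \<in> F \<Longrightarrow> 0 \<le> f i"
  shows "(\<Sum>i\<in>F. f i powr r) \<le> (\<Sum>i\<in>F. f i) powr r"
  using assms(2)
proof (induction F rule: infinite_finite_induct)
  case (insert i F)
  then have "(\<Sum>i\<in>insert i F. f i powr r) \<le> f i powr r + (\<Sum>i\<in>F. f i) powr r"
    by simp
  also have "\<dots> \<le> (f i + (\<Sum>i\<in>F. f i)) powr r"
    using insert assms by (intro powr_add_superadditive sum_nonneg) auto
  finally show ?case using insert by simp
qed auto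

lemma powr_add_le_max:
  fixes x y r :: real
  assumes "r \<ge> 0" "x \<ge> 0" "y \<ge> 0"
  shows "(x + y) powr r \<le> 2 powr r * (x powr r + y powr r)"
proof -
  have "(x + y) powr r \<le> (2 * max x y) powr r"
    using assms by (intro powr_mono2) auto
  also have "\<dots> \<le> 2 powr r * (x powr r + y powr r)"
    using assms by (auto simp: powr_mult max_def)
  finally show ?thesis .
qed

lemma abs_add_powr_le:
  fixes x y r :: real
  assumes "r \<ge> 0"
  shows "\<bar>x + y\<bar> powr r \<le> 2 powr r * (\<bar>x\<bar> powr r + \<bar>y\<bar> powr r)"
    and "\<bar>x - y\<bar> powr r \<le> 2 powr r * (\<bar>x\<bar> powr r + \<bar>y\<bar> powr r)"
proof -
  have "\<bar>x + y\<bar> powr r \<le> (\<bar>x\<bar> + \<bar>y\<bar>) powr r" "\<bar>x - y\<bar> powr r \<le> (\<bar>x\<bar> + \<bar>y\<bar>) powr r"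
    using assms by (intro powr_mono2; simp)+
  then show "\<bar>x + y\<bar> powr r \<le> 2 powr r * (\<bar>x\<bar> powr r + \<bar>y\<bar> powr r)"
    "\<bar>x - y\<bar> powr r \<le> 2 powr r * (\<bar>x\<bar> powr r + \<bar>y\<bar> powr r)"
    using powr_add_le_max[OF assms, of "\<bar>x\<bar>" "\<bar>y\<bar>"] by linarith+
qed

text \<open>The coefficient of \<open>y powr r\<close> tends to 1 as \<open>d\<close> tends to 0, at
  the price of a large coefficient of \<open>x powr r\<close>. Comparing \<open>x\<close> with
  \<open>d * y\<close> decides which of the two terms alone dominates.\<close>

lemma powr_add_le_eps:
  fixes x y r d :: real
  assumes "r \<ge> 0" "x \<ge> 0" "y \<ge> 0" "d > 0"
  shows "(x + y) powr r \<le> (1 + d) powr r * y powr r + (1 + 1 / d) powr r * x powr r"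
proof (cases "x \<le> d * y")
  case True
  then have "(x + y) powr r \<le> ((1 + d) * y) powr r"
    using assms by (intro powr_mono2) (auto simp: algebra_simps)
  also have "\<dots> = (1 + d) powr r * y powr r"
    using assms by (simp add: powr_mult)
  finally show ?thesis by (simp add: add_increasing2)
next
  case False
  then have "(x + y) powr r \<le> ((1 + 1 / d) * x) powr r"
    using assms by (intro powr_mono2) (auto simp: field_simps)
  also have "\<dots> = (1 + 1 / d) powr r * x powr r"
    using assms by (simp add: powr_mult)
  finally show ?thesis by (simp add: add_increasing)
qed

(* For r = p - 1 this is the derivative of |x|^p divided by p. *)
definition signed_powr :: "real \<Rightarrow> real \<Rightarrow> real" where
  "signed_powr x r = sgn x * \<bar>x\<bar> powr r"

lemma signed_powr_measurable [measurable]: "(\<lambda>x. signed_powr x r) \<in> borel_measurable borel"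
  unfolding signed_powr_def by measurable

lemma abs_signed_powr: "\<bar>signed_powr x r\<bar> = \<bar>x\<bar> powr r"
  by (cases "x = 0") (auto simp: signed_powr_def abs_mult abs_sgn_eq)

section \<open>First-order expansion of \<open>|x + y|^p\<close> with two-sided remainder\<close>

lemma abs_powr_tangent:
  fixes x y r :: real
  assumes "r \<ge> 1"
  shows "\<bar>x\<bar> powr r + r * signed_powr x (r - 1) * (y - x) \<le> \<bar>y\<bar> powr r"
proof -
  have "sgn x * (y - x) \<le> \<bar>y\<bar> - \<bar>x\<bar>"
    by (auto simp: sgn_if)
  then have "\<bar>x\<bar> powr (r - 1) * (sgn x * (y - x)) \<le> \<bar>x\<bar> powr (r - 1) * (\<bar>y\<bar> - \<bar>x\<bar>)"
    by (intro mult_left_mono) auto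
  then have "r * signed_powr x (r - 1) * (y - x) \<le> r * \<bar>x\<bar> powr (r - 1) * (\<bar>y\<bar> - \<bar>x\<bar>)"
    using assms by (simp add: signed_powr_def mult.assoc mult.left_commute)
  then show ?thesis
    using powr_tangent[OF assms, of "\<bar>y\<bar>" "\<bar>x\<bar>"] by simp
qed

text \<open>Clarkson's inequality. With \<open>q = p / 2\<close>, superadditivity of the power
  \<open>q\<close> bounds the left side by \<open>2 * (u^2 + v^2) powr q\<close>. Since
  \<open>u^2 + v^2\<close> is the mean of \<open>(u + v)^2\<close> and \<open>(u - v)^2\<close>,
  convexity of the power \<open>q\<close> gives the rest.\<close>

lemma powr_clarkson:
  fixes u v p :: real
  assumes "p \<ge> 2"
  shows "2 * (\<bar>u\<bar> powr p + \<bar>v\<bar> powr p) \<le> \<bar>u + v\<bar> powr p + \<bar>u - v\<bar> powr p"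
proof -
  define q where "q = p / 2"
  have q: "q \<ge> 1" using assms by (simp add: q_def)
  have sq: "\<bar>x\<bar> powr p = (x\<^sup>2) powr q" for x :: real
  proof (cases "x = 0")
    case False
    then have "x\<^sup>2 = \<bar>x\<bar> powr 2" by (simp add: powr_numeral)
    then have "(x\<^sup>2) powr q = \<bar>x\<bar> powr (2 * q)" by (simp only: powr_powr)
    then show ?thesis by (simp add: q_def)
  qed simp
  have "2 * (\<bar>u\<bar> powr p + \<bar>v\<bar> powr p) \<le> 2 * (u\<^sup>2 + v\<^sup>2) powr q"
    unfolding sq using powr_add_superadditive[OF q, of "u\<^sup>2" "v\<^sup>2"] by simp
  also have "\<dots> \<le> ((u + v)\<^sup>2) powr q + ((u - v)\<^sup>2) powr q"
  proof -
    let ?m = "u\<^sup>2 + v\<^sup>2"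
    have "?m powr q + q * ?m powr (q - 1) * ((u + v)\<^sup>2 - ?m) \<le> ((u + v)\<^sup>2) powr q"
      "?m powr q + q * ?m powr (q - 1) * ((u - v)\<^sup>2 - ?m) \<le> ((u - v)\<^sup>2) powr q"
      by (intro powr_tangent q; simp)+
    moreover have "q * ?m powr (q - 1) * ((u + v)\<^sup>2 - ?m) + q * ?m powr (q - 1) * ((u - v)\<^sup>2 - ?m) = 0"
      unfolding distrib_left[symmetric] by (simp add: power2_eq_square algebra_simps)
    ultimately show ?thesis by linarith
  qed
  finally show ?thesis by (simp add: sq)
qed

text \<open>Clarkson's inequality is applied to \<open>x + y / 2\<close> and \<open>y / 2\<close>,
  and the midpoint term is then bounded below by the tangent at \<open>x\<close>. The half step is
  the origin of \<open>y / 2\<close> in the remainder.\<close>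

lemma abs_powr_expansion_lower:
  fixes x y p :: real
  assumes "p \<ge> 2"
  shows "\<bar>x\<bar> powr p + p * signed_powr x (p - 1) * y + 2 * \<bar>y / 2\<bar> powr p \<le> \<bar>x + y\<bar> powr p"
proof -
  have "2 * (\<bar>x + y / 2\<bar> powr p + \<bar>y / 2\<bar> powr p) \<le> \<bar>x + y\<bar> powr p + \<bar>x\<bar> powr p"
    using powr_clarkson[OF assms, of "x + y / 2" "y / 2"] by (simp add: add.commute)
  moreover have "\<bar>x\<bar> powr p + p * signed_powr x (p - 1) * (y / 2) \<le> \<bar>x + y / 2\<bar> powr p"
    using abs_powr_tangent[of p x "x + y / 2"] assms by simp
  ultimately show ?thesis by (simp add: algebra_simps)
qed

text \<open>A Lipschitz estimate for the derivative of the p-th power between points of modulus at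
  most \<open>\<bar>x\<bar> + \<bar>y\<bar>\<close>; the extra factor \<open>y\<close> makes it
  insensitive to the direction of the step. Points of opposite signs are compared through 0.\<close>

lemma signed_powr_diff_le:
  fixes x y p :: real
  assumes "p \<ge> 2"
  shows "(signed_powr (x + y) (p - 1) - signed_powr x (p - 1)) * y \<le> p * (\<bar>x\<bar> + \<bar>y\<bar>) powr (p - 2) * y\<^sup>2"
proof -
  have p1: "p - 1 \<ge> 1" using assms by simp
  define m where "m = \<bar>x\<bar> + \<bar>y\<bar>"
  have same: "u powr (p - 1) - v powr (p - 1) \<le> p * m powr (p - 2) * (u - v)"
    if "0 \<le> v" "v \<le> u" "u \<le> m" for u v
  proof -
    have "u powr (p - 1) - v powr (p - 1) \<le> (p - 1) * u powr (p - 2) * (u - v)"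
      using powr_tangent[OF p1, of v u] that by (simp add: algebra_simps)
    also have "\<dots> \<le> p * m powr (p - 2) * (u - v)"
      using assms that by (intro mult_mono powr_mono2) auto
    finally show ?thesis .
  qed
  have opp: "u powr (p - 1) + v powr (p - 1) \<le> p * m powr (p - 2) * (u + v)"
    if "0 \<le> v" "0 \<le> u" "u \<le> m" "v \<le> m" for u v
  proof -
    have "w powr (p - 1) \<le> p * m powr (p - 2) * w" if "0 \<le> w" "w \<le> m" for w
      using same[of 0 w] that by simp
    from this[of u] this[of v] that show ?thesis by (simp add: distrib_left)
  qed
  have main: "signed_powr b (p - 1) - signed_powr a (p - 1) \<le> p * m powr (p - 2) * (b - a)"
    if "a \<le> b" "\<bar>a\<bar> \<le> m" "\<bar>b\<bar> \<le> m" for a b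
  proof -
    consider "0 \<le> a" | "a < 0" "0 < b" | "b \<le> 0" "a < 0"
      using that by linarith
    then show ?thesis
    proof cases
      case 1
      then show ?thesis using same[of a b] that
        by (cases "a = 0"; cases "b = 0") (auto simp: signed_powr_def sgn_if)
    next
      case 2
      then show ?thesis using opp[of "- a" b] that
        by (auto simp: signed_powr_def sgn_if)
    next
      case 3
      then show ?thesis using same[of "- b" "- a"] that
        by (cases "b = 0") (auto simp: signed_powr_def sgn_if)
    qed
  qed
  show ?thesis
  proof (cases "y \<ge> 0")
    case True
    have "signed_powr (x + y) (p - 1) - signed_powr x (p - 1) \<le> p * m powr (p - 2) * y"
      using main[of x "x + y"] True by (simp add: m_def)
    from mult_right_mono[OF this True] show ?thesis
      by (simp add: power2_eq_square mult.assoc m_def)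
  next
    case False
    have "signed_powr x (p - 1) - signed_powr (x + y) (p - 1) \<le> p * m powr (p - 2) * (- y)"
      using main[of "x + y" x] False by (simp add: m_def)
    from mult_right_mono[OF this, of "- y"] False show ?thesis
      by (simp add: power2_eq_square mult.assoc m_def algebra_simps)
  qed
qed

lemma abs_powr_minus_two: "\<bar>y\<bar> powr (p - 2) * y\<^sup>2 = \<bar>y::real\<bar> powr p"
  by (cases "y = 0") (auto simp: powr_diff powr_numeral)

text \<open>The tangent at \<open>x + y\<close>, evaluated at \<open>x\<close>, gives a bound with
  the derivative at the wrong point; \<open>signed_powr_diff_le\<close> moves it back to
  \<open>x\<close>. Each of these two steps contributes one factor \<open>p\<close>, and splitting
  the power of \<open>\<bar>x\<bar> + \<bar>y\<bar>\<close> contributes the power of 2.\<close>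

lemma abs_powr_expansion_upper:
  fixes x y p :: real
  assumes "p \<ge> 2"
  shows "\<bar>x + y\<bar> powr p \<le> \<bar>x\<bar> powr p + p * signed_powr x (p - 1) * y
           + p\<^sup>2 * 2 powr p * (\<bar>x\<bar> powr (p - 2) * y\<^sup>2 + \<bar>y\<bar> powr p)"
proof -
  have "\<bar>x + y\<bar> powr p \<le> \<bar>x\<bar> powr p + p * signed_powr (x + y) (p - 1) * y"
    using abs_powr_tangent[of p "x + y" x] assms by simp
  also have "\<dots> = \<bar>x\<bar> powr p + p * signed_powr x (p - 1) * y
      + p * ((signed_powr (x + y) (p - 1) - signed_powr x (p - 1)) * y)"
    by (simp add: algebra_simps)
  also have "\<dots> \<le> \<bar>x\<bar> powr p + p * signed_powr x (p - 1) * y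
      + p * (p * (\<bar>x\<bar> + \<bar>y\<bar>) powr (p - 2) * y\<^sup>2)"
    using assms signed_powr_diff_le[OF assms, of x y] by (intro add_left_mono mult_left_mono) auto
  also have "p * (p * (\<bar>x\<bar> + \<bar>y\<bar>) powr (p - 2) * y\<^sup>2)
      \<le> p * (p * (2 powr (p - 2) * (\<bar>x\<bar> powr (p - 2) + \<bar>y\<bar> powr (p - 2))) * y\<^sup>2)"
    using assms by (intro mult_left_mono mult_right_mono powr_add_le_max) auto
  also have "\<dots> = p\<^sup>2 * 2 powr (p - 2) * (\<bar>x\<bar> powr (p - 2) * y\<^sup>2 + \<bar>y\<bar> powr (p - 2) * y\<^sup>2)"
    by (simp add: power2_eq_square algebra_simps)
  also have "\<dots> \<le> p\<^sup>2 * 2 powr p * (\<bar>x\<bar> powr (p - 2) * y\<^sup>2 + \<bar>y\<bar> powr p)"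
    unfolding abs_powr_minus_two using assms
    by (intro mult_right_mono mult_left_mono powr_mono) auto
  finally show ?thesis by simp
qed

text \<open>The level \<open>l\<close> is free: a large \<open>l\<close> makes the coefficient of
  the p-th power small enough for that term to be absorbed later.\<close>

lemma powr_minus_two_le:
  fixes x l p :: real
  assumes "p \<ge> 2" "l > 0"
  shows "\<bar>x\<bar> powr (p - 2) \<le> l powr (p - 2) + \<bar>x\<bar> powr p / l\<^sup>2"
proof (cases "\<bar>x\<bar> \<le> l")
  case True
  then have "\<bar>x\<bar> powr (p - 2) \<le> l powr (p - 2)"
    using assms by (intro powr_mono2) auto
  then show ?thesis by (simp add: add_increasing2)
next
  case False
  then have "l\<^sup>2 \<le> x\<^sup>2"
    using assms by (metis abs_le_square_iff abs_of_pos less_eq_real_def not_less)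
  then have "\<bar>x\<bar> powr (p - 2) * l\<^sup>2 \<le> \<bar>x\<bar> powr (p - 2) * x\<^sup>2"
    by (intro mult_left_mono) auto
  then have "\<bar>x\<bar> powr (p - 2) \<le> \<bar>x\<bar> powr p / l\<^sup>2"
    unfolding abs_powr_minus_two using assms by (simp add: pos_le_divide_eq)
  then show ?thesis by (simp add: add_increasing)
qed

section \<open>Moments of sums of independent random variables\<close>

context prob_space
begin

lemma integrable_abs_powr_mono:
  fixes X :: "'a \<Rightarrow> real"
  assumes [measurable]: "X \<in> borel_measurable M"
    and "integrable M (\<lambda>\<omega>. \<bar>X \<omega>\<bar> powr p)" "0 \<le> r" "r \<le> p"
  shows "integrable M (\<lambda>\<omega>. \<bar>X \<omega>\<bar> powr r)"
proof (rule Bochner_Integration.integrable_bound)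
  show "integrable M (\<lambda>\<omega>. 1 + \<bar>X \<omega>\<bar> powr p)"
    using assms by auto
  have "x powr r \<le> 1 + x powr p" if "x \<ge> 0" for x :: real
  proof (cases "x \<le> 1")
    case True
    then have "x powr r \<le> 1"
      using powr_mono2[of r x 1] that assms by simp
    then show ?thesis by (simp add: add_increasing2)
  next
    case False
    then have "x powr r \<le> x powr p" using assms by (intro powr_mono) auto
    then show ?thesis by simp
  qed
  then show "AE \<omega> in M. norm (\<bar>X \<omega>\<bar> powr r) \<le> norm (1 + \<bar>X \<omega>\<bar> powr p)"
    by auto
qed simp

lemma integrable_from_abs_powr:
  fixes X :: "'a \<Rightarrow> real"
  assumes "X \<in> borel_measurable M" "integrable M (\<lambda>\<omega>. \<bar>X \<omega>\<bar> powr p)" "1 \<le> p"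
  shows "integrable M X"
  using integrable_abs_powr_mono[OF assms(1,2), of 1] assms integrable_abs_iff[OF assms(1)]
  by simp

lemma integrable_square_from_abs_powr:
  fixes X :: "'a \<Rightarrow> real"
  assumes "X \<in> borel_measurable M" "integrable M (\<lambda>\<omega>. \<bar>X \<omega>\<bar> powr p)" "2 \<le> p"
  shows "integrable M (\<lambda>\<omega>. (X \<omega>)\<^sup>2)"
  using integrable_abs_powr_mono[OF assms(1,2), of 2] assms by (simp add: powr_numeral)

lemma integrable_abs_add_powr:
  fixes X Y :: "'a \<Rightarrow> real"
  assumes [measurable]: "X \<in> borel_measurable M" "Y \<in> borel_measurable M"
    and "integrable M (\<lambda>\<omega>. \<bar>X \<omega>\<bar> powr p)" "integrable M (\<lambda>\<omega>. \<bar>Y \<omega>\<bar> powr p)" "0 \<le> p"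
  shows "integrable M (\<lambda>\<omega>. \<bar>X \<omega> + Y \<omega>\<bar> powr p)"
proof (rule Bochner_Integration.integrable_bound)
  show "integrable M (\<lambda>\<omega>. 2 powr p * (\<bar>X \<omega>\<bar> powr p + \<bar>Y \<omega>\<bar> powr p))"
    using assms by auto
qed (use assms abs_add_powr_le(1) in auto)

lemma integrable_abs_sum_powr:
  fixes Y :: "'i \<Rightarrow> 'a \<Rightarrow> real"
  assumes "finite G" "\<And>i. i \<in> G \<Longrightarrow> Y i \<in> borel_measurable M"
    and "\<And>i. i \<in> G \<Longrightarrow> integrable M (\<lambda>\<omega>. \<bar>Y i \<omega>\<bar> powr p)" "0 \<le> p"
  shows "integrable M (\<lambda>\<omega>. \<bar>\<Sum>i\<in>G. Y i \<omega>\<bar> powr p)"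
  using assms(1-3)
proof (induction G)
  case (insert i G)
  then have "integrable M (\<lambda>\<omega>. \<bar>Y i \<omega> + (\<Sum>j\<in>G. Y j \<omega>)\<bar> powr p)"
    using assms(4) by (intro integrable_abs_add_powr) auto
  then show ?case using insert by simp
qed auto

lemma indep_var_expectation_mult:
  fixes U V :: "'a \<Rightarrow> real" and f g :: "real \<Rightarrow> real"
  assumes "indep_var borel U borel V" "f \<in> borel_measurable borel" "g \<in> borel_measurable borel"
    and "integrable M (\<lambda>\<omega>. f (U \<omega>))" "integrable M (\<lambda>\<omega>. g (V \<omega>))"
  shows "expectation (\<lambda>\<omega>. f (U \<omega>) * g (V \<omega>)) = expectation (\<lambda>\<omega>. f (U \<omega>)) * expectation (\<lambda>\<omega>. g (V \<omega>))"
    and "integrable M (\<lambda>\<omega>. f (U \<omega>) * g (V \<omega>))"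
proof -
  have "indep_var borel (\<lambda>\<omega>. f (U \<omega>)) borel (\<lambda>\<omega>. g (V \<omega>))"
    using indep_var_compose[OF assms(1-3)] by (simp add: comp_def)
  then show "expectation (\<lambda>\<omega>. f (U \<omega>) * g (V \<omega>)) = expectation (\<lambda>\<omega>. f (U \<omega>)) * expectation (\<lambda>\<omega>. g (V \<omega>))"
    and "integrable M (\<lambda>\<omega>. f (U \<omega>) * g (V \<omega>))"
    using assms by (auto intro: indep_var_lebesgue_integral indep_var_integrable)
qed

text \<open>The first-order term of the expansion of \<open>|U + V|^p\<close> is a function of
  \<open>U\<close> times \<open>V\<close> and has mean zero by independence and centering; only the
  remainder contributes.\<close>

lemma moment_add_centered:
  fixes U V :: "'a \<Rightarrow> real"
  assumes ind: "indep_var borel U borel V" and p: "p \<ge> 2"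
    and U: "integrable M (\<lambda>\<omega>. \<bar>U \<omega>\<bar> powr p)" and V: "integrable M (\<lambda>\<omega>. \<bar>V \<omega>\<bar> powr p)"
    and centered: "expectation V = 0"
  shows "expectation (\<lambda>\<omega>. \<bar>U \<omega>\<bar> powr p) + 2 * expectation (\<lambda>\<omega>. \<bar>V \<omega> / 2\<bar> powr p)
          \<le> expectation (\<lambda>\<omega>. \<bar>U \<omega> + V \<omega>\<bar> powr p)"
    and "expectation (\<lambda>\<omega>. \<bar>U \<omega> + V \<omega>\<bar> powr p)
          \<le> expectation (\<lambda>\<omega>. \<bar>U \<omega>\<bar> powr p) + p\<^sup>2 * 2 powr p *
              (expectation (\<lambda>\<omega>. \<bar>U \<omega>\<bar> powr (p - 2)) * expectation (\<lambda>\<omega>. (V \<omega>)\<^sup>2)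
               + expectation (\<lambda>\<omega>. \<bar>V \<omega>\<bar> powr p))"
proof -
  have [measurable]: "U \<in> borel_measurable M" "V \<in> borel_measurable M"
    using indep_var_rv1[OF ind] indep_var_rv2[OF ind] by auto
  have s: "integrable M (\<lambda>\<omega>. signed_powr (U \<omega>) (p - 1))"
    by (rule integrable_abs_iff[THEN iffD1]) (use integrable_abs_powr_mono[OF _ U, of "p - 1"] p in \<open>simp_all add: abs_signed_powr\<close>)
  have V1: "integrable M V" using integrable_from_abs_powr[OF _ V] p by simp
  have V2: "integrable M (\<lambda>\<omega>. (V \<omega>)\<^sup>2)" using integrable_square_from_abs_powr[OF _ V] p by simp
  have U2: "integrable M (\<lambda>\<omega>. \<bar>U \<omega>\<bar> powr (p - 2))"
    using integrable_abs_powr_mono[OF _ U, of "p - 2"] p by simp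
  have UV: "integrable M (\<lambda>\<omega>. \<bar>U \<omega> + V \<omega>\<bar> powr p)"
    using U V p by (intro integrable_abs_add_powr) auto
  have Vh: "integrable M (\<lambda>\<omega>. \<bar>V \<omega> / 2\<bar> powr p)"
    using V by (simp add: powr_divide)
  have a: "expectation (\<lambda>\<omega>. signed_powr (U \<omega>) (p - 1) * V \<omega>) = 0"
    "integrable M (\<lambda>\<omega>. signed_powr (U \<omega>) (p - 1) * V \<omega>)"
    using indep_var_expectation_mult[OF ind signed_powr_measurable _ s, of "\<lambda>x. x"] V1
    by (auto simp: centered)
  have lin: "expectation (\<lambda>\<omega>. p * signed_powr (U \<omega>) (p - 1) * V \<omega>) = 0"
    "integrable M (\<lambda>\<omega>. p * signed_powr (U \<omega>) (p - 1) * V \<omega>)"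
    using a by (auto simp: mult.assoc)
  have b: "expectation (\<lambda>\<omega>. \<bar>U \<omega>\<bar> powr (p - 2) * (V \<omega>)\<^sup>2)
      = expectation (\<lambda>\<omega>. \<bar>U \<omega>\<bar> powr (p - 2)) * expectation (\<lambda>\<omega>. (V \<omega>)\<^sup>2)"
    "integrable M (\<lambda>\<omega>. \<bar>U \<omega>\<bar> powr (p - 2) * (V \<omega>)\<^sup>2)"
    using indep_var_expectation_mult[OF ind _ _ U2 V2] by auto
  have "expectation (\<lambda>\<omega>. \<bar>U \<omega>\<bar> powr p + p * signed_powr (U \<omega>) (p - 1) * V \<omega> + 2 * \<bar>V \<omega> / 2\<bar> powr p)
      \<le> expectation (\<lambda>\<omega>. \<bar>U \<omega> + V \<omega>\<bar> powr p)"
    using U lin Vh UV abs_powr_expansion_lower[OF p] by (intro integral_mono) auto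
  then show "expectation (\<lambda>\<omega>. \<bar>U \<omega>\<bar> powr p) + 2 * expectation (\<lambda>\<omega>. \<bar>V \<omega> / 2\<bar> powr p)
          \<le> expectation (\<lambda>\<omega>. \<bar>U \<omega> + V \<omega>\<bar> powr p)"
    using U lin Vh by simp
  have "expectation (\<lambda>\<omega>. \<bar>U \<omega> + V \<omega>\<bar> powr p) \<le>
      expectation (\<lambda>\<omega>. \<bar>U \<omega>\<bar> powr p + p * signed_powr (U \<omega>) (p - 1) * V \<omega> + p\<^sup>2 * 2 powr p *
        (\<bar>U \<omega>\<bar> powr (p - 2) * (V \<omega>)\<^sup>2 + \<bar>V \<omega>\<bar> powr p))"
    using U lin V UV b abs_powr_expansion_upper[OF p] by (intro integral_mono) auto
  then show "expectation (\<lambda>\<omega>. \<bar>U \<omega> + V \<omega>\<bar> powr p)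
          \<le> expectation (\<lambda>\<omega>. \<bar>U \<omega>\<bar> powr p) + p\<^sup>2 * 2 powr p *
              (expectation (\<lambda>\<omega>. \<bar>U \<omega>\<bar> powr (p - 2)) * expectation (\<lambda>\<omega>. (V \<omega>)\<^sup>2)
               + expectation (\<lambda>\<omega>. \<bar>V \<omega>\<bar> powr p))"
    using U lin V b by simp
qed

section \<open>Sums of independent centered variables\<close>

lemma indep_vars_rv:
  assumes "indep_vars N Y I" "i \<in> I"
  shows "Y i \<in> measurable M (N i)"
  using assms by (simp add: indep_vars_def)

lemma indep_vars_sum_subset:
  fixes Y :: "'i \<Rightarrow> 'a \<Rightarrow> real"
  assumes "indep_vars (\<lambda>_. borel) Y F" "finite F" "G \<subseteq> F" "i \<in> F" "i \<notin> G"
  shows "indep_var borel (\<lambda>\<omega>. \<Sum>j\<in>G. Y j \<omega>) borel (Y i)"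
proof -
  have "indep_var
    borel ((\<lambda>f. \<Sum>j\<in>G. f j) \<circ> (\<lambda>\<omega>. restrict (\<lambda>j. Y j \<omega>) G))
    borel ((\<lambda>f. f i) \<circ> (\<lambda>\<omega>. restrict (\<lambda>j. Y j \<omega>) {i}))"
    using assms by (intro indep_var_compose[OF indep_var_restrict[OF assms(1)]]) auto
  also have "(\<lambda>f. f i) \<circ> (\<lambda>\<omega>. restrict (\<lambda>j. Y j \<omega>) {i}) = Y i"
    by auto
  also have "(\<lambda>f. \<Sum>j\<in>G. f j) \<circ> (\<lambda>\<omega>. restrict (\<lambda>j. Y j \<omega>) G) = (\<lambda>\<omega>. \<Sum>j\<in>G. Y j \<omega>)"
    by (auto cong: rev_conj_cong)
  finally show ?thesis .
qed

context
  fixes Y :: "'i \<Rightarrow> 'a \<Rightarrow> real" and F :: "'i set" and p :: real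
  assumes F: "finite F" and p: "p \<ge> 2"
    and indep: "indep_vars (\<lambda>_. borel) Y F"
    and moment: "\<And>i. i \<in> F \<Longrightarrow> integrable M (\<lambda>\<omega>. \<bar>Y i \<omega>\<bar> powr p)"
    and centered: "\<And>i. i \<in> F \<Longrightarrow> expectation (Y i) = 0"
begin

lemma centered_sum_step:
  assumes "G \<subseteq> F" "i \<in> F" "i \<notin> G"
  defines "S \<equiv> \<lambda>H. expectation (\<lambda>\<omega>. \<bar>\<Sum>i\<in>H. Y i \<omega>\<bar> powr p)"
  shows "S G + 2 * expectation (\<lambda>\<omega>. \<bar>Y i \<omega> / 2\<bar> powr p) \<le> S (insert i G)"
    and "S (insert i G) \<le> S G + p\<^sup>2 * 2 powr p *
              (expectation (\<lambda>\<omega>. \<bar>\<Sum>i\<in>G. Y i \<omega>\<bar> powr (p - 2)) * expectation (\<lambda>\<omega>. (Y i \<omega>)\<^sup>2)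
               + expectation (\<lambda>\<omega>. \<bar>Y i \<omega>\<bar> powr p))"
proof -
  have G: "finite G" using F assms finite_subset by auto
  have "integrable M (\<lambda>\<omega>. \<bar>\<Sum>i\<in>G. Y i \<omega>\<bar> powr p)"
    using moment assms G p indep_vars_rv[OF indep] by (intro integrable_abs_sum_powr) auto
  from moment_add_centered[OF indep_vars_sum_subset[OF indep F assms(1-3)] p this moment centered]
  show "S G + 2 * expectation (\<lambda>\<omega>. \<bar>Y i \<omega> / 2\<bar> powr p) \<le> S (insert i G)"
    and "S (insert i G) \<le> S G + p\<^sup>2 * 2 powr p *
              (expectation (\<lambda>\<omega>. \<bar>\<Sum>i\<in>G. Y i \<omega>\<bar> powr (p - 2)) * expectation (\<lambda>\<omega>. (Y i \<omega>)\<^sup>2)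
               + expectation (\<lambda>\<omega>. \<bar>Y i \<omega>\<bar> powr p))"
    using assms G by (simp_all add: add.commute)
qed

lemma centered_sum_lower:
  assumes "G \<subseteq> F"
  shows "2 * (\<Sum>i\<in>G. expectation (\<lambda>\<omega>. \<bar>Y i \<omega> / 2\<bar> powr p)) \<le> expectation (\<lambda>\<omega>. \<bar>\<Sum>i\<in>G. Y i \<omega>\<bar> powr p)"
  using finite_subset[OF assms F] assms
proof (induction G rule: finite_induct)
  case (insert i G)
  then show ?case using centered_sum_step(1)[of G i] by auto
qed auto

text \<open>Each added summand increases the p-th moment by a nonnegative amount. This bounds the
  moments of all partial sums by that of the complete sum, uniformly along the induction for the
  upper bound.\<close>

lemma centered_sum_mono:
  assumes "G \<subseteq> F"
  shows "expectation (\<lambda>\<omega>. \<bar>\<Sum>i\<in>G. Y i \<omega>\<bar> powr p) \<le> expectation (\<lambda>\<omega>. \<bar>\<Sum>i\<in>F. Y i \<omega>\<bar> powr p)"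
proof -
  have "expectation (\<lambda>\<omega>. \<bar>\<Sum>i\<in>G. Y i \<omega>\<bar> powr p) \<le> expectation (\<lambda>\<omega>. \<bar>\<Sum>i\<in>G \<union> H. Y i \<omega>\<bar> powr p)"
    if "finite H" "H \<subseteq> F - G" for H
    using that
  proof (induction H rule: finite_induct)
    case (insert i H)
    have "0 \<le> expectation (\<lambda>\<omega>. \<bar>Y i \<omega> / 2\<bar> powr p)"
      by simp
    moreover have "expectation (\<lambda>\<omega>. \<bar>\<Sum>i\<in>G \<union> H. Y i \<omega>\<bar> powr p) + 2 * expectation (\<lambda>\<omega>. \<bar>Y i \<omega> / 2\<bar> powr p)
        \<le> expectation (\<lambda>\<omega>. \<bar>\<Sum>i\<in>insert i (G \<union> H). Y i \<omega>\<bar> powr p)"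
      using insert assms by (intro centered_sum_step(1)) auto
    moreover have "expectation (\<lambda>\<omega>. \<bar>\<Sum>i\<in>G. Y i \<omega>\<bar> powr p) \<le> expectation (\<lambda>\<omega>. \<bar>\<Sum>i\<in>G \<union> H. Y i \<omega>\<bar> powr p)"
      using insert by auto
    ultimately have "expectation (\<lambda>\<omega>. \<bar>\<Sum>i\<in>G. Y i \<omega>\<bar> powr p)
        \<le> expectation (\<lambda>\<omega>. \<bar>\<Sum>i\<in>insert i (G \<union> H). Y i \<omega>\<bar> powr p)"
      by linarith
    then show ?case by simp
  qed simp
  from this[of "F - G"] assms F show ?thesis
    by (simp add: Un_absorb1)
qed

text \<open>Bounding the moment of order \<open>p - 2\<close> of every partial sum by
  \<open>l powr (p - 2) + Y0 / l\<^sup>2\<close> makes the contributions additive in the summands.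
  The price is that the unknown moment \<open>Y0\<close> of the complete sum reappears on the right;
  the choice of \<open>l\<close> in \<open>centered_sum_rosenthal\<close> removes it.\<close>

lemma centered_sum_upper:
  assumes "G \<subseteq> F" "l > 0"
  defines "Y0 \<equiv> expectation (\<lambda>\<omega>. \<bar>\<Sum>i\<in>F. Y i \<omega>\<bar> powr p)"
  shows "expectation (\<lambda>\<omega>. \<bar>\<Sum>i\<in>G. Y i \<omega>\<bar> powr p) \<le> p\<^sup>2 * 2 powr p *
     ((l powr (p - 2) + Y0 / l\<^sup>2) * (\<Sum>i\<in>G. expectation (\<lambda>\<omega>. (Y i \<omega>)\<^sup>2))
       + (\<Sum>i\<in>G. expectation (\<lambda>\<omega>. \<bar>Y i \<omega>\<bar> powr p)))"
  using finite_subset[OF assms(1) F] assms(1)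
proof (induction G rule: finite_induct)
  case (insert i G)
  let ?S = "\<lambda>\<omega>. \<Sum>i\<in>G. Y i \<omega>"
  have [measurable]: "?S \<in> borel_measurable M"
    using insert indep_vars_rv[OF indep] by (intro borel_measurable_sum) auto
  have int: "integrable M (\<lambda>\<omega>. \<bar>?S \<omega>\<bar> powr p)"
    using moment insert p indep_vars_rv[OF indep] by (intro integrable_abs_sum_powr) auto
  have "expectation (\<lambda>\<omega>. \<bar>?S \<omega>\<bar> powr (p - 2)) \<le> expectation (\<lambda>\<omega>. l powr (p - 2) + \<bar>?S \<omega>\<bar> powr p / l\<^sup>2)"
    using integrable_abs_powr_mono[OF _ int, of "p - 2"] p int powr_minus_two_le[OF p assms(2)]
    by (intro integral_mono) auto
  also have "\<dots> = l powr (p - 2) + expectation (\<lambda>\<omega>. \<bar>?S \<omega>\<bar> powr p) / l\<^sup>2"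
    using int by (simp add: prob_space)
  also have "\<dots> \<le> l powr (p - 2) + Y0 / l\<^sup>2"
    unfolding Y0_def using insert by (intro add_left_mono divide_right_mono centered_sum_mono) auto
  finally have *: "expectation (\<lambda>\<omega>. \<bar>?S \<omega>\<bar> powr (p - 2)) \<le> l powr (p - 2) + Y0 / l\<^sup>2" .
  have "expectation (\<lambda>\<omega>. \<bar>\<Sum>i\<in>insert i G. Y i \<omega>\<bar> powr p) \<le> expectation (\<lambda>\<omega>. \<bar>?S \<omega>\<bar> powr p) + p\<^sup>2 * 2 powr p *
              (expectation (\<lambda>\<omega>. \<bar>?S \<omega>\<bar> powr (p - 2)) * expectation (\<lambda>\<omega>. (Y i \<omega>)\<^sup>2)
               + expectation (\<lambda>\<omega>. \<bar>Y i \<omega>\<bar> powr p))"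
    using insert by (intro centered_sum_step(2)) auto
  also have "\<dots> \<le> expectation (\<lambda>\<omega>. \<bar>?S \<omega>\<bar> powr p) + p\<^sup>2 * 2 powr p *
              ((l powr (p - 2) + Y0 / l\<^sup>2) * expectation (\<lambda>\<omega>. (Y i \<omega>)\<^sup>2)
               + expectation (\<lambda>\<omega>. \<bar>Y i \<omega>\<bar> powr p))"
    using * by (intro add_mono mult_left_mono mult_right_mono order_refl) auto
  also have "\<dots> \<le> p\<^sup>2 * 2 powr p *
     ((l powr (p - 2) + Y0 / l\<^sup>2) * (\<Sum>i\<in>insert i G. expectation (\<lambda>\<omega>. (Y i \<omega>)\<^sup>2))
       + (\<Sum>i\<in>insert i G. expectation (\<lambda>\<omega>. \<bar>Y i \<omega>\<bar> powr p)))"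
    using insert by (simp add: algebra_simps)
  finally show ?case .
qed auto

text \<open>An absorption argument: \<open>Y0\<close> is a real number, so once it stands on the
  right with coefficient 1/2 it can be moved to the left.\<close>

lemma centered_sum_rosenthal:
  defines "K \<equiv> p\<^sup>2 * 2 powr p"
  shows "expectation (\<lambda>\<omega>. \<bar>\<Sum>i\<in>F. Y i \<omega>\<bar> powr p) \<le>
      2 * K * (\<Sum>i\<in>F. expectation (\<lambda>\<omega>. \<bar>Y i \<omega>\<bar> powr p))
       + (2 * K * (\<Sum>i\<in>F. expectation (\<lambda>\<omega>. (Y i \<omega>)\<^sup>2))) powr (p / 2)"
proof -
  define V where "V = (\<Sum>i\<in>F. expectation (\<lambda>\<omega>. (Y i \<omega>)\<^sup>2))"
  define B where "B = (\<Sum>i\<in>F. expectation (\<lambda>\<omega>. \<bar>Y i \<omega>\<bar> powr p))"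
  define Y0 where "Y0 = expectation (\<lambda>\<omega>. \<bar>\<Sum>i\<in>F. Y i \<omega>\<bar> powr p)"
  have K: "K > 0" using p by (simp add: K_def)
  have V: "V \<ge> 0" unfolding V_def by (intro sum_nonneg) auto
  have B: "B \<ge> 0" unfolding B_def by (intro sum_nonneg) auto
  have bound: "Y0 \<le> K * ((l powr (p - 2) + Y0 / l\<^sup>2) * V + B)" if "l > 0" for l
    unfolding Y0_def V_def B_def K_def using centered_sum_upper[OF order_refl that] .
  have "Y0 \<le> 2 * K * B + (2 * K * V) powr (p / 2)"
  proof (cases "V = 0")
    \<comment> \<open>The level chosen in the other case would be 0 here. Any positive level works,
      since \<open>V\<close> multiplies everything that depends on it.\<close>
    case True
    then have "Y0 \<le> K * B" using bound[of 1] by simp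
    also have "\<dots> \<le> 2 * K * B" using K B by simp
    finally show ?thesis using True by simp
  next
    case False
    \<comment> \<open>This level turns the term \<open>K * V * Y0 / l\<^sup>2\<close> into
      \<open>Y0 / 2\<close>.\<close>
    define l where "l = sqrt (2 * K * V)"
    have l2: "l\<^sup>2 = 2 * K * V" and l: "l > 0"
      using K V False by (simp_all add: l_def)
    have "Y0 \<le> l powr (p - 2) * (K * V) + Y0 * (K * V) / l\<^sup>2 + K * B"
      using bound[OF l] by (simp add: algebra_simps)
    also have "K * V = l\<^sup>2 / 2" using l2 by simp
    also have "l powr (p - 2) * (l\<^sup>2 / 2) = l powr p / 2"
      using abs_powr_minus_two[of l p] l by simp
    also have "Y0 * (l\<^sup>2 / 2) / l\<^sup>2 = Y0 / 2"
      using l by simp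
    finally have "Y0 \<le> 2 * K * B + l powr p" by simp
    also have "l powr p = (l\<^sup>2) powr (p / 2)"
    proof -
      have "l\<^sup>2 = l powr 2" using l by (simp add: powr_numeral)
      then show ?thesis by (simp add: powr_powr)
    qed
    finally show ?thesis by (simp add: l2)
  qed
  then show ?thesis by (simp add: Y0_def B_def V_def)
qed

end

section \<open>Sums of independent nonnegative variables\<close>

text \<open>Write \<open>S powr q\<close> as the sum of the products
  \<open>X i * S powr (q - 1)\<close> and separate \<open>X i\<close> from the other summands by
  \<open>powr_add_le_eps\<close>. With \<open>m\<close> the mean of \<open>S\<close>, this leaves
  \<open>e * m\<close> times the moment of order \<open>q - 1\<close>, which Young's inequality
  splits into a multiple of the moment of order \<open>q\<close> and \<open>m powr q\<close>. Moving
  the former to the left produces the factor \<open>q - e * (q - 1)\<close>, close to 1 for small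
  \<open>d\<close>.\<close>

lemma nonneg_sum_moment:
  fixes X :: "'i \<Rightarrow> 'a \<Rightarrow> real"
  assumes F: "finite F" and q: "q \<ge> 1" and d: "d > 0"
    and indep: "indep_vars (\<lambda>_. borel) X F"
    and moment: "\<And>i. i \<in> F \<Longrightarrow> integrable M (\<lambda>\<omega>. \<bar>X i \<omega>\<bar> powr q)"
    and nonneg: "\<And>i \<omega>. i \<in> F \<Longrightarrow> \<omega> \<in> space M \<Longrightarrow> 0 \<le> X i \<omega>"
  defines "e \<equiv> (1 + d) powr (q - 1)" and "C \<equiv> (1 + 1 / d) powr (q - 1)"
  shows "expectation (\<lambda>\<omega>. (\<Sum>i\<in>F. X i \<omega>) powr q) * (q - e * (q - 1))
    \<le> q * C * (\<Sum>i\<in>F. expectation (\<lambda>\<omega>. X i \<omega> powr q)) + e * (\<Sum>i\<in>F. expectation (X i)) powr q"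
proof -
  define S where "S \<omega> = (\<Sum>i\<in>F. X i \<omega>)" for \<omega>
  define m where "m = (\<Sum>i\<in>F. expectation (X i))"
  have rv: "X i \<in> borel_measurable M" if "i \<in> F" for i
    using indep_vars_rv[OF indep that] .
  have [measurable]: "S \<in> borel_measurable M"
    unfolding S_def using rv by measurable
  have S0: "0 \<le> S \<omega>" if "\<omega> \<in> space M" for \<omega>
    unfolding S_def using nonneg that by (intro sum_nonneg) auto
  have m0: "0 \<le> m" unfolding m_def using nonneg by (intro sum_nonneg integral_nonneg_AE) auto
  have intS: "integrable M (\<lambda>\<omega>. \<bar>S \<omega>\<bar> powr q)"
    unfolding S_def using F rv moment q by (intro integrable_abs_sum_powr) auto
  have intS1: "integrable M (\<lambda>\<omega>. \<bar>S \<omega>\<bar> powr (q - 1))"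
    using integrable_abs_powr_mono[OF _ intS, of "q - 1"] q by simp
  have "1 + 1 / d > 0" using d by (intro add_pos_pos) auto
  then have eC: "e > 0" "C > 0" using d by (auto simp: e_def C_def)
  have intX: "integrable M (X i)" if "i \<in> F" for i
    using integrable_from_abs_powr[OF rv[OF that] moment[OF that] q] .
  have weighted: "integrable M (\<lambda>\<omega>. X i \<omega> * \<bar>S \<omega>\<bar> powr (q - 1))"
    "expectation (\<lambda>\<omega>. X i \<omega> * \<bar>S \<omega>\<bar> powr (q - 1))
      \<le> C * expectation (\<lambda>\<omega>. \<bar>X i \<omega>\<bar> powr q) + e * (expectation (X i) * expectation (\<lambda>\<omega>. \<bar>S \<omega>\<bar> powr (q - 1)))"
    if i: "i \<in> F" for i
  proof -
    note [measurable] = rv[OF i]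
    \<comment> \<open>The sum without \<open>X i\<close> is independent of \<open>X i\<close>, so
      the mixed term factorizes. As all summands are nonnegative, \<open>R\<close> may afterwards be
      replaced by \<open>S\<close>, which no longer depends on \<open>i\<close>.\<close>
    define R where "R \<omega> = (\<Sum>j\<in>F - {i}. X j \<omega>)" for \<omega>
    have ind: "indep_var borel R borel (X i)"
      unfolding R_def using i F by (intro indep_vars_sum_subset[OF indep]) auto
    have [measurable]: "R \<in> borel_measurable M" using indep_var_rv1[OF ind] .
    have SR: "S \<omega> = X i \<omega> + R \<omega>" for \<omega>
      using i F by (simp add: S_def R_def sum.remove)
    have R0: "0 \<le> R \<omega>" if "\<omega> \<in> space M" for \<omega>
      unfolding R_def using nonneg that by (intro sum_nonneg) auto
    have "integrable M (\<lambda>\<omega>. \<bar>R \<omega>\<bar> powr q)"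
      unfolding R_def using F rv moment q by (intro integrable_abs_sum_powr) auto
    from integrable_abs_powr_mono[OF _ this, of "q - 1"] q
    have intR: "integrable M (\<lambda>\<omega>. \<bar>R \<omega>\<bar> powr (q - 1))" by simp
    have prod: "integrable M (\<lambda>\<omega>. \<bar>R \<omega>\<bar> powr (q - 1) * X i \<omega>)"
      "expectation (\<lambda>\<omega>. \<bar>R \<omega>\<bar> powr (q - 1) * X i \<omega>) = expectation (\<lambda>\<omega>. \<bar>R \<omega>\<bar> powr (q - 1)) * expectation (X i)"
      by (rule indep_var_expectation_mult[OF ind, where f = "\<lambda>x. \<bar>x\<bar> powr (q - 1)" and g = "\<lambda>x. x",
          OF _ _ intR intX[OF i]]; measurable)+
    have pw: "X i \<omega> * \<bar>S \<omega>\<bar> powr (q - 1) \<le> C * \<bar>X i \<omega>\<bar> powr q + e * (\<bar>R \<omega>\<bar> powr (q - 1) * X i \<omega>)"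
      if "\<omega> \<in> space M" for \<omega>
    proof -
      have "\<bar>S \<omega>\<bar> powr (q - 1) \<le> e * \<bar>R \<omega>\<bar> powr (q - 1) + C * X i \<omega> powr (q - 1)"
        unfolding SR e_def C_def
        using powr_add_le_eps[of "q - 1" "X i \<omega>" "R \<omega>" d] q d nonneg[OF i that] R0[OF that] by simp
      from mult_right_mono[OF this nonneg[OF i that]]
      have "X i \<omega> * \<bar>S \<omega>\<bar> powr (q - 1)
          \<le> e * (\<bar>R \<omega>\<bar> powr (q - 1) * X i \<omega>) + C * (X i \<omega> powr (q - 1) * X i \<omega>)"
        by (simp add: algebra_simps)
      also have "X i \<omega> powr (q - 1) * X i \<omega> = \<bar>X i \<omega>\<bar> powr q"
        using nonneg[OF i that] by (simp add: powr_mult_self)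
      finally show ?thesis by simp
    qed
    have int_bound: "integrable M (\<lambda>\<omega>. C * \<bar>X i \<omega>\<bar> powr q + e * (\<bar>R \<omega>\<bar> powr (q - 1) * X i \<omega>))"
      using moment[OF i] prod by auto
    show int: "integrable M (\<lambda>\<omega>. X i \<omega> * \<bar>S \<omega>\<bar> powr (q - 1))"
    proof (rule Bochner_Integration.integrable_bound[OF int_bound])
      show "AE \<omega> in M. norm (X i \<omega> * \<bar>S \<omega>\<bar> powr (q - 1))
          \<le> norm (C * \<bar>X i \<omega>\<bar> powr q + e * (\<bar>R \<omega>\<bar> powr (q - 1) * X i \<omega>))"
      proof (intro AE_I2)
        fix \<omega> assume w: "\<omega> \<in> space M"
        show "norm (X i \<omega> * \<bar>S \<omega>\<bar> powr (q - 1))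
          \<le> norm (C * \<bar>X i \<omega>\<bar> powr q + e * (\<bar>R \<omega>\<bar> powr (q - 1) * X i \<omega>))"
          using pw[OF w] nonneg[OF i w] by simp
      qed
    qed measurable
    have "expectation (\<lambda>\<omega>. X i \<omega> * \<bar>S \<omega>\<bar> powr (q - 1))
        \<le> expectation (\<lambda>\<omega>. C * \<bar>X i \<omega>\<bar> powr q + e * (\<bar>R \<omega>\<bar> powr (q - 1) * X i \<omega>))"
      using int int_bound pw by (intro integral_mono) auto
    also have "\<dots> = C * expectation (\<lambda>\<omega>. \<bar>X i \<omega>\<bar> powr q)
        + e * (expectation (X i) * expectation (\<lambda>\<omega>. \<bar>R \<omega>\<bar> powr (q - 1)))"
      using moment[OF i] prod by simp
    also have "\<dots> \<le> C * expectation (\<lambda>\<omega>. \<bar>X i \<omega>\<bar> powr q)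
        + e * (expectation (X i) * expectation (\<lambda>\<omega>. \<bar>S \<omega>\<bar> powr (q - 1)))"
    proof -
      have "expectation (\<lambda>\<omega>. \<bar>R \<omega>\<bar> powr (q - 1)) \<le> expectation (\<lambda>\<omega>. \<bar>S \<omega>\<bar> powr (q - 1))"
        using intR intS1 q R0 nonneg[OF i] by (intro integral_mono powr_mono2) (auto simp: SR)
      moreover have "0 \<le> expectation (X i)"
        using nonneg[OF i] by (intro integral_nonneg_AE) auto
      ultimately show ?thesis
        using eC by (intro add_left_mono mult_left_mono) auto
    qed
    finally show "expectation (\<lambda>\<omega>. X i \<omega> * \<bar>S \<omega>\<bar> powr (q - 1))
      \<le> C * expectation (\<lambda>\<omega>. \<bar>X i \<omega>\<bar> powr q) + e * (expectation (X i) * expectation (\<lambda>\<omega>. \<bar>S \<omega>\<bar> powr (q - 1)))" .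
  qed
  define T where "T = expectation (\<lambda>\<omega>. \<bar>S \<omega>\<bar> powr q)"
  define A where "A = (\<Sum>i\<in>F. expectation (\<lambda>\<omega>. \<bar>X i \<omega>\<bar> powr q))"
  have "T = expectation (\<lambda>\<omega>. \<Sum>i\<in>F. X i \<omega> * \<bar>S \<omega>\<bar> powr (q - 1))"
    unfolding T_def
  proof (intro Bochner_Integration.integral_cong refl)
    fix \<omega> assume "\<omega> \<in> space M"
    then show "\<bar>S \<omega>\<bar> powr q = (\<Sum>i\<in>F. X i \<omega> * \<bar>S \<omega>\<bar> powr (q - 1))"
      unfolding sum_distrib_right[symmetric] S_def[symmetric]
      using S0 powr_mult_self[of "S \<omega>" q] by (simp add: mult.commute)
  qed
  also have "\<dots> = (\<Sum>i\<in>F. expectation (\<lambda>\<omega>. X i \<omega> * \<bar>S \<omega>\<bar> powr (q - 1)))"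
    using weighted by (intro Bochner_Integration.integral_sum) auto
  also have "\<dots> \<le> (\<Sum>i\<in>F. C * expectation (\<lambda>\<omega>. \<bar>X i \<omega>\<bar> powr q) + e * (expectation (X i) * expectation (\<lambda>\<omega>. \<bar>S \<omega>\<bar> powr (q - 1))))"
    using weighted by (intro sum_mono) auto
  also have "\<dots> = C * A + e * (m * expectation (\<lambda>\<omega>. \<bar>S \<omega>\<bar> powr (q - 1)))"
    by (simp add: sum.distrib A_def m_def sum_distrib_left sum_distrib_right)
  finally have "q * T \<le> q * (C * A + e * (m * expectation (\<lambda>\<omega>. \<bar>S \<omega>\<bar> powr (q - 1))))"
    using q by (intro mult_left_mono) auto
  then have 1: "q * T \<le> q * (C * A) + e * (q * (m * expectation (\<lambda>\<omega>. \<bar>S \<omega>\<bar> powr (q - 1))))"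
    by (simp add: algebra_simps)
  (* Young's inequality, from the tangent of the power function. *)
  have "q * (m * expectation (\<lambda>\<omega>. \<bar>S \<omega>\<bar> powr (q - 1))) = expectation (\<lambda>\<omega>. q * \<bar>S \<omega>\<bar> powr (q - 1) * m)"
    by simp
  also have "\<dots> \<le> expectation (\<lambda>\<omega>. (q - 1) * \<bar>S \<omega>\<bar> powr q + m powr q)"
  proof (intro integral_mono)
    fix \<omega> assume "\<omega> \<in> space M"
    have "\<bar>S \<omega>\<bar> powr q + q * \<bar>S \<omega>\<bar> powr (q - 1) * (m - \<bar>S \<omega>\<bar>) \<le> m powr q"
      using q m0 by (intro powr_tangent) auto
    moreover have "q * \<bar>S \<omega>\<bar> powr (q - 1) * (m - \<bar>S \<omega>\<bar>)
        = q * \<bar>S \<omega>\<bar> powr (q - 1) * m - q * (\<bar>S \<omega>\<bar> powr (q - 1) * \<bar>S \<omega>\<bar>)"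
      by (simp add: algebra_simps)
    moreover have "\<bar>S \<omega>\<bar> powr (q - 1) * \<bar>S \<omega>\<bar> = \<bar>S \<omega>\<bar> powr q"
      by (intro powr_mult_self) simp
    ultimately show "q * \<bar>S \<omega>\<bar> powr (q - 1) * m \<le> (q - 1) * \<bar>S \<omega>\<bar> powr q + m powr q"
      by (simp add: algebra_simps)
  qed (use intS intS1 in auto)
  also have "\<dots> = (q - 1) * T + m powr q"
    using intS by (simp add: T_def prob_space)
  finally have "e * (q * (m * expectation (\<lambda>\<omega>. \<bar>S \<omega>\<bar> powr (q - 1)))) \<le> e * ((q - 1) * T + m powr q)"
    using eC by (intro mult_left_mono) auto
  with 1 have "T * (q - e * (q - 1)) \<le> q * C * A + e * m powr q"
    by (simp add: algebra_simps)
  moreover have "T = expectation (\<lambda>\<omega>. (\<Sum>i\<in>F. X i \<omega>) powr q)"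
    unfolding T_def S_def using nonneg
    by (intro Bochner_Integration.integral_cong refl) (simp add: sum_nonneg)
  moreover have "A = (\<Sum>i\<in>F. expectation (\<lambda>\<omega>. X i \<omega> powr q))"
    unfolding A_def using nonneg
    by (intro sum.cong Bochner_Integration.integral_cong refl) simp
  ultimately show ?thesis by (simp add: m_def)
qed

text \<open>As \<open>d\<close> tends to 0 from the right, both \<open>(1 + d) powr (q - 1)\<close>
  and the absorbed factor \<open>g d\<close> tend to 1, so their ratio falls below
  \<open>\<theta>\<close>. The resulting \<open>C\<close> depends on \<open>q\<close> and
  \<open>\<theta>\<close> alone, not on the family or the number of summands.\<close>

lemma nonneg_sum_moment_const:
  fixes q \<theta> :: real
  assumes "q \<ge> 1" "\<theta> > 1"
  obtains C where "C > 0" "\<And>(X :: 'i \<Rightarrow> 'a \<Rightarrow> real) F.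
    \<lbrakk>finite F; indep_vars (\<lambda>_. borel) X F; \<And>i. i \<in> F \<Longrightarrow> integrable M (\<lambda>\<omega>. \<bar>X i \<omega>\<bar> powr q);
      \<And>i \<omega>. i \<in> F \<Longrightarrow> \<omega> \<in> space M \<Longrightarrow> 0 \<le> X i \<omega>\<rbrakk> \<Longrightarrow>
    expectation (\<lambda>\<omega>. (\<Sum>i\<in>F. X i \<omega>) powr q)
      \<le> C * (\<Sum>i\<in>F. expectation (\<lambda>\<omega>. X i \<omega> powr q)) + \<theta> * (\<Sum>i\<in>F. expectation (X i)) powr q"
proof -
  define g where "g d = q - (1 + d) powr (q - 1) * (q - 1)" for d :: real
  have lim: "((\<lambda>d::real. (1 + d) powr (q - 1)) \<longlongrightarrow> (1 + 0) powr (q - 1)) (at_right 0)"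
    by (intro tendsto_intros) auto
  then have g: "(g \<longlongrightarrow> 1) (at_right 0)"
    unfolding g_def by (auto intro!: tendsto_eq_intros)
  have "((\<lambda>d. (1 + d) powr (q - 1) / g d) \<longlongrightarrow> 1) (at_right 0)"
    using lim g by (auto intro!: tendsto_eq_intros)
  then have "\<forall>\<^sub>F d in at_right 0. (1 + d) powr (q - 1) / g d < \<theta>"
    using assms(2) by (intro order_tendstoD(2))
  moreover have "\<forall>\<^sub>F d in at_right 0. g d > 0"
    using g by (intro order_tendstoD(1)[of g 1]) auto
  moreover have "\<forall>\<^sub>F d in at_right 0. d > (0::real)"
    by (simp add: eventually_at_right_less)
  ultimately have "\<forall>\<^sub>F d in at_right 0. (1 + d) powr (q - 1) / g d < \<theta> \<and> g d > 0 \<and> d > 0"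
    by eventually_elim auto
  then obtain d where d: "(1 + d) powr (q - 1) / g d < \<theta>" "g d > 0" "d > 0"
    using eventually_happens'[OF trivial_limit_at_right_real] by blast
  define C where "C = q * (1 + 1 / d) powr (q - 1) / g d"
  show ?thesis
  proof (rule that)
    have "1 + 1 / d > 0" using d by (intro add_pos_pos) auto
    then show "C > 0" using d assms by (auto simp: C_def intro!: mult_pos_pos divide_pos_pos)
    fix X :: "'i \<Rightarrow> 'a \<Rightarrow> real" and F
    assume a: "finite F" "indep_vars (\<lambda>_. borel) X F" "\<And>i. i \<in> F \<Longrightarrow> integrable M (\<lambda>\<omega>. \<bar>X i \<omega>\<bar> powr q)"
      "\<And>i \<omega>. i \<in> F \<Longrightarrow> \<omega> \<in> space M \<Longrightarrow> 0 \<le> X i \<omega>"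
    let ?T = "expectation (\<lambda>\<omega>. (\<Sum>i\<in>F. X i \<omega>) powr q)"
    let ?A = "\<Sum>i\<in>F. expectation (\<lambda>\<omega>. X i \<omega> powr q)"
    let ?m = "(\<Sum>i\<in>F. expectation (X i)) powr q"
    have "?T * g d \<le> q * (1 + 1 / d) powr (q - 1) * ?A + (1 + d) powr (q - 1) * ?m"
      using nonneg_sum_moment[OF a(1) assms(1) d(3) a(2-4)] by (simp add: g_def)
    then have "?T \<le> (q * (1 + 1 / d) powr (q - 1) * ?A + (1 + d) powr (q - 1) * ?m) / g d"
      using d(2) by (simp add: pos_le_divide_eq)
    also have "\<dots> = C * ?A + (1 + d) powr (q - 1) / g d * ?m"
      by (simp add: C_def add_divide_distrib)
    also have "\<dots> \<le> C * ?A + \<theta> * ?m"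
      using d by (intro add_left_mono mult_right_mono) auto
    finally show "?T \<le> C * ?A + \<theta> * ?m" .
  qed
qed

end

section \<open>Generations of the tree\<close>

text \<open>The joint law is the product of the marginal laws, so Fubini's theorem applies. The
  outcome \<open>\<omega>'\<close> acts as an independent copy, and the inner integral is the
  conditional expectation given \<open>X\<close>.\<close>

lemma (in prob_space) indep_var_nn_integral:
  assumes ind: "indep_var S X T Y" and g [measurable]: "g \<in> borel_measurable (S \<Otimes>\<^sub>M T)"
  shows "(\<integral>\<^sup>+\<omega>. g (X \<omega>, Y \<omega>) \<partial>M) = (\<integral>\<^sup>+\<omega>. (\<integral>\<^sup>+\<omega>'. g (X \<omega>, Y \<omega>') \<partial>M) \<partial>M)"
proof -
  have [measurable]: "X \<in> measurable M S" "Y \<in> measurable M T"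
    using indep_var_rv1[OF ind] indep_var_rv2[OF ind] by auto
  interpret Y: prob_space "distr M T Y" by (rule prob_space_distr) measurable
  have "(\<integral>\<^sup>+\<omega>. g (X \<omega>, Y \<omega>) \<partial>M) = (\<integral>\<^sup>+z. g z \<partial>distr M (S \<Otimes>\<^sub>M T) (\<lambda>\<omega>. (X \<omega>, Y \<omega>)))"
    by (subst nn_integral_distr) auto
  also have "distr M (S \<Otimes>\<^sub>M T) (\<lambda>\<omega>. (X \<omega>, Y \<omega>)) = distr M S X \<Otimes>\<^sub>M distr M T Y"
    using ind by (simp add: indep_var_distribution_eq)
  also have "(\<integral>\<^sup>+z. g z \<partial>(distr M S X \<Otimes>\<^sub>M distr M T Y))
      = (\<integral>\<^sup>+x. (\<integral>\<^sup>+y. g (x, y) \<partial>distr M T Y) \<partial>distr M S X)"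
    by (subst Y.nn_integral_fst[symmetric]) (auto cong: measurable_cong_sets)
  also have "\<dots> = (\<integral>\<^sup>+x. (\<integral>\<^sup>+\<omega>'. g (x, Y \<omega>') \<partial>M) \<partial>distr M S X)"
    by (intro nn_integral_cong nn_integral_distr) auto
  also have "\<dots> = (\<integral>\<^sup>+\<omega>. (\<integral>\<^sup>+\<omega>'. g (X \<omega>, Y \<omega>') \<partial>M) \<partial>M)"
    by (intro nn_integral_distr) measurable
  finally show ?thesis .
qed

text \<open>Cutting the labels off at \<open>k\<close> makes a generation finite and keeps the tree
  structure: the children with labels below \<open>k\<close> of nodes in \<open>gen n k\<close> form
  exactly \<open>gen (Suc n) k\<close>. Arbitrary finite sets of nodes would not give this
  recursion.\<close>

definition gen :: "nat \<Rightarrow> nat \<Rightarrow> nat list set" where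
  "gen n k = {v. length v = n \<and> set v \<subseteq> {..<k}}"

lemma finite_gen [simp]: "finite (gen n k)"
  using finite_lists_length_eq[of "{..<k}" n] by (simp add: gen_def conj_commute)

lemma gen_0: "gen 0 k = {[]}"
  by (auto simp: gen_def)

lemma gen_mono: "k \<le> j \<Longrightarrow> gen n k \<subseteq> gen n j"
  by (auto simp: gen_def)

lemma length_gen: "v \<in> gen n k \<Longrightarrow> length v = n"
  by (simp add: gen_def)

lemma incseq_sum_gen:
  fixes f :: "nat list \<Rightarrow> real"
  assumes "\<And>v. length v = n \<Longrightarrow> 0 \<le> f v"
  shows "incseq (\<lambda>k. \<Sum>v\<in>gen n k. f v)"
proof (rule incseq_SucI)
  show "(\<Sum>v\<in>gen n k. f v) \<le> (\<Sum>v\<in>gen n (Suc k). f v)" for k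
    using gen_mono[of k "Suc k" n] assms by (intro sum_mono2) (auto dest: length_gen)
qed

lemma sum_gen_Suc: "(\<Sum>v\<in>gen (Suc n) k. f v) = (\<Sum>v\<in>gen n k. \<Sum>i<k. f (v @ [i]))"
proof -
  have "gen (Suc n) k = (\<lambda>(v, i). v @ [i]) ` (gen n k \<times> {..<k})"
  proof (intro set_eqI iffI)
    fix w assume w: "w \<in> gen (Suc n) k"
    then have "w \<noteq> []" by (auto simp: gen_def)
    then obtain v i where vi: "w = v @ [i]" by (metis append_butlast_last_id)
    with w have "(v, i) \<in> gen n k \<times> {..<k}" by (auto simp: gen_def)
    then show "w \<in> (\<lambda>(v, i). v @ [i]) ` (gen n k \<times> {..<k})"
      using vi by force
  qed (auto simp: gen_def)
  then have "(\<Sum>v\<in>gen (Suc n) k. f v) = (\<Sum>(v, i)\<in>gen n k \<times> {..<k}. f (v @ [i]))"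
    by (simp add: sum.reindex inj_on_def case_prod_beta comp_def)
  then show ?thesis by (simp add: sum.cartesian_product)
qed

lemma sum_gen_1: "(\<Sum>v\<in>gen (Suc 0) k. f v) = (\<Sum>i<k. f [i])"
  by (simp add: sum_gen_Suc gen_0)

text \<open>A finite set of nodes uses finitely many labels and hence lies in some
  \<open>gen n k\<close>, so the truncations are cofinal among the finite sets.\<close>

lemma infsum_generation:
  fixes f :: "nat list \<Rightarrow> ennreal"
  shows "(\<Sum>\<^sub>\<infinity>v\<in>{v. length v = n}. f v) = (SUP k. \<Sum>v\<in>gen n k. f v)"
proof -
  have "(\<Sum>\<^sub>\<infinity>v\<in>{v. length v = n}. f v) = (SUP F\<in>{F. finite F \<and> F \<subseteq> {v. length v = n}}. sum f F)"
    by (intro nonneg_infsum_complete) auto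
  also have "\<dots> = (SUP k. \<Sum>v\<in>gen n k. f v)"
  proof (intro antisym SUP_least)
    fix F :: "nat list set" assume F: "F \<in> {F. finite F \<and> F \<subseteq> {v. length v = n}}"
    then have "finite (\<Union>v\<in>F. set v)" by auto
    then obtain k where "(\<Union>v\<in>F. set v) \<subseteq> {..<k}"
      using finite_nat_iff_bounded by auto
    then have "F \<subseteq> gen n k" using F by (auto simp: gen_def)
    then have "sum f F \<le> (\<Sum>v\<in>gen n k. f v)" by (intro sum_mono2) auto
    then show "sum f F \<le> (SUP k. \<Sum>v\<in>gen n k. f v)"
      by (rule SUP_upper2[rotated]) auto
  next
    fix k
    show "(\<Sum>v\<in>gen n k. f v) \<le> (SUP F\<in>{F. finite F \<and> F \<subseteq> {v. length v = n}}. sum f F)"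
      by (rule SUP_upper) (auto simp: length_gen)
  qed
  finally show ?thesis .
qed

(* enn2real sends an infinite total to 0. *)
definition total_weight :: "(nat \<Rightarrow> real) \<Rightarrow> real" where
  "total_weight w = enn2real (SUP k. ennreal (\<Sum>i<k. w i))"

lemma total_weight_measurable [measurable]:
  "total_weight \<in> borel_measurable (Pi\<^sub>M UNIV (\<lambda>_. borel))"
  unfolding total_weight_def by measurable

section \<open>The weight vectors: measurability, common law, conditioning\<close>

context weighted_branching_process
begin

abbreviation weight_space :: "(nat \<Rightarrow> real) measure" where
  "weight_space \<equiv> Pi\<^sub>M UNIV (\<lambda>_. borel)"

lemma weights_measurable [measurable]: "(\<lambda>\<omega> i. L v i \<omega>) \<in> measurable M weight_space"
  using weights_indep by (simp add: indep_vars_def)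

lemma weight_measurable [measurable]: "L v i \<in> borel_measurable M"
  using measurable_compose[OF weights_measurable measurable_component_singleton[of i UNIV]] by simp

lemma node_weight_measurable [measurable]: "node_weight L v \<in> borel_measurable M"
  unfolding node_weight_def by measurable

lemma node_weight_nonneg: "\<omega> \<in> space M \<Longrightarrow> 0 \<le> node_weight L v \<omega>"
  unfolding node_weight_def using weights_nonneg by (intro prod_nonneg) auto

lemma nn_integral_weights_ident:
  assumes [measurable]: "h \<in> borel_measurable weight_space"
  shows "(\<integral>\<^sup>+\<omega>. h (\<lambda>i. L v i \<omega>) \<partial>M) = (\<integral>\<^sup>+\<omega>. h (\<lambda>i. L [] i \<omega>) \<partial>M)"
proof -
  have "(\<integral>\<^sup>+\<omega>. h (\<lambda>i. L v i \<omega>) \<partial>M) = (\<integral>\<^sup>+w. h w \<partial>distr M weight_space (\<lambda>\<omega> i. L v i \<omega>))"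
    by (subst nn_integral_distr) auto
  also have "\<dots> = (\<integral>\<^sup>+w. h w \<partial>distr M weight_space (\<lambda>\<omega> i. L [] i \<omega>))"
    by (subst weights_ident) simp
  also have "\<dots> = (\<integral>\<^sup>+\<omega>. h (\<lambda>i. L [] i \<omega>) \<partial>M)"
    by (subst nn_integral_distr) auto
  finally show ?thesis .
qed

lemma integral_weights_ident:
  fixes h :: "(nat \<Rightarrow> real) \<Rightarrow> real"
  assumes [measurable]: "h \<in> borel_measurable weight_space"
  shows "expectation (\<lambda>\<omega>. h (\<lambda>i. L v i \<omega>)) = expectation (\<lambda>\<omega>. h (\<lambda>i. L [] i \<omega>))"
proof -
  have "expectation (\<lambda>\<omega>. h (\<lambda>i. L v i \<omega>)) = (\<integral>w. h w \<partial>distr M weight_space (\<lambda>\<omega> i. L v i \<omega>))"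
    by (subst integral_distr) auto
  also have "\<dots> = (\<integral>w. h w \<partial>distr M weight_space (\<lambda>\<omega> i. L [] i \<omega>))"
    by (subst weights_ident) simp
  also have "\<dots> = expectation (\<lambda>\<omega>. h (\<lambda>i. L [] i \<omega>))"
    by (subst integral_distr) auto
  finally show ?thesis .
qed

lemma integrable_weights_ident:
  fixes h :: "(nat \<Rightarrow> real) \<Rightarrow> real"
  assumes [measurable]: "h \<in> borel_measurable weight_space"
    and "integrable M (\<lambda>\<omega>. h (\<lambda>i. L [] i \<omega>))"
  shows "integrable M (\<lambda>\<omega>. h (\<lambda>i. L v i \<omega>))"
proof -
  have "integrable M (\<lambda>\<omega>. h (\<lambda>i. L v i \<omega>)) \<longleftrightarrow> integrable (distr M weight_space (\<lambda>\<omega> i. L v i \<omega>)) h" for v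
    by (subst integrable_distr_eq) auto
  then show ?thesis using assms(2) weights_ident[of v] by simp
qed

lemma indep_vars_weights:
  assumes "\<And>v. v \<in> F \<Longrightarrow> g v \<in> borel_measurable weight_space"
  shows "indep_vars (\<lambda>_. borel) (\<lambda>v \<omega>. g v (\<lambda>i. L v i \<omega>)) F"
  using indep_vars_compose2[OF indep_vars_subset[OF weights_indep], of F g "\<lambda>_. borel"] assms
  by simp

(* Conditioning on the first n generations: by Fubini, the weights of the nodes in F may be
   replaced by constants when integrating functions of their children's weights. *)
lemma nn_integral_generation:
  fixes \<theta> :: "real \<Rightarrow> real" and \<Psi> :: "(nat \<Rightarrow> real) \<Rightarrow> real" and \<phi> :: "real \<Rightarrow> ennreal"
  assumes F: "\<And>v. v \<in> F \<Longrightarrow> length v = n"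
    and [measurable]: "\<theta> \<in> borel_measurable borel" "\<Psi> \<in> borel_measurable weight_space" "\<phi> \<in> borel_measurable borel"
  shows "(\<integral>\<^sup>+\<omega>. \<phi> (\<Sum>v\<in>F. \<theta> (node_weight L v \<omega>) * \<Psi> (\<lambda>i. L v i \<omega>)) \<partial>M)
    = (\<integral>\<^sup>+\<omega>. (\<integral>\<^sup>+\<omega>'. \<phi> (\<Sum>v\<in>F. \<theta> (node_weight L v \<omega>) * \<Psi> (\<lambda>i. L v i \<omega>')) \<partial>M) \<partial>M)"
proof -
  \<comment> \<open>\<open>L v\<close> belongs to the edges leaving \<open>v\<close>. The weight of
    a node in generation \<open>n\<close> therefore depends only on the vectors of strictly shorter
    nodes, a block disjoint from that of the nodes of length \<open>n\<close>.\<close>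
  define A B where "A = {v :: nat list. length v < n}" and "B = {v :: nat list. length v = n}"
  let ?P = "\<lambda>_ :: nat list. weight_space"
  define X Y where "X = (\<lambda>\<omega>. \<lambda>v\<in>A. (\<lambda>i. L v i \<omega>))" and "Y = (\<lambda>\<omega>. \<lambda>v\<in>B. (\<lambda>i. L v i \<omega>))"
  have ind: "indep_var (Pi\<^sub>M A ?P) X (Pi\<^sub>M B ?P) Y"
    unfolding X_def Y_def by (rule indep_var_restrict[OF weights_indep]) (auto simp: A_def B_def)
  define g :: "(nat list \<Rightarrow> nat \<Rightarrow> real) \<times> (nat list \<Rightarrow> nat \<Rightarrow> real) \<Rightarrow> ennreal"
    where "g z = \<phi> (\<Sum>v\<in>F. \<theta> (\<Prod>k<length v. fst z (take k v) (v ! k)) * \<Psi> (snd z v))" for z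
  have mX: "(\<lambda>z. fst z (take k v) (v ! k)) \<in> borel_measurable (Pi\<^sub>M A ?P \<Otimes>\<^sub>M Pi\<^sub>M B ?P)"
    if "v \<in> F" "k < length v" for v k
  proof -
    have "take k v \<in> A" using that F by (auto simp: A_def)
    then have "(\<lambda>x. x (take k v)) \<in> measurable (Pi\<^sub>M A ?P) weight_space"
      by (rule measurable_component_singleton)
    from measurable_compose[OF this measurable_component_singleton[of "v ! k" UNIV "\<lambda>_. borel"]]
    show ?thesis by (intro measurable_compose[OF measurable_fst]) simp
  qed
  have mY: "(\<lambda>z. \<Psi> (snd z v)) \<in> borel_measurable (Pi\<^sub>M A ?P \<Otimes>\<^sub>M Pi\<^sub>M B ?P)" if "v \<in> F" for v
  proof -
    have "v \<in> B" using that F by (auto simp: B_def)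
    then have "(\<lambda>x. x v) \<in> measurable (Pi\<^sub>M B ?P) weight_space"
      by (rule measurable_component_singleton)
    from measurable_compose[OF this assms(3)] show ?thesis
      by (intro measurable_compose[OF measurable_snd]) simp
  qed
  have g: "g \<in> borel_measurable (Pi\<^sub>M A ?P \<Otimes>\<^sub>M Pi\<^sub>M B ?P)"
    unfolding g_def
    by (intro measurable_compose[OF _ assms(4)] borel_measurable_sum borel_measurable_times
        measurable_compose[OF _ assms(2)] borel_measurable_prod mX mY) auto
  have eq: "g (X \<omega>, Y \<omega>') = \<phi> (\<Sum>v\<in>F. \<theta> (node_weight L v \<omega>) * \<Psi> (\<lambda>i. L v i \<omega>'))" for \<omega> \<omega>'
  proof -
    have "(\<Prod>k<length v. X \<omega> (take k v) (v ! k)) = node_weight L v \<omega>" "Y \<omega>' v = (\<lambda>i. L v i \<omega>')" if "v \<in> F" for v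
      using F[OF that] by (auto simp: X_def Y_def A_def B_def node_weight_def)
    then show ?thesis unfolding g_def by simp
  qed
  show ?thesis
    using indep_var_nn_integral[OF ind g] by (simp add: eq)
qed

end

text \<open>Two indices are merged into their maximum, where both monotone factors are at least as
  large.\<close>

lemma SUP_mult_incseq:
  fixes f g :: "nat \<Rightarrow> ennreal"
  assumes "incseq f" "incseq g"
  shows "(SUP k. f k * g k) = (SUP k. f k) * (SUP k. g k)"
proof (rule antisym)
  show "(SUP k. f k * g k) \<le> (SUP k. f k) * (SUP k. g k)"
    by (intro SUP_least mult_mono SUP_upper) auto
  have "f i * g j \<le> (SUP k. f k * g k)" for i j
  proof -
    have "f i * g j \<le> f (max i j) * g (max i j)"
      by (rule mult_mono[OF incseqD[OF assms(1)] incseqD[OF assms(2)]]) auto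
    also have "\<dots> \<le> (SUP k. f k * g k)" by (rule SUP_upper) simp
    finally show ?thesis .
  qed
  then show "(SUP k. f k) * (SUP k. g k) \<le> (SUP k. f k * g k)"
    unfolding SUP_mult_left_ennreal SUP_mult_right_ennreal by (intro SUP_least)
qed

lemma SUP_power_incseq:
  fixes f :: "nat \<Rightarrow> ennreal"
  assumes "incseq f"
  shows "(SUP k. f k ^ n) = (SUP k. f k) ^ n"
proof (induction n)
  case (Suc n)
  have "incseq (\<lambda>k. f k ^ n)"
    using assms by (auto simp: incseq_def intro!: power_mono)
  from SUP_mult_incseq[OF assms this] show ?case by (simp add: Suc)
qed simp

lemma ennreal_SUP_finite_LIMSEQ:
  fixes f :: "nat \<Rightarrow> real"
  assumes "incseq f" "\<And>k. 0 \<le> f k" "(SUP k. ennreal (f k)) < \<infinity>"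
  shows "f \<longlonglongrightarrow> enn2real (SUP k. ennreal (f k))"
proof -
  have "(\<lambda>k. ennreal (f k)) \<longlonglongrightarrow> (SUP k. ennreal (f k))"
    using assms(1) by (intro LIMSEQ_SUP) (auto simp: incseq_def intro!: ennreal_leI)
  then have "(\<lambda>k. enn2real (ennreal (f k))) \<longlonglongrightarrow> enn2real (SUP k. ennreal (f k))"
    using assms(3) by (intro tendsto_enn2real) (simp_all add: ennreal_enn2real)
  then show ?thesis using assms(2) by simp
qed

section \<open>Moments of a truncated generation\<close>

context weighted_branching_process
begin

text \<open>The function m(r) of the tree with labels below \<open>k\<close>; it may be infinite,
  and it increases to \<open>moment_fun M L r\<close> as \<open>k\<close> grows.\<close>

definition truncated_moment :: "real \<Rightarrow> nat \<Rightarrow> ennreal" where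
  "truncated_moment r k = (\<integral>\<^sup>+\<omega>. ennreal (\<Sum>i<k. L [] i \<omega> powr r) \<partial>M)"

lemma incseq_truncated_moment: "incseq (truncated_moment r)"
  unfolding truncated_moment_def
  by (intro incseq_SucI nn_integral_mono ennreal_leI sum_mono2) auto

lemma truncated_moment_sum:
  "truncated_moment r k = (\<Sum>i<k. \<integral>\<^sup>+\<omega>. ennreal (L [] i \<omega> powr r) \<partial>M)"
  unfolding truncated_moment_def
  by (subst nn_integral_sum[symmetric]) (auto simp: sum_ennreal)

text \<open>The weight of the edge to a child is independent of the weight of its parent, and its
  law depends only on the label. Summing over parents and labels thus gives one factor
  \<open>truncated_moment r k\<close> per generation.\<close>

lemma generation_moment:
  "(\<integral>\<^sup>+\<omega>. ennreal (\<Sum>v\<in>gen n k. node_weight L v \<omega> powr r) \<partial>M) = truncated_moment r k ^ n"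
proof -
  have "(\<Sum>v\<in>gen n k. \<integral>\<^sup>+\<omega>. ennreal (node_weight L v \<omega> powr r) \<partial>M) = truncated_moment r k ^ n"
  proof (induction n)
    case 0
    then show ?case by (simp add: gen_0 node_weight_Nil emeasure_space_1)
  next
    case (Suc n)
    have "(\<integral>\<^sup>+\<omega>. ennreal (node_weight L (v @ [i]) \<omega> powr r) \<partial>M)
        = (\<integral>\<^sup>+\<omega>. ennreal (node_weight L v \<omega> powr r) \<partial>M) * (\<integral>\<^sup>+\<omega>. ennreal (L [] i \<omega> powr r) \<partial>M)" for v i
    proof -
      have [measurable]: "(\<lambda>w. w i) \<in> borel_measurable weight_space"
        by (rule measurable_component_singleton) simp
      \<comment> \<open>The sum over the single node \<open>v\<close> only brings the expression
        into the form required by \<open>nn_integral_generation\<close>.\<close>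
      have "(\<integral>\<^sup>+\<omega>. ennreal (node_weight L (v @ [i]) \<omega> powr r) \<partial>M)
          = (\<integral>\<^sup>+\<omega>. ennreal (\<bar>\<Sum>u\<in>{v}. node_weight L u \<omega> * L u i \<omega>\<bar> powr r) \<partial>M)"
        using weights_nonneg node_weight_nonneg
        by (intro nn_integral_cong) (simp add: node_weight_snoc mult.commute)
      also have "\<dots> = (\<integral>\<^sup>+\<omega>. (\<integral>\<^sup>+\<omega>'. ennreal (\<bar>\<Sum>u\<in>{v}. node_weight L u \<omega> * L u i \<omega>'\<bar> powr r) \<partial>M) \<partial>M)"
        by (rule nn_integral_generation[where n = "length v" and \<theta> = "\<lambda>x. x" and \<Psi> = "\<lambda>w. w i"
            and \<phi> = "\<lambda>x. ennreal (\<bar>x\<bar> powr r)"]) auto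
      also have "\<dots> = (\<integral>\<^sup>+\<omega>. (\<integral>\<^sup>+\<omega>'. ennreal (node_weight L v \<omega> powr r) * ennreal (L v i \<omega>' powr r) \<partial>M) \<partial>M)"
        using weights_nonneg node_weight_nonneg
        by (intro nn_integral_cong) (simp add: abs_mult powr_mult flip: ennreal_mult)
      also have "\<dots> = (\<integral>\<^sup>+\<omega>. ennreal (node_weight L v \<omega> powr r) \<partial>M) * (\<integral>\<^sup>+\<omega>'. ennreal (L v i \<omega>' powr r) \<partial>M)"
        by (simp add: nn_integral_cmult nn_integral_multc)
      also have "(\<integral>\<^sup>+\<omega>'. ennreal (L v i \<omega>' powr r) \<partial>M) = (\<integral>\<^sup>+\<omega>'. ennreal (L [] i \<omega>' powr r) \<partial>M)"
        using nn_integral_weights_ident[of "\<lambda>w. ennreal (w i powr r)" v] by simp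
      finally show ?thesis .
    qed
    then show ?case
      unfolding sum_gen_Suc using Suc
      by (simp add: truncated_moment_sum mult.commute flip: sum_product)
  qed
  then show ?thesis
    by (subst (asm) nn_integral_sum[symmetric]) (auto simp: sum_ennreal)
qed

lemma moment_fun_SUP: "moment_fun M L r = (SUP k. truncated_moment r k)"
proof -
  have "moment_fun M L r = (\<integral>\<^sup>+\<omega>. (SUP k. ennreal (\<Sum>v\<in>gen 1 k. node_weight L v \<omega> powr r)) \<partial>M)"
    unfolding moment_fun_def infsum_generation by (simp add: sum_ennreal)
  also have "\<dots> = (SUP k. \<integral>\<^sup>+\<omega>. ennreal (\<Sum>v\<in>gen 1 k. node_weight L v \<omega> powr r) \<partial>M)"
    by (intro nn_integral_monotone_convergence_SUP incseq_SucI le_funI ennreal_leI incseq_SucD[OF incseq_sum_gen]) auto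
  also have "\<dots> = (SUP k. truncated_moment r k)"
    unfolding generation_moment by simp
  finally show ?thesis .
qed

lemma truncated_moment_le: "truncated_moment r k \<le> moment_fun M L r"
  unfolding moment_fun_SUP by (rule SUP_upper) simp

lemma generation_sum_SUP:
  assumes "\<omega> \<in> space M"
  shows "generation_sum L n \<omega> = (SUP k. ennreal (\<Sum>v\<in>gen n k. node_weight L v \<omega>))"
  unfolding generation_sum_def infsum_generation using node_weight_nonneg[OF assms] by (simp add: sum_ennreal)

lemma intrinsic_martingale_SUP:
  assumes "\<omega> \<in> space M"
  shows "intrinsic_martingale L n \<omega> = enn2real (SUP k. ennreal (\<Sum>v\<in>gen n k. node_weight L v \<omega>))"
  by (simp add: intrinsic_martingale_def generation_sum_SUP[OF assms])

lemma intrinsic_martingale_measurable [measurable]: "intrinsic_martingale L n \<in> borel_measurable M"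
proof -
  have "(\<lambda>\<omega>. enn2real (SUP k. ennreal (\<Sum>v\<in>gen n k. node_weight L v \<omega>))) \<in> borel_measurable M"
    by measurable
  then show ?thesis
    by (subst measurable_cong[OF intrinsic_martingale_SUP])
qed

lemma martingale_limit_measurable [measurable]: "martingale_limit L \<in> borel_measurable M"
  unfolding martingale_limit_def by measurable

lemma fluctuation_term_measurable [measurable]: "fluctuation_term L a n \<in> borel_measurable M"
  unfolding fluctuation_term_def by measurable

lemma intrinsic_martingale_nonneg: "0 \<le> intrinsic_martingale L n \<omega>"
  by (simp add: intrinsic_martingale_def)

lemma intrinsic_martingale_0: "\<omega> \<in> space M \<Longrightarrow> intrinsic_martingale L 0 \<omega> = 1"
  by (simp add: intrinsic_martingale_SUP gen_0 node_weight_Nil)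

lemma intrinsic_martingale_1:
  "\<omega> \<in> space M \<Longrightarrow> intrinsic_martingale L 1 \<omega> = total_weight (\<lambda>i. L [] i \<omega>)"
  by (simp add: intrinsic_martingale_SUP sum_gen_1 total_weight_def node_weight_def)

lemma total_weight_nonneg: "0 \<le> total_weight w"
  by (simp add: total_weight_def)

end

section \<open>Almost sure finiteness and pathwise limits of the truncations\<close>

context normalized_supercritical_wbp
begin

text \<open>Exponent 1 in \<open>generation_moment\<close>, carried to the whole tree by monotone
  convergence; each generation contributes the factor m(1) = 1.\<close>

lemma nn_integral_generation_sum: "(\<integral>\<^sup>+\<omega>. generation_sum L n \<omega> \<partial>M) = 1"
proof -
  have "(\<integral>\<^sup>+\<omega>. generation_sum L n \<omega> \<partial>M)
      = (\<integral>\<^sup>+\<omega>. (SUP k. ennreal (\<Sum>v\<in>gen n k. node_weight L v \<omega> powr 1)) \<partial>M)"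
    using node_weight_nonneg by (intro nn_integral_cong) (simp add: generation_sum_SUP)
  also have "\<dots> = (SUP k. \<integral>\<^sup>+\<omega>. ennreal (\<Sum>v\<in>gen n k. node_weight L v \<omega> powr 1) \<partial>M)"
    by (intro nn_integral_monotone_convergence_SUP incseq_SucI le_funI ennreal_leI incseq_SucD[OF incseq_sum_gen]) auto
  also have "\<dots> = moment_fun M L 1 ^ n"
    unfolding generation_moment moment_fun_SUP by (rule SUP_power_incseq[OF incseq_truncated_moment])
  finally show ?thesis by (simp add: normalized)
qed

lemma nn_integral_total_weight: "(\<integral>\<^sup>+\<omega>. (SUP k. ennreal (\<Sum>i<k. L v i \<omega>)) \<partial>M) = 1"
proof -
  have "(\<integral>\<^sup>+\<omega>. (SUP k. ennreal (\<Sum>i<k. L v i \<omega>)) \<partial>M) = (\<integral>\<^sup>+\<omega>. (SUP k. ennreal (\<Sum>i<k. L [] i \<omega>)) \<partial>M)"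
    by (rule nn_integral_weights_ident[of "\<lambda>w. SUP k. ennreal (\<Sum>i<k. w i)"]) measurable
  also have "\<dots> = (\<integral>\<^sup>+\<omega>. generation_sum L 1 \<omega> \<partial>M)"
    by (intro nn_integral_cong) (simp add: generation_sum_SUP sum_gen_1 node_weight_def)
  finally show ?thesis by (simp only: nn_integral_generation_sum)
qed

text \<open>Off this event \<open>enn2real\<close> may turn an infinite sum into 0. On it all sums
  in use are genuine limits of their truncations, so relations between successive generations can be
  proved pathwise. Only countably many conditions occur, each of them almost sure because the
  corresponding mean is 1.\<close>

definition regular :: "'a \<Rightarrow> bool" where
  "regular \<omega> \<longleftrightarrow> \<omega> \<in> space M \<and> (\<forall>n. generation_sum L n \<omega> < \<infinity>) \<and> (\<forall>v. (SUP k. ennreal (\<Sum>i<k. L v i \<omega>)) < \<infinity>)"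

lemma AE_regular: "AE \<omega> in M. regular \<omega>"
proof -
  have "AE \<omega> in M. generation_sum L n \<omega> < \<infinity>" for n
  proof -
    have "AE \<omega> in M. (SUP k. ennreal (\<Sum>v\<in>gen n k. node_weight L v \<omega>)) \<noteq> \<infinity>"
    proof (rule nn_integral_PInf_AE)
      show "(\<integral>\<^sup>+\<omega>. (SUP k. ennreal (\<Sum>v\<in>gen n k. node_weight L v \<omega>)) \<partial>M) \<noteq> \<infinity>"
        using nn_integral_generation_sum[of n] by (subst nn_integral_cong[OF generation_sum_SUP[symmetric]]) simp_all
    qed measurable
    then show ?thesis
      using AE_space by eventually_elim (metis generation_sum_SUP infinity_ennreal_def less_top)
  qed
  moreover have "AE \<omega> in M. (SUP k. ennreal (\<Sum>i<k. L v i \<omega>)) < \<infinity>" for v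
  proof -
    have "AE \<omega> in M. (SUP k. ennreal (\<Sum>i<k. L v i \<omega>)) \<noteq> \<infinity>"
    proof (rule nn_integral_PInf_AE)
      show "(\<integral>\<^sup>+\<omega>. (SUP k. ennreal (\<Sum>i<k. L v i \<omega>)) \<partial>M) \<noteq> \<infinity>"
        unfolding nn_integral_total_weight by simp
    qed measurable
    then show ?thesis by eventually_elim (metis infinity_ennreal_def less_top)
  qed
  ultimately show ?thesis
    unfolding regular_def by (intro AE_conjI AE_space AE_all_countable[THEN iffD2] allI)
qed

lemma regular_generation_limit:
  assumes "regular \<omega>"
  shows "(\<lambda>k. \<Sum>v\<in>gen n k. node_weight L v \<omega>) \<longlonglongrightarrow> intrinsic_martingale L n \<omega>"
    and "(\<Sum>v\<in>gen n k. node_weight L v \<omega>) \<le> intrinsic_martingale L n \<omega>"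
proof -
  have w: "\<omega> \<in> space M" using assms by (simp add: regular_def)
  have inc: "incseq (\<lambda>k. \<Sum>v\<in>gen n k. node_weight L v \<omega>)"
    using node_weight_nonneg[OF w] by (intro incseq_sum_gen)
  show lim: "(\<lambda>k. \<Sum>v\<in>gen n k. node_weight L v \<omega>) \<longlonglongrightarrow> intrinsic_martingale L n \<omega>"
    unfolding intrinsic_martingale_SUP[OF w]
  proof (rule ennreal_SUP_finite_LIMSEQ[OF inc])
    show "(SUP k. ennreal (\<Sum>v\<in>gen n k. node_weight L v \<omega>)) < \<infinity>"
      using assms unfolding regular_def generation_sum_SUP[OF w, symmetric] by blast
  qed (simp add: sum_nonneg node_weight_nonneg[OF w])
  show "(\<Sum>v\<in>gen n k. node_weight L v \<omega>) \<le> intrinsic_martingale L n \<omega>"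
    using incseq_le[OF inc lim] .
qed

lemma regular_total_weight_limit:
  assumes "regular \<omega>"
  shows "(\<lambda>k. \<Sum>i<k. L v i \<omega>) \<longlonglongrightarrow> total_weight (\<lambda>i. L v i \<omega>)"
    and "(\<Sum>i<k. L v i \<omega>) \<le> total_weight (\<lambda>i. L v i \<omega>)"
proof -
  have w: "\<omega> \<in> space M" using assms by (simp add: regular_def)
  have inc: "incseq (\<lambda>k. \<Sum>i<k. L v i \<omega>)"
    using weights_nonneg[OF w] by (auto simp: incseq_def intro!: sum_mono2)
  show lim: "(\<lambda>k. \<Sum>i<k. L v i \<omega>) \<longlonglongrightarrow> total_weight (\<lambda>i. L v i \<omega>)"
    unfolding total_weight_def
  proof (rule ennreal_SUP_finite_LIMSEQ[OF inc])
    show "(SUP k. ennreal (\<Sum>i<k. L v i \<omega>)) < \<infinity>"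
      using assms unfolding regular_def by blast
  qed (simp add: sum_nonneg weights_nonneg[OF w])
  show "(\<Sum>i<k. L v i \<omega>) \<le> total_weight (\<lambda>i. L v i \<omega>)"
    using incseq_le[OF inc lim] .
qed

text \<open>In \<open>a n k\<close> the parents are truncated, but each of them keeps all its
  children. This places \<open>a n k\<close> between the truncated and the complete sum of
  generation \<open>n + 1\<close>, and the former converges to the latter.\<close>

lemma regular_next_generation:
  assumes "regular \<omega>"
  defines "a \<equiv> \<lambda>n k. \<Sum>v\<in>gen n k. node_weight L v \<omega> * total_weight (\<lambda>i. L v i \<omega>)"
  shows "a n k \<le> intrinsic_martingale L (Suc n) \<omega>"
    and "a n \<longlonglongrightarrow> intrinsic_martingale L (Suc n) \<omega>"
proof -
  have w: "\<omega> \<in> space M" using assms by (simp add: regular_def)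
  note nn = node_weight_nonneg[OF w] weights_nonneg[OF w]
  show le: "a n k \<le> intrinsic_martingale L (Suc n) \<omega>" for k
  proof (rule LIMSEQ_le_const2)
    show "(\<lambda>j. \<Sum>v\<in>gen n k. node_weight L v \<omega> * (\<Sum>i<j. L v i \<omega>)) \<longlonglongrightarrow> a n k"
      unfolding a_def by (intro tendsto_sum tendsto_mult tendsto_const regular_total_weight_limit assms)
    have "(\<Sum>v\<in>gen n k. node_weight L v \<omega> * (\<Sum>i<j. L v i \<omega>)) \<le> intrinsic_martingale L (Suc n) \<omega>" for j
    proof -
      \<comment> \<open>Raising both cutoffs to \<open>max k j\<close> turns the double sum into a
        single one over \<open>gen (Suc n) (max k j)\<close>.\<close>
      have "(\<Sum>v\<in>gen n k. node_weight L v \<omega> * (\<Sum>i<j. L v i \<omega>))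
          \<le> (\<Sum>v\<in>gen n (max k j). node_weight L v \<omega> * (\<Sum>i<max k j. L v i \<omega>))"
      proof (rule order_trans)
        show "(\<Sum>v\<in>gen n k. node_weight L v \<omega> * (\<Sum>i<j. L v i \<omega>))
            \<le> (\<Sum>v\<in>gen n k. node_weight L v \<omega> * (\<Sum>i<max k j. L v i \<omega>))"
          using nn by (intro sum_mono mult_left_mono sum_mono2) auto
        show "(\<Sum>v\<in>gen n k. node_weight L v \<omega> * (\<Sum>i<max k j. L v i \<omega>))
            \<le> (\<Sum>v\<in>gen n (max k j). node_weight L v \<omega> * (\<Sum>i<max k j. L v i \<omega>))"
          using nn gen_mono[of k "max k j" n] by (intro sum_mono2) (auto intro!: sum_nonneg mult_nonneg_nonneg)
      qed
      also have "\<dots> = (\<Sum>v\<in>gen (Suc n) (max k j). node_weight L v \<omega>)"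
        by (simp add: sum_gen_Suc node_weight_snoc sum_distrib_left mult.commute)
      also have "\<dots> \<le> intrinsic_martingale L (Suc n) \<omega>"
        by (rule regular_generation_limit[OF assms(1)])
      finally show ?thesis .
    qed
    then show "\<exists>N. \<forall>j\<ge>N. (\<Sum>v\<in>gen n k. node_weight L v \<omega> * (\<Sum>i<j. L v i \<omega>)) \<le> intrinsic_martingale L (Suc n) \<omega>"
      by blast
  qed
  have ge: "(\<Sum>v\<in>gen (Suc n) k. node_weight L v \<omega>) \<le> a n k" for k
  proof -
    have "(\<Sum>v\<in>gen (Suc n) k. node_weight L v \<omega>) = (\<Sum>v\<in>gen n k. node_weight L v \<omega> * (\<Sum>i<k. L v i \<omega>))"
      by (simp add: sum_gen_Suc node_weight_snoc sum_distrib_left mult.commute)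
    also have "\<dots> \<le> a n k"
      unfolding a_def using nn regular_total_weight_limit(2)[OF assms(1)] by (intro sum_mono mult_left_mono) auto
    finally show ?thesis .
  qed
  show "a n \<longlonglongrightarrow> intrinsic_martingale L (Suc n) \<omega>"
    by (rule tendsto_sandwich[OF _ _ regular_generation_limit(1)[OF assms(1)] tendsto_const])
       (use le ge in auto)
qed

end

section \<open>Increments of the martingale\<close>

context normalized_supercritical_wbp
begin

text \<open>Only the parents are truncated. Given the first \<open>n\<close> generations this is a
  finite weighted sum of independent centered variables, because \<open>total_weight\<close> retains
  all children and has mean exactly 1; cutting off the children as well could destroy the
  centering.\<close>

definition partial_increment :: "nat \<Rightarrow> nat \<Rightarrow> 'a \<Rightarrow> real" where
  "partial_increment n k \<omega> = (\<Sum>v\<in>gen n k. node_weight L v \<omega> * (total_weight (\<lambda>i. L v i \<omega>) - 1))"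

lemma total_weight_children_measurable [measurable]:
  "(\<lambda>\<omega>. total_weight (\<lambda>i. L v i \<omega>)) \<in> borel_measurable M"
  by (rule measurable_compose[OF weights_measurable total_weight_measurable])

lemma partial_increment_measurable [measurable]: "partial_increment n k \<in> borel_measurable M"
  unfolding partial_increment_def by measurable

text \<open>The truncated increment is a difference of two nonnegative sums, each bounded by its
  limit. The resulting bound is uniform in \<open>k\<close> and provides the majorant for dominated
  convergence.\<close>

lemma regular_increment:
  assumes "regular \<omega>"
  shows "(\<lambda>k. partial_increment n k \<omega>) \<longlonglongrightarrow> intrinsic_martingale L (Suc n) \<omega> - intrinsic_martingale L n \<omega>"
    and "\<bar>partial_increment n k \<omega>\<bar> \<le> intrinsic_martingale L (Suc n) \<omega> + intrinsic_martingale L n \<omega>"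
proof -
  have w: "\<omega> \<in> space M" using assms by (simp add: regular_def)
  define a b where "a k = (\<Sum>v\<in>gen n k. node_weight L v \<omega> * total_weight (\<lambda>i. L v i \<omega>))"
    and "b k = (\<Sum>v\<in>gen n k. node_weight L v \<omega>)" for k
  have ab: "partial_increment n k \<omega> = a k - b k" for k
    by (simp add: partial_increment_def a_def b_def right_diff_distrib sum_subtractf)
  have nn: "0 \<le> a k" "0 \<le> b k" for k
    unfolding a_def b_def using node_weight_nonneg[OF w] total_weight_nonneg
    by (simp_all add: sum_nonneg)
  show "(\<lambda>k. partial_increment n k \<omega>) \<longlonglongrightarrow> intrinsic_martingale L (Suc n) \<omega> - intrinsic_martingale L n \<omega>"
    unfolding ab using regular_next_generation(2)[OF assms, of n] regular_generation_limit(1)[OF assms, of n]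
    by (intro tendsto_diff) (simp_all add: a_def b_def)
  have "a k \<le> intrinsic_martingale L (Suc n) \<omega>" "b k \<le> intrinsic_martingale L n \<omega>"
    unfolding a_def b_def
    by (rule regular_next_generation(1)[OF assms] regular_generation_limit(2)[OF assms])+
  then show "\<bar>partial_increment n k \<omega>\<bar> \<le> intrinsic_martingale L (Suc n) \<omega> + intrinsic_martingale L n \<omega>"
    unfolding ab using nn[of k] by linarith
qed

lemma total_weight_expectation:
  "integrable M (\<lambda>\<omega>. total_weight (\<lambda>i. L v i \<omega>))" "expectation (\<lambda>\<omega>. total_weight (\<lambda>i. L v i \<omega>)) = 1"
proof -
  have "(\<integral>\<^sup>+\<omega>. ennreal (total_weight (\<lambda>i. L v i \<omega>)) \<partial>M) = (\<integral>\<^sup>+\<omega>. (SUP k. ennreal (\<Sum>i<k. L v i \<omega>)) \<partial>M)"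
    using AE_regular
    by (intro nn_integral_cong_AE) (auto simp: regular_def total_weight_def ennreal_enn2real)
  then have *: "(\<integral>\<^sup>+\<omega>. ennreal (total_weight (\<lambda>i. L v i \<omega>)) \<partial>M) = ennreal 1"
    unfolding nn_integral_total_weight by simp
  show "integrable M (\<lambda>\<omega>. total_weight (\<lambda>i. L v i \<omega>))" "expectation (\<lambda>\<omega>. total_weight (\<lambda>i. L v i \<omega>)) = 1"
    using nn_integral_eq_integrable[THEN iffD1, OF _ _ _ *] total_weight_nonneg by auto
qed

text \<open>Once the first generations are fixed, the node weights act as constants
  \<open>c\<close>, and these are the facts that the inequalities for centered sums ask for. The
  order \<open>s\<close> is kept apart from \<open>r\<close> because Rosenthal's inequality
  evaluates moments of orders 2 and p.\<close>

lemma scaled_offspring: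
  fixes c :: "nat list \<Rightarrow> real"
  assumes r: "r \<ge> 1"
    and int: "integrable M (\<lambda>\<omega>. \<bar>total_weight (\<lambda>i. L [] i \<omega>) - 1\<bar> powr r)"
  defines "Y \<equiv> \<lambda>v \<omega>. c v * (total_weight (\<lambda>i. L v i \<omega>) - 1)"
  shows "indep_vars (\<lambda>_. borel) Y F"
    and "integrable M (\<lambda>\<omega>. \<bar>Y v \<omega>\<bar> powr r)"
    and "expectation (Y v) = 0"
    and "0 \<le> s \<Longrightarrow> expectation (\<lambda>\<omega>. \<bar>Y v \<omega>\<bar> powr s)
        = \<bar>c v\<bar> powr s * expectation (\<lambda>\<omega>. \<bar>total_weight (\<lambda>i. L [] i \<omega>) - 1\<bar> powr s)"
proof -
  show "indep_vars (\<lambda>_. borel) Y F"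
    unfolding Y_def by (rule indep_vars_weights) measurable
  have "integrable M (\<lambda>\<omega>. \<bar>total_weight (\<lambda>i. L v i \<omega>) - 1\<bar> powr r)"
    by (rule integrable_weights_ident[of "\<lambda>w. \<bar>total_weight w - 1\<bar> powr r", OF _ int]) measurable
  then show "integrable M (\<lambda>\<omega>. \<bar>Y v \<omega>\<bar> powr r)"
    unfolding Y_def by (simp add: abs_mult powr_mult)
  show "expectation (Y v) = 0"
    unfolding Y_def using total_weight_expectation[of v] by (simp add: prob_space)
  have "expectation (\<lambda>\<omega>. \<bar>total_weight (\<lambda>i. L v i \<omega>) - 1\<bar> powr s)
      = expectation (\<lambda>\<omega>. \<bar>total_weight (\<lambda>i. L [] i \<omega>) - 1\<bar> powr s)"
    by (rule integral_weights_ident) measurable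
  then show "expectation (\<lambda>\<omega>. \<bar>Y v \<omega>\<bar> powr s)
        = \<bar>c v\<bar> powr s * expectation (\<lambda>\<omega>. \<bar>total_weight (\<lambda>i. L [] i \<omega>) - 1\<bar> powr s)"
    unfolding Y_def by (simp add: abs_mult powr_mult)
qed

lemma nn_integral_partial_increment:
  assumes [measurable]: "\<phi> \<in> borel_measurable borel"
  shows "(\<integral>\<^sup>+\<omega>. \<phi> (partial_increment n k \<omega>) \<partial>M) =
    (\<integral>\<^sup>+\<omega>. (\<integral>\<^sup>+\<omega>'. \<phi> (\<Sum>v\<in>gen n k. node_weight L v \<omega> * (total_weight (\<lambda>i. L v i \<omega>') - 1)) \<partial>M) \<partial>M)"
  unfolding partial_increment_def
  by (rule nn_integral_generation[where n = n and \<theta> = "\<lambda>x. x" and \<Psi> = "\<lambda>w. total_weight w - 1"])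
     (auto simp: length_gen)

section \<open>Lower bound for the increments\<close>

text \<open>\<open>centered_sum_lower\<close> is applied conditionally, with the node weights as
  coefficients; the remainder \<open>2 * \<bar>y / 2\<bar> powr r\<close> of the expansion explains
  the shape of \<open>c\<close>. Integrating the r-th powers of the node weights then gives
  \<open>truncated_moment r k ^ n\<close>.\<close>

lemma partial_increment_lower:
  assumes r: "r \<ge> 2"
    and int: "integrable M (\<lambda>\<omega>. \<bar>total_weight (\<lambda>i. L [] i \<omega>) - 1\<bar> powr r)"
  defines "c \<equiv> 2 * ((1 / 2) powr r * expectation (\<lambda>\<omega>. \<bar>total_weight (\<lambda>i. L [] i \<omega>) - 1\<bar> powr r))"
  shows "ennreal c * truncated_moment r k ^ n \<le> (\<integral>\<^sup>+\<omega>. ennreal (\<bar>partial_increment n k \<omega>\<bar> powr r) \<partial>M)"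
proof -
  have r1: "r \<ge> 1" using r by simp
  have c: "c \<ge> 0" unfolding c_def by simp
  have "ennreal c * truncated_moment r k ^ n
      = (\<integral>\<^sup>+\<omega>. ennreal c * ennreal (\<Sum>v\<in>gen n k. node_weight L v \<omega> powr r) \<partial>M)"
    unfolding generation_moment[symmetric] by (simp add: nn_integral_cmult)
  also have "\<dots> \<le> (\<integral>\<^sup>+\<omega>. (\<integral>\<^sup>+\<omega>'. ennreal (\<bar>\<Sum>v\<in>gen n k. node_weight L v \<omega> * (total_weight (\<lambda>i. L v i \<omega>') - 1)\<bar> powr r) \<partial>M) \<partial>M)"
  proof (rule nn_integral_mono)
    fix \<omega> assume w: "\<omega> \<in> space M"
    define Y where "Y v \<omega>' = node_weight L v \<omega> * (total_weight (\<lambda>i. L v i \<omega>') - 1)" for v \<omega>'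
    note Y = scaled_offspring[OF r1 int, where c = "\<lambda>v. node_weight L v \<omega>", folded Y_def]
    have half: "expectation (\<lambda>\<omega>'. \<bar>Y v \<omega>' / 2\<bar> powr r) = node_weight L v \<omega> powr r * (c / 2)" for v
    proof -
      have "expectation (\<lambda>\<omega>'. \<bar>Y v \<omega>' / 2\<bar> powr r) = (1 / 2) powr r * expectation (\<lambda>\<omega>'. \<bar>Y v \<omega>'\<bar> powr r)"
        by (simp add: powr_divide)
      also have "\<dots> = node_weight L v \<omega> powr r * (c / 2)"
        using r node_weight_nonneg[OF w] by (subst Y(4)) (simp_all add: c_def)
      finally show ?thesis .
    qed
    have meas: "Y v \<in> borel_measurable M" for v
      unfolding Y_def by measurable
    have "2 * (\<Sum>v\<in>gen n k. expectation (\<lambda>\<omega>'. \<bar>Y v \<omega>' / 2\<bar> powr r)) \<le> expectation (\<lambda>\<omega>'. \<bar>\<Sum>v\<in>gen n k. Y v \<omega>'\<bar> powr r)"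
      by (rule centered_sum_lower[OF finite_gen r Y(1)]) (use Y(2,3) in auto)
    then have "c * (\<Sum>v\<in>gen n k. node_weight L v \<omega> powr r) \<le> expectation (\<lambda>\<omega>'. \<bar>\<Sum>v\<in>gen n k. Y v \<omega>'\<bar> powr r)"
      unfolding half sum_distrib_right[symmetric] by (simp add: mult.commute)
    then have "ennreal (c * (\<Sum>v\<in>gen n k. node_weight L v \<omega> powr r)) \<le> ennreal (expectation (\<lambda>\<omega>'. \<bar>\<Sum>v\<in>gen n k. Y v \<omega>'\<bar> powr r))"
      by (rule ennreal_leI)
    also have "\<dots> = (\<integral>\<^sup>+\<omega>'. ennreal (\<bar>\<Sum>v\<in>gen n k. Y v \<omega>'\<bar> powr r) \<partial>M)"
      using r by (intro nn_integral_eq_integral[symmetric] integrable_abs_sum_powr meas Y(2)) auto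
    finally show "ennreal c * ennreal (\<Sum>v\<in>gen n k. node_weight L v \<omega> powr r)
        \<le> (\<integral>\<^sup>+\<omega>'. ennreal (\<bar>\<Sum>v\<in>gen n k. node_weight L v \<omega> * (total_weight (\<lambda>i. L v i \<omega>') - 1)\<bar> powr r) \<partial>M)"
      using c by (simp add: ennreal_mult sum_nonneg Y_def)
  qed
  also have "\<dots> = (\<integral>\<^sup>+\<omega>. ennreal (\<bar>partial_increment n k \<omega>\<bar> powr r) \<partial>M)"
    by (rule nn_integral_partial_increment[symmetric, where \<phi> = "\<lambda>x. ennreal (\<bar>x\<bar> powr r)"]) measurable
  finally show ?thesis .
qed

lemma integrable_offspring_centered:
  assumes "r \<ge> 1" "integrable M (\<lambda>\<omega>. intrinsic_martingale L 1 \<omega> powr r)"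
  shows "integrable M (\<lambda>\<omega>. \<bar>total_weight (\<lambda>i. L [] i \<omega>) - 1\<bar> powr r)"
proof -
  have "integrable M (\<lambda>\<omega>. \<bar>total_weight (\<lambda>i. L [] i \<omega>)\<bar> powr r)"
    using assms(2) total_weight_nonneg
    by (subst Bochner_Integration.integrable_cong[OF refl, where g = "\<lambda>\<omega>. intrinsic_martingale L 1 \<omega> powr r"])
       (simp_all only: intrinsic_martingale_1 abs_of_nonneg)
  from integrable_abs_add_powr[OF _ _ this, of "\<lambda>_. - 1"] assms(1) show ?thesis
    by simp
qed

text \<open>Fatou's lemma points the wrong way for a lower bound, so \<open>k\<close> tends to
  infinity by dominated convergence. The majorant is built from \<open>W_n\<close> and
  \<open>W_(n+1)\<close>, which is why integrability is assumed in every generation.\<close>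

lemma increment_lower:
  assumes r: "r \<ge> 2"
    and int: "\<And>n. integrable M (\<lambda>\<omega>. intrinsic_martingale L n \<omega> powr r)"
  defines "c \<equiv> 2 * ((1 / 2) powr r * expectation (\<lambda>\<omega>. \<bar>total_weight (\<lambda>i. L [] i \<omega>) - 1\<bar> powr r))"
  shows "ennreal c * moment_fun M L r ^ n
    \<le> (\<integral>\<^sup>+\<omega>. ennreal (\<bar>intrinsic_martingale L (Suc n) \<omega> - intrinsic_martingale L n \<omega>\<bar> powr r) \<partial>M)"
proof -
  let ?W = "intrinsic_martingale L"
  have r0: "r \<ge> 1" "r > 0" "r \<ge> 0" using r by auto
  note offspring = integrable_offspring_centered[OF r0(1) int]
  have lim: "(\<lambda>k. \<integral>\<^sup>+\<omega>. ennreal (\<bar>partial_increment n k \<omega>\<bar> powr r) \<partial>M)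
      \<longlonglongrightarrow> (\<integral>\<^sup>+\<omega>. ennreal (\<bar>?W (Suc n) \<omega> - ?W n \<omega>\<bar> powr r) \<partial>M)"
  proof (rule nn_integral_dominated_convergence)
    show "AE \<omega> in M. ennreal (\<bar>partial_increment n k \<omega>\<bar> powr r)
        \<le> ennreal (2 powr r * (?W (Suc n) \<omega> powr r + ?W n \<omega> powr r))" for k
      using AE_regular
    proof eventually_elim
      case (elim \<omega>)
      have "\<bar>partial_increment n k \<omega>\<bar> powr r \<le> (?W (Suc n) \<omega> + ?W n \<omega>) powr r"
        using regular_increment(2)[OF elim] r0 by (intro powr_mono2) auto
      also have "\<dots> \<le> 2 powr r * (?W (Suc n) \<omega> powr r + ?W n \<omega> powr r)"
        using r0 intrinsic_martingale_nonneg by (intro powr_add_le_max) auto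
      finally show ?case by (rule ennreal_leI)
    qed
    show "(\<integral>\<^sup>+\<omega>. ennreal (2 powr r * (?W (Suc n) \<omega> powr r + ?W n \<omega> powr r)) \<partial>M) < \<infinity>"
      using int[of n] int[of "Suc n"] by (subst nn_integral_eq_integral) auto
    show "AE \<omega> in M. (\<lambda>k. ennreal (\<bar>partial_increment n k \<omega>\<bar> powr r)) \<longlonglongrightarrow> ennreal (\<bar>?W (Suc n) \<omega> - ?W n \<omega>\<bar> powr r)"
      using AE_regular
    proof eventually_elim
      case (elim \<omega>)
      show ?case
        using r0 by (intro tendsto_ennrealI tendsto_powr2 tendsto_rabs tendsto_const regular_increment(1)[OF elim]) auto
    qed
  qed measurable
  \<comment> \<open>The cutoff \<open>j\<close> on the left stays fixed while \<open>k\<close> grows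
    on the right; the supremum over \<open>j\<close> is taken last.\<close>
  have "ennreal c * truncated_moment r j ^ n \<le> (\<integral>\<^sup>+\<omega>. ennreal (\<bar>?W (Suc n) \<omega> - ?W n \<omega>\<bar> powr r) \<partial>M)" for j
  proof (rule LIMSEQ_le_const[OF lim], intro exI[of _ j] allI impI)
    fix k assume "j \<le> k"
    then have "ennreal c * truncated_moment r j ^ n \<le> ennreal c * truncated_moment r k ^ n"
      by (intro mult_left_mono power_mono incseqD[OF incseq_truncated_moment]) auto
    also have "\<dots> \<le> (\<integral>\<^sup>+\<omega>. ennreal (\<bar>partial_increment n k \<omega>\<bar> powr r) \<partial>M)"
      unfolding c_def by (rule partial_increment_lower[OF r offspring])
    finally show "ennreal c * truncated_moment r j ^ n \<le> (\<integral>\<^sup>+\<omega>. ennreal (\<bar>partial_increment n k \<omega>\<bar> powr r) \<partial>M)" .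
  qed
  then show ?thesis
    unfolding moment_fun_SUP SUP_power_incseq[OF incseq_truncated_moment, symmetric] SUP_mult_left_ennreal
    by (rule SUP_least)
qed

end

section \<open>Upper bound for the increments\<close>

lemma square_powr: "0 \<le> c \<Longrightarrow> (c\<^sup>2) powr q = c powr (2 * q)" for c q :: real
  by (cases "c = 0") (simp_all add: powr_powr flip: powr_numeral)

context normalized_supercritical_wbp
begin

text \<open>Rosenthal's inequality conditionally on the first \<open>n\<close> generations. The
  conditional variance is a multiple of the random sum of squared node weights, so its power p/2
  survives as a moment of its own. The constant does not depend on \<open>n\<close> and
  \<open>k\<close>.\<close>

lemma partial_increment_upper:
  assumes p: "p \<ge> 2"
    and int: "integrable M (\<lambda>\<omega>. \<bar>total_weight (\<lambda>i. L [] i \<omega>) - 1\<bar> powr p)"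
  obtains C where "C \<ge> 0" "\<And>n k. (\<integral>\<^sup>+\<omega>. ennreal (\<bar>partial_increment n k \<omega>\<bar> powr p) \<partial>M)
    \<le> ennreal C * (truncated_moment p k ^ n + (\<integral>\<^sup>+\<omega>. ennreal ((\<Sum>v\<in>gen n k. (node_weight L v \<omega>)\<^sup>2) powr (p / 2)) \<partial>M))"
proof
  define K where "K = p\<^sup>2 * 2 powr p"
  define \<kappa> where "\<kappa> = expectation (\<lambda>\<omega>. \<bar>total_weight (\<lambda>i. L [] i \<omega>) - 1\<bar> powr p)"
  define \<sigma> where "\<sigma> = expectation (\<lambda>\<omega>. \<bar>total_weight (\<lambda>i. L [] i \<omega>) - 1\<bar> powr 2)"
  \<comment> \<open>The sum of the two coefficients in Rosenthal's inequality, so that one constant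
    serves both terms.\<close>
  define C where "C = 2 * K * \<kappa> + (2 * K * \<sigma>) powr (p / 2)"
  have nn: "K \<ge> 0" "\<kappa> \<ge> 0" "\<sigma> \<ge> 0" using p by (simp_all add: K_def \<kappa>_def \<sigma>_def)
  show C: "C \<ge> 0" using nn by (simp add: C_def)
  have p1: "p \<ge> 1" using p by simp
  fix n k
  let ?A = "\<lambda>\<omega>. \<Sum>v\<in>gen n k. node_weight L v \<omega> powr p"
  let ?B = "\<lambda>\<omega>. (\<Sum>v\<in>gen n k. (node_weight L v \<omega>)\<^sup>2) powr (p / 2)"
  have "(\<integral>\<^sup>+\<omega>. ennreal (\<bar>partial_increment n k \<omega>\<bar> powr p) \<partial>M)
    = (\<integral>\<^sup>+\<omega>. (\<integral>\<^sup>+\<omega>'. ennreal (\<bar>\<Sum>v\<in>gen n k. node_weight L v \<omega> * (total_weight (\<lambda>i. L v i \<omega>') - 1)\<bar> powr p) \<partial>M) \<partial>M)"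
    by (rule nn_integral_partial_increment[where \<phi> = "\<lambda>x. ennreal (\<bar>x\<bar> powr p)"]) measurable
  also have "\<dots> \<le> (\<integral>\<^sup>+\<omega>. ennreal C * (ennreal (?A \<omega>) + ennreal (?B \<omega>)) \<partial>M)"
  proof (rule nn_integral_mono)
    fix \<omega> assume w: "\<omega> \<in> space M"
    define Y where "Y v \<omega>' = node_weight L v \<omega> * (total_weight (\<lambda>i. L v i \<omega>') - 1)" for v \<omega>'
    note Y = scaled_offspring[OF p1 int, where c = "\<lambda>v. node_weight L v \<omega>", folded Y_def]
    have meas: "Y v \<in> borel_measurable M" for v
      unfolding Y_def by measurable
    have A: "expectation (\<lambda>\<omega>'. \<bar>Y v \<omega>'\<bar> powr p) = node_weight L v \<omega> powr p * \<kappa>" for v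
      using p node_weight_nonneg[OF w] by (subst Y(4)) (simp_all add: \<kappa>_def)
    have B: "expectation (\<lambda>\<omega>'. (Y v \<omega>')\<^sup>2) = (node_weight L v \<omega>)\<^sup>2 * \<sigma>" for v
      using Y(4)[of 2 v] by (simp add: \<sigma>_def powr_numeral)
    have "expectation (\<lambda>\<omega>'. \<bar>\<Sum>v\<in>gen n k. Y v \<omega>'\<bar> powr p)
        \<le> 2 * K * (\<Sum>v\<in>gen n k. expectation (\<lambda>\<omega>'. \<bar>Y v \<omega>'\<bar> powr p))
          + (2 * K * (\<Sum>v\<in>gen n k. expectation (\<lambda>\<omega>'. (Y v \<omega>')\<^sup>2))) powr (p / 2)"
      unfolding K_def by (rule centered_sum_rosenthal[OF finite_gen p Y(1)]) (use Y(2,3) in auto)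
    also have "\<dots> = 2 * K * \<kappa> * ?A \<omega> + (2 * K * \<sigma>) powr (p / 2) * ?B \<omega>"
    proof -
      have "(2 * K * ((\<Sum>v\<in>gen n k. (node_weight L v \<omega>)\<^sup>2) * \<sigma>)) powr (p / 2)
          = ((2 * K * \<sigma>) * (\<Sum>v\<in>gen n k. (node_weight L v \<omega>)\<^sup>2)) powr (p / 2)"
        by (simp add: mult.assoc mult.left_commute mult.commute)
      also have "\<dots> = (2 * K * \<sigma>) powr (p / 2) * ?B \<omega>"
        using nn by (intro powr_mult)
      finally show ?thesis
        unfolding A B sum_distrib_right[symmetric] by simp
    qed
    also have "\<dots> \<le> C * ?A \<omega> + C * ?B \<omega>"
      using nn by (intro add_mono mult_right_mono) (simp_all add: C_def sum_nonneg)
    finally have "ennreal (expectation (\<lambda>\<omega>'. \<bar>\<Sum>v\<in>gen n k. Y v \<omega>'\<bar> powr p)) \<le> ennreal (C * ?A \<omega> + C * ?B \<omega>)"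
      by (rule ennreal_leI)
    moreover have "ennreal (expectation (\<lambda>\<omega>'. \<bar>\<Sum>v\<in>gen n k. Y v \<omega>'\<bar> powr p)) = (\<integral>\<^sup>+\<omega>'. ennreal (\<bar>\<Sum>v\<in>gen n k. Y v \<omega>'\<bar> powr p) \<partial>M)"
      using p by (intro nn_integral_eq_integral[symmetric] integrable_abs_sum_powr meas Y(2)) auto
    moreover have "ennreal (C * ?A \<omega> + C * ?B \<omega>) = ennreal C * (ennreal (?A \<omega>) + ennreal (?B \<omega>))"
      using C by (simp add: sum_nonneg distrib_left flip: ennreal_plus ennreal_mult)
    ultimately show "(\<integral>\<^sup>+\<omega>'. ennreal (\<bar>\<Sum>v\<in>gen n k. node_weight L v \<omega> * (total_weight (\<lambda>i. L v i \<omega>') - 1)\<bar> powr p) \<partial>M)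
        \<le> ennreal C * (ennreal (?A \<omega>) + ennreal (?B \<omega>))"
      by (simp add: Y_def)
  qed
  also have "\<dots> = ennreal C * (truncated_moment p k ^ n + (\<integral>\<^sup>+\<omega>. ennreal (?B \<omega>) \<partial>M))"
    unfolding generation_moment[symmetric] by (simp add: nn_integral_cmult nn_integral_add)
  finally show "(\<integral>\<^sup>+\<omega>. ennreal (\<bar>partial_increment n k \<omega>\<bar> powr p) \<partial>M)
    \<le> ennreal C * (truncated_moment p k ^ n + (\<integral>\<^sup>+\<omega>. ennreal (?B \<omega>) \<partial>M))" .
qed

text \<open>A sum of squares of nonnegative numbers is at most the square of their sum. The bound is
  independent of \<open>k\<close>; through it the moment of order \<open>2 * q\<close> of
  \<open>W_1\<close> enters the recursion.\<close>

lemma sum_squares_children_bound: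
  assumes "regular \<omega>" "q \<ge> 1"
  shows "(\<Sum>i<k. (L [] i \<omega>)\<^sup>2) powr q \<le> intrinsic_martingale L 1 \<omega> powr (2 * q)"
proof -
  have w: "\<omega> \<in> space M" using assms by (simp add: regular_def)
  have "(\<Sum>i<k. (L [] i \<omega>)\<^sup>2) \<le> (\<Sum>i<k. L [] i \<omega>)\<^sup>2"
    using powr_sum_superadditive[of 2 "{..<k}" "\<lambda>i. L [] i \<omega>"] weights_nonneg[OF w]
    by (simp add: powr_numeral sum_nonneg)
  also have "\<dots> \<le> (total_weight (\<lambda>i. L [] i \<omega>))\<^sup>2"
    using regular_total_weight_limit(2)[OF assms(1)] weights_nonneg[OF w]
    by (intro power_mono sum_nonneg) auto
  finally have "(\<Sum>i<k. (L [] i \<omega>)\<^sup>2) powr q \<le> ((total_weight (\<lambda>i. L [] i \<omega>))\<^sup>2) powr q"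
    using assms(2) by (intro powr_mono2 sum_nonneg) auto
  also have "\<dots> = intrinsic_martingale L 1 \<omega> powr (2 * q)"
    unfolding intrinsic_martingale_1[OF w] using total_weight_nonneg by (rule square_powr)
  finally show ?thesis .
qed

text \<open>Grouped by parents, the squared weights of generation \<open>n + 1\<close> are, given
  the first \<open>n\<close> generations, a sum of independent nonnegative variables whose
  conditional mean is at most \<open>m2\<close> times the previous sum of squares. In
  \<open>nonneg_sum_moment_const\<close> the power of this mean yields the leading coefficient, and
  the moments of the single summands yield the inhomogeneity.\<close>

lemma square_sum_recursion:
  assumes q: "q \<ge> 1" and \<theta>: "\<theta> > 1"
    and int: "integrable M (\<lambda>\<omega>. intrinsic_martingale L 1 \<omega> powr (2 * q))"
    and m2: "moment_fun M L 2 = ennreal m2" "m2 \<ge> 0"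
  defines "U \<equiv> \<lambda>n k. \<integral>\<^sup>+\<omega>. ennreal ((\<Sum>v\<in>gen n k. (node_weight L v \<omega>)\<^sup>2) powr q) \<partial>M"
  obtains C where "C \<ge> 0" "\<And>n k. U (Suc n) k \<le> ennreal C * truncated_moment (2 * q) k ^ n + ennreal (\<theta> * m2 powr q) * U n k"
\<comment> \<open>The constant is obtained before \<open>n\<close>, \<open>k\<close> and the outcome
  conditioned on are fixed, hence it is uniform in all of them.\<close>
proof (rule nonneg_sum_moment_const[OF q \<theta>])
  fix C0 assume C0: "C0 > 0" "\<And>(X :: nat list \<Rightarrow> 'a \<Rightarrow> real) F.
    \<lbrakk>finite F; indep_vars (\<lambda>_. borel) X F; \<And>i. i \<in> F \<Longrightarrow> integrable M (\<lambda>\<omega>. \<bar>X i \<omega>\<bar> powr q);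
      \<And>i \<omega>. i \<in> F \<Longrightarrow> \<omega> \<in> space M \<Longrightarrow> 0 \<le> X i \<omega>\<rbrakk> \<Longrightarrow>
    expectation (\<lambda>\<omega>. (\<Sum>i\<in>F. X i \<omega>) powr q)
      \<le> C0 * (\<Sum>i\<in>F. expectation (\<lambda>\<omega>. X i \<omega> powr q)) + \<theta> * (\<Sum>i\<in>F. expectation (X i)) powr q"
  define \<kappa> where "\<kappa> = expectation (\<lambda>\<omega>. intrinsic_martingale L 1 \<omega> powr (2 * q))"
  have \<kappa>: "\<kappa> \<ge> 0" by (simp add: \<kappa>_def)
  define C where "C = C0 * \<kappa>"
  have C: "C \<ge> 0" using C0(1) \<kappa> by (simp add: C_def)
  show thesis
  proof (rule that[OF C])
    fix n k
    define \<Psi> where "\<Psi> w = (\<Sum>i<k. (w i)\<^sup>2)" for w :: "nat \<Rightarrow> real"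
    have \<Psi>_meas [measurable]: "\<Psi> \<in> borel_measurable weight_space"
      unfolding \<Psi>_def by measurable
    have \<Psi>_children [measurable]: "(\<lambda>\<omega>. \<Psi> (\<lambda>i. L v i \<omega>)) \<in> borel_measurable M" for v
      by (rule measurable_compose[OF weights_measurable \<Psi>_meas])
    have \<Psi>_nonneg: "0 \<le> \<Psi> w" for w
      unfolding \<Psi>_def by (simp add: sum_nonneg)
    have \<Psi>_powr_root: "integrable M (\<lambda>\<omega>. \<bar>\<Psi> (\<lambda>i. L [] i \<omega>)\<bar> powr q)"
    proof (rule Bochner_Integration.integrable_bound[OF int])
      show "AE \<omega> in M. norm (\<bar>\<Psi> (\<lambda>i. L [] i \<omega>)\<bar> powr q) \<le> norm (intrinsic_martingale L 1 \<omega> powr (2 * q))"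
        using AE_regular
      proof eventually_elim
        case (elim \<omega>)
        show ?case
          using sum_squares_children_bound[OF elim q, of k] by (simp add: \<Psi>_def sum_nonneg)
      qed
    qed measurable
    have \<Psi>_powr: "integrable M (\<lambda>\<omega>. \<bar>\<Psi> (\<lambda>i. L v i \<omega>)\<bar> powr q)"
      "expectation (\<lambda>\<omega>. \<bar>\<Psi> (\<lambda>i. L v i \<omega>)\<bar> powr q) \<le> \<kappa>" for v
    proof -
      show "integrable M (\<lambda>\<omega>. \<bar>\<Psi> (\<lambda>i. L v i \<omega>)\<bar> powr q)"
        by (rule integrable_weights_ident[of "\<lambda>w. \<bar>\<Psi> w\<bar> powr q", OF _ \<Psi>_powr_root]) measurable
      have "expectation (\<lambda>\<omega>. \<bar>\<Psi> (\<lambda>i. L v i \<omega>)\<bar> powr q) = expectation (\<lambda>\<omega>. \<bar>\<Psi> (\<lambda>i. L [] i \<omega>)\<bar> powr q)"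
        by (rule integral_weights_ident) measurable
      also have "\<dots> \<le> \<kappa>"
        unfolding \<kappa>_def
      proof (rule integral_mono_AE[OF \<Psi>_powr_root int])
        show "AE \<omega> in M. \<bar>\<Psi> (\<lambda>i. L [] i \<omega>)\<bar> powr q \<le> intrinsic_martingale L 1 \<omega> powr (2 * q)"
          using AE_regular
        proof eventually_elim
          case (elim \<omega>)
          show ?case
            using sum_squares_children_bound[OF elim q, of k] by (simp add: \<Psi>_def sum_nonneg)
        qed
      qed
      finally show "expectation (\<lambda>\<omega>. \<bar>\<Psi> (\<lambda>i. L v i \<omega>)\<bar> powr q) \<le> \<kappa>" .
    qed
    have \<Psi>_int: "integrable M (\<lambda>\<omega>. \<Psi> (\<lambda>i. L v i \<omega>))" for v
      by (rule integrable_from_abs_powr[OF \<Psi>_children \<Psi>_powr(1) q])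
    have \<Psi>_exp: "expectation (\<lambda>\<omega>. \<Psi> (\<lambda>i. L v i \<omega>)) \<le> m2" for v
    proof -
      have "ennreal (expectation (\<lambda>\<omega>. \<Psi> (\<lambda>i. L [] i \<omega>))) = (\<integral>\<^sup>+\<omega>. ennreal (\<Psi> (\<lambda>i. L [] i \<omega>)) \<partial>M)"
        using \<Psi>_int \<Psi>_nonneg by (intro nn_integral_eq_integral[symmetric]) auto
      also have "\<dots> = truncated_moment 2 k"
        unfolding truncated_moment_def \<Psi>_def using weights_nonneg
        by (intro nn_integral_cong) (simp add: powr_numeral)
      also have "\<dots> \<le> ennreal m2"
        using truncated_moment_le[of 2 k] by (simp add: m2)
      finally have "expectation (\<lambda>\<omega>. \<Psi> (\<lambda>i. L [] i \<omega>)) \<le> m2"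
        using m2(2) by simp
      then show ?thesis
        using integral_weights_ident[OF \<Psi>_meas, of v] by simp
    qed
    let ?S = "\<lambda>\<omega>. \<Sum>v\<in>gen n k. (node_weight L v \<omega>)\<^sup>2"
    have next_gen: "(\<Sum>v\<in>gen (Suc n) k. (node_weight L v \<omega>)\<^sup>2) = (\<Sum>v\<in>gen n k. (node_weight L v \<omega>)\<^sup>2 * \<Psi> (\<lambda>i. L v i \<omega>))" for \<omega>
      by (simp add: sum_gen_Suc node_weight_snoc \<Psi>_def sum_distrib_left power_mult_distrib mult.commute)
    have "U (Suc n) k = (\<integral>\<^sup>+\<omega>. (\<integral>\<^sup>+\<omega>'. ennreal ((\<Sum>v\<in>gen n k. (node_weight L v \<omega>)\<^sup>2 * \<Psi> (\<lambda>i. L v i \<omega>')) powr q) \<partial>M) \<partial>M)"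
      unfolding U_def next_gen
      by (rule nn_integral_generation[where n = n and \<theta> = "\<lambda>x. x\<^sup>2" and \<Psi> = \<Psi> and \<phi> = "\<lambda>x. ennreal (x powr q)"])
         (auto simp: length_gen)
    also have "\<dots> \<le> (\<integral>\<^sup>+\<omega>. ennreal C * ennreal (\<Sum>v\<in>gen n k. node_weight L v \<omega> powr (2 * q))
        + ennreal (\<theta> * m2 powr q) * ennreal (?S \<omega> powr q) \<partial>M)"
    proof (rule nn_integral_mono)
      fix \<omega> assume w: "\<omega> \<in> space M"
      define X where "X v \<omega>' = (node_weight L v \<omega>)\<^sup>2 * \<Psi> (\<lambda>i. L v i \<omega>')" for v \<omega>'
      have [measurable]: "X v \<in> borel_measurable M" for v
        unfolding X_def by measurable
      have indep: "indep_vars (\<lambda>_. borel) X (gen n k)"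
        unfolding X_def by (rule indep_vars_weights) measurable
      have Xpow: "\<bar>X v \<omega>'\<bar> powr q = node_weight L v \<omega> powr (2 * q) * \<bar>\<Psi> (\<lambda>i. L v i \<omega>')\<bar> powr q" for v \<omega>'
        unfolding X_def by (simp add: abs_mult powr_mult square_powr node_weight_nonneg[OF w])
      have Xint: "integrable M (\<lambda>\<omega>'. \<bar>X v \<omega>'\<bar> powr q)" for v
        unfolding Xpow using \<Psi>_powr(1) by simp
      have Xnn: "0 \<le> X v \<omega>'" for v \<omega>'
        unfolding X_def using \<Psi>_nonneg by simp
      have "expectation (\<lambda>\<omega>'. (\<Sum>v\<in>gen n k. X v \<omega>') powr q)
          \<le> C0 * (\<Sum>v\<in>gen n k. expectation (\<lambda>\<omega>'. X v \<omega>' powr q)) + \<theta> * (\<Sum>v\<in>gen n k. expectation (X v)) powr q"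
        by (rule C0(2)[OF finite_gen indep Xint Xnn])
      also have "\<dots> \<le> C0 * (\<Sum>v\<in>gen n k. node_weight L v \<omega> powr (2 * q) * \<kappa>) + \<theta> * (\<Sum>v\<in>gen n k. (node_weight L v \<omega>)\<^sup>2 * m2) powr q"
      proof (intro add_mono mult_left_mono sum_mono powr_mono2 sum_nonneg)
        fix v
        have "expectation (\<lambda>\<omega>'. X v \<omega>' powr q) = expectation (\<lambda>\<omega>'. \<bar>X v \<omega>'\<bar> powr q)"
          using Xnn by simp
        also have "\<dots> \<le> node_weight L v \<omega> powr (2 * q) * \<kappa>"
          unfolding Xpow using \<Psi>_powr(2)[of v] by (simp add: mult_left_mono)
        finally show "expectation (\<lambda>\<omega>'. X v \<omega>' powr q) \<le> node_weight L v \<omega> powr (2 * q) * \<kappa>" .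
        show "expectation (X v) \<le> (node_weight L v \<omega>)\<^sup>2 * m2"
          unfolding X_def using \<Psi>_exp[of v] by (simp add: mult_left_mono)
        show "0 \<le> expectation (X v)" using Xnn by simp
      qed (use C0(1) q \<theta> in auto)
      also have "\<dots> = C * (\<Sum>v\<in>gen n k. node_weight L v \<omega> powr (2 * q)) + (\<theta> * m2 powr q) * ?S \<omega> powr q"
        unfolding sum_distrib_right[symmetric] C_def using m2(2)
        by (simp add: powr_mult sum_nonneg)
      finally have "ennreal (expectation (\<lambda>\<omega>'. (\<Sum>v\<in>gen n k. X v \<omega>') powr q))
          \<le> ennreal (C * (\<Sum>v\<in>gen n k. node_weight L v \<omega> powr (2 * q)) + (\<theta> * m2 powr q) * ?S \<omega> powr q)"
        by (rule ennreal_leI)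
      moreover have "ennreal (expectation (\<lambda>\<omega>'. (\<Sum>v\<in>gen n k. X v \<omega>') powr q)) = (\<integral>\<^sup>+\<omega>'. ennreal ((\<Sum>v\<in>gen n k. X v \<omega>') powr q) \<partial>M)"
      proof -
        have "integrable M (\<lambda>\<omega>'. \<bar>\<Sum>v\<in>gen n k. X v \<omega>'\<bar> powr q)"
          using q by (intro integrable_abs_sum_powr Xint) auto
        then show ?thesis
          using Xnn by (intro nn_integral_eq_integral[symmetric]) (auto simp: sum_nonneg)
      qed
      moreover have "ennreal (C * (\<Sum>v\<in>gen n k. node_weight L v \<omega> powr (2 * q)) + (\<theta> * m2 powr q) * ?S \<omega> powr q)
          = ennreal C * ennreal (\<Sum>v\<in>gen n k. node_weight L v \<omega> powr (2 * q))
        + ennreal (\<theta> * m2 powr q) * ennreal (?S \<omega> powr q)"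
        using C \<theta> by (subst ennreal_plus) (simp_all add: sum_nonneg ennreal_mult)
      ultimately show "(\<integral>\<^sup>+\<omega>'. ennreal ((\<Sum>v\<in>gen n k. (node_weight L v \<omega>)\<^sup>2 * \<Psi> (\<lambda>i. L v i \<omega>')) powr q) \<partial>M)
          \<le> ennreal C * ennreal (\<Sum>v\<in>gen n k. node_weight L v \<omega> powr (2 * q))
        + ennreal (\<theta> * m2 powr q) * ennreal (?S \<omega> powr q)"
        by (simp add: X_def)
    qed
    also have "\<dots> = ennreal C * truncated_moment (2 * q) k ^ n + ennreal (\<theta> * m2 powr q) * U n k"
      unfolding generation_moment[symmetric] U_def by (simp add: nn_integral_cmult nn_integral_add)
    finally show "U (Suc n) k \<le> ennreal C * truncated_moment (2 * q) k ^ n + ennreal (\<theta> * m2 powr q) * U n k" .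
  qed
qed

text \<open>The rate \<open>r\<close> exceeds both m(2)^(p/2) and m(p), so the linear recursion with
  inhomogeneity of order \<open>r ^ n\<close> has solutions of the same order.\<close>

lemma increment_upper:
  assumes p: "p \<ge> 2"
    and int: "integrable M (\<lambda>\<omega>. intrinsic_martingale L 1 \<omega> powr p)"
    and m2: "moment_fun M L 2 = ennreal m2" "m2 \<ge> 0" "m2 powr (p / 2) < r"
    and mp: "moment_fun M L p = ennreal mp" "mp \<ge> 0" "mp < r"
  obtains K where "K \<ge> 0" "\<And>n. (\<integral>\<^sup>+\<omega>. ennreal (\<bar>intrinsic_martingale L (Suc n) \<omega> - intrinsic_martingale L n \<omega>\<bar> powr p) \<partial>M)
    \<le> ennreal (K * r ^ n)"
proof -
  let ?W = "intrinsic_martingale L"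
  define q where "q = p / 2"
  have q: "q \<ge> 1" "2 * q = p" using p by (auto simp: q_def)
  define U where "U n k = (\<integral>\<^sup>+\<omega>. ennreal ((\<Sum>v\<in>gen n k. (node_weight L v \<omega>)\<^sup>2) powr q) \<partial>M)" for n k
  have r: "r > 0" using mp by simp
  \<comment> \<open>The strict inequality for \<open>m2\<close> leaves room for a factor above 1; if
    the power of \<open>m2\<close> vanishes, any such factor will do.\<close>
  obtain \<theta> where \<theta>: "\<theta> > 1" "\<theta> * m2 powr q < r"
  proof (cases "m2 powr q = 0")
    case True
    then show ?thesis using that[of 2] r by simp
  next
    case False
    then have "m2 powr q > 0" by (simp add: less_le)
    then have "1 < r / m2 powr q" using m2(3) by (simp add: q_def)
    then obtain \<theta> where "1 < \<theta>" "\<theta> < r / m2 powr q" using dense by blast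
    then show ?thesis using that[of \<theta>] \<open>m2 powr q > 0\<close> by (simp add: pos_less_divide_eq)
  qed
  obtain C1 where C1: "C1 \<ge> 0" "\<And>n k. U (Suc n) k \<le> ennreal C1 * truncated_moment p k ^ n + ennreal (\<theta> * m2 powr q) * U n k"
    using square_sum_recursion[OF q(1) \<theta>(1) int[folded q(2)] m2(1,2)] unfolding U_def q(2) by metis
  have tm: "truncated_moment p k ^ n \<le> ennreal (r ^ n)" for k n
  proof -
    have "truncated_moment p k \<le> ennreal r"
      using truncated_moment_le[of p k] mp by (simp add: ennreal_leI order_trans)
    then have "truncated_moment p k ^ n \<le> ennreal r ^ n" by (intro power_mono) auto
    then show ?thesis using r by (simp add: ennreal_power)
  qed
  \<comment> \<open>Chosen so that the bound \<open>K1 * r ^ n\<close> reproduces itself under the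
    recursion, that is \<open>C1 + \<theta> * m2 powr q * K1 \<le> r * K1\<close>; the maximum with
    1 covers \<open>U 0 k = 1\<close>.\<close>
  define K1 where "K1 = max 1 (C1 / (r - \<theta> * m2 powr q))"
  have K1: "K1 \<ge> 1" "C1 + \<theta> * m2 powr q * K1 \<le> r * K1"
  proof -
    have "C1 / (r - \<theta> * m2 powr q) \<le> K1" by (simp add: K1_def)
    then show "C1 + \<theta> * m2 powr q * K1 \<le> r * K1"
      using \<theta>(2) by (simp add: pos_divide_le_eq algebra_simps)
  qed (simp add: K1_def)
  have U: "U n k \<le> ennreal (K1 * r ^ n)" for n k
  proof (induction n)
    case 0
    have "U 0 k = 1" by (simp add: U_def gen_0 node_weight_Nil emeasure_space_1)
    then show ?case using K1(1) by (simp add: ennreal_le_1 flip: ennreal_1)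
  next
    case (Suc n)
    have "U (Suc n) k \<le> ennreal C1 * truncated_moment p k ^ n + ennreal (\<theta> * m2 powr q) * U n k"
      by (rule C1(2))
    also have "\<dots> \<le> ennreal C1 * ennreal (r ^ n) + ennreal (\<theta> * m2 powr q) * ennreal (K1 * r ^ n)"
      by (intro add_mono mult_left_mono tm Suc) auto
    also have "\<dots> = ennreal ((C1 + \<theta> * m2 powr q * K1) * r ^ n)"
      using C1(1) \<theta>(1) K1(1) r
      by (simp add: distrib_right mult.assoc flip: ennreal_mult ennreal_plus)
    also have "\<dots> \<le> ennreal ((r * K1) * r ^ n)"
      using r K1(2) by (intro ennreal_leI mult_right_mono) auto
    finally show ?case by (simp add: mult_ac)
  qed
  have p1: "p \<ge> 1" using p by simp
  obtain C2 where C2: "C2 \<ge> 0" "\<And>n k. (\<integral>\<^sup>+\<omega>. ennreal (\<bar>partial_increment n k \<omega>\<bar> powr p) \<partial>M)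
    \<le> ennreal C2 * (truncated_moment p k ^ n + U n k)"
    using partial_increment_upper[OF p integrable_offspring_centered[OF p1 int]] unfolding U_def q_def by metis
  define K where "K = C2 * (1 + K1)"
  have S: "(\<integral>\<^sup>+\<omega>. ennreal (\<bar>partial_increment n k \<omega>\<bar> powr p) \<partial>M) \<le> ennreal (K * r ^ n)" for n k
  proof -
    have "(\<integral>\<^sup>+\<omega>. ennreal (\<bar>partial_increment n k \<omega>\<bar> powr p) \<partial>M) \<le> ennreal C2 * (truncated_moment p k ^ n + U n k)"
      by (rule C2(2))
    also have "\<dots> \<le> ennreal C2 * (ennreal (r ^ n) + ennreal (K1 * r ^ n))"
      by (intro mult_left_mono add_mono tm U) auto
    also have "\<dots> = ennreal (K * r ^ n)"
      using C2(1) K1(1) r by (simp add: K_def distrib_right distrib_left mult.assoc flip: ennreal_mult ennreal_plus)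
    finally show ?thesis .
  qed
  show ?thesis
  proof (rule that[of K])
    show "K \<ge> 0" using C2(1) K1(1) by (simp add: K_def)
    fix n
    have "(\<integral>\<^sup>+\<omega>. ennreal (\<bar>?W (Suc n) \<omega> - ?W n \<omega>\<bar> powr p) \<partial>M)
        = (\<integral>\<^sup>+\<omega>. liminf (\<lambda>k. ennreal (\<bar>partial_increment n k \<omega>\<bar> powr p)) \<partial>M)"
    proof (rule nn_integral_cong_AE)
      show "AE \<omega> in M. ennreal (\<bar>?W (Suc n) \<omega> - ?W n \<omega>\<bar> powr p) = liminf (\<lambda>k. ennreal (\<bar>partial_increment n k \<omega>\<bar> powr p))"
        using AE_regular
      proof eventually_elim
        case (elim \<omega>)
        have "(\<lambda>k. ennreal (\<bar>partial_increment n k \<omega>\<bar> powr p)) \<longlonglongrightarrow> ennreal (\<bar>?W (Suc n) \<omega> - ?W n \<omega>\<bar> powr p)"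
          using p by (intro tendsto_ennrealI tendsto_powr2 tendsto_rabs tendsto_const regular_increment(1)[OF elim]) auto
        from lim_imp_Liminf[OF sequentially_bot this] show ?case by simp
      qed
    qed
    also have "\<dots> \<le> liminf (\<lambda>k. \<integral>\<^sup>+\<omega>. ennreal (\<bar>partial_increment n k \<omega>\<bar> powr p) \<partial>M)"
      by (rule nn_integral_liminf) measurable
    also have "\<dots> \<le> ennreal (K * r ^ n)"
      using S by (intro Liminf_le) auto
    finally show "(\<integral>\<^sup>+\<omega>. ennreal (\<bar>?W (Suc n) \<omega> - ?W n \<omega>\<bar> powr p) \<partial>M) \<le> ennreal (K * r ^ n)" .
  qed
qed

end

section \<open>Convergence of the series\<close>

text \<open>For finite \<open>m\<close> the two products are related by the increasing map
  \<open>y powr r\<close>, which fixes 1; for infinite \<open>m\<close> both conditions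
  fail.\<close>

lemma exp_mult_ennreal_powr_less_1:
  assumes "r > 0"
  shows "ennreal (exp a) * ennreal_powr m (1 / r) < 1 \<longleftrightarrow> ennreal (exp (a * r)) * m < 1"
proof (cases m)
  case (real x)
  have "ennreal (exp a) * ennreal_powr m (1 / r) = ennreal (exp a * x powr (1 / r))"
    using real by (simp add: ennreal_powr_def ennreal_mult)
  moreover have "ennreal (exp (a * r)) * m = ennreal ((exp a * x powr (1 / r)) powr r)"
    using real assms by (simp add: powr_mult powr_powr exp_powr_real ennreal_mult)
  moreover have "y powr r < 1 \<longleftrightarrow> y < 1" if "y \<ge> 0" for y :: real
    using powr_less_mono2[of r y 1] powr_mono2[of r 1 y] that assms by fastforce
  ultimately show ?thesis
    using real by (simp add: ennreal_less_one_iff)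
next
  case top
  then show ?thesis by (simp add: ennreal_powr_def ennreal_mult_top)
qed

section \<open>Elementary facts about L_p\<close>

context prob_space
begin

lemma in_Lp_diff:
  assumes "in_Lp M p X" "in_Lp M p Y" "p \<ge> 0"
  shows "in_Lp M p (\<lambda>\<omega>. X \<omega> - Y \<omega>)"
  using integrable_abs_add_powr[of X "\<lambda>\<omega>. - Y \<omega>" p] assms by (auto simp: in_Lp_def)

lemma in_Lp_scale:
  assumes "in_Lp M p X"
  shows "in_Lp M p (\<lambda>\<omega>. c * X \<omega>)"
  using assms by (auto simp: in_Lp_def abs_mult powr_mult)

lemma in_Lp_const: "in_Lp M p (\<lambda>\<omega>. c)"
  by (simp add: in_Lp_def)

lemma in_Lp_cong:
  assumes "\<And>\<omega>. \<omega> \<in> space M \<Longrightarrow> X \<omega> = Y \<omega>"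
  shows "in_Lp M p X \<longleftrightarrow> in_Lp M p Y"
  unfolding in_Lp_def using assms
  by (intro conj_cong measurable_cong Bochner_Integration.integrable_cong) auto

lemma in_Lp_dominated:
  assumes [measurable]: "X \<in> borel_measurable M" "H \<in> borel_measurable M"
    and "integrable M (\<lambda>\<omega>. H \<omega> powr p)" "AE \<omega> in M. \<bar>X \<omega>\<bar> \<le> H \<omega>" "p \<ge> 0"
  shows "in_Lp M p X"
proof -
  have "integrable M (\<lambda>\<omega>. \<bar>X \<omega>\<bar> powr p)"
  proof (rule Bochner_Integration.integrable_bound[OF assms(3)])
    show "AE \<omega> in M. norm (\<bar>X \<omega>\<bar> powr p) \<le> norm (H \<omega> powr p)"
      using assms(4) by eventually_elim (use assms(5) in \<open>auto intro: powr_mono2\<close>)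
  qed measurable
  then show ?thesis by (simp add: in_Lp_def)
qed

lemma expectation_diff_powr_le:
  assumes "in_Lp M p X" "in_Lp M p Y" "p \<ge> 0"
  shows "expectation (\<lambda>\<omega>. \<bar>X \<omega> - Y \<omega>\<bar> powr p)
    \<le> 2 powr p * (expectation (\<lambda>\<omega>. \<bar>X \<omega>\<bar> powr p) + expectation (\<lambda>\<omega>. \<bar>Y \<omega>\<bar> powr p))"
proof -
  have "expectation (\<lambda>\<omega>. \<bar>X \<omega> - Y \<omega>\<bar> powr p)
      \<le> expectation (\<lambda>\<omega>. 2 powr p * (\<bar>X \<omega>\<bar> powr p + \<bar>Y \<omega>\<bar> powr p))"
    using in_Lp_diff[OF assms] assms abs_add_powr_le(2)[OF assms(3)]
    by (intro integral_mono) (auto simp: in_Lp_def)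
  then show ?thesis using assms by (simp add: in_Lp_def)
qed

text \<open>Below the level \<open>l\<close> the r-th power is at most \<open>l powr r\<close>,
  above it the p-th power dominates. With \<open>l\<close> chosen first, a small moment of order
  \<open>p\<close> thus forces a small moment of order \<open>r\<close>.\<close>

lemma expectation_powr_le_powr:
  assumes "in_Lp M p X" "0 < l" "0 \<le> r" "r \<le> p"
  shows "expectation (\<lambda>\<omega>. \<bar>X \<omega>\<bar> powr r) \<le> l powr r + l powr (r - p) * expectation (\<lambda>\<omega>. \<bar>X \<omega>\<bar> powr p)"
proof -
  have pw: "\<bar>x\<bar> powr r \<le> l powr r + l powr (r - p) * \<bar>x\<bar> powr p" for x
  proof (cases "\<bar>x\<bar> \<le> l")
    case True
    then have "\<bar>x\<bar> powr r \<le> l powr r" using assms by (intro powr_mono2) auto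
    then show ?thesis by (simp add: add_increasing2)
  next
    case False
    have "\<bar>x\<bar> powr r = \<bar>x\<bar> powr (r - p) * \<bar>x\<bar> powr p"
      by (simp flip: powr_add)
    also have "\<dots> \<le> l powr (r - p) * \<bar>x\<bar> powr p"
      using False assms by (intro mult_right_mono powr_mono2') auto
    finally show ?thesis by (simp add: add_increasing)
  qed
  have "expectation (\<lambda>\<omega>. \<bar>X \<omega>\<bar> powr r) \<le> expectation (\<lambda>\<omega>. l powr r + l powr (r - p) * \<bar>X \<omega>\<bar> powr p)"
    using assms pw integrable_abs_powr_mono[of X p r] by (intro integral_mono) (auto simp: in_Lp_def)
  also have "\<dots> = l powr r + l powr (r - p) * expectation (\<lambda>\<omega>. \<bar>X \<omega>\<bar> powr p)"
    using assms by (simp add: in_Lp_def prob_space)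
  finally show ?thesis .
qed

end

section \<open>Sufficiency: a pathwise geometric majorant\<close>

text \<open>\<open>lim\<close> is meaningful only for a convergent sequence; summability of the
  increments supplies convergence before the tail is estimated.\<close>

lemma geometric_increments_limit:
  fixes W :: "nat \<Rightarrow> real"
  assumes \<rho>: "0 < \<rho>" "\<rho> < 1" and D: "\<And>n. \<bar>W (Suc n) - W n\<bar> \<le> H * \<rho> ^ n"
  shows "\<bar>lim W - W n\<bar> \<le> H * \<rho> ^ n / (1 - \<rho>)"
proof -
  have H: "H \<ge> 0" using D[of 0] by simp
  \<comment> \<open>The factor \<open>1 - \<rho> ^ m\<close> comes from the exact partial sum of the
    geometric series and makes the induction close.\<close>
  have bound: "\<bar>W (n + m) - W n\<bar> \<le> H * \<rho> ^ n * (1 - \<rho> ^ m) / (1 - \<rho>)" for m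
  proof (induction m)
    case (Suc m)
    have "\<bar>W (n + Suc m) - W n\<bar> \<le> H * \<rho> ^ n * (1 - \<rho> ^ m) / (1 - \<rho>) + H * \<rho> ^ (n + m)"
      using Suc D[of "n + m"] by simp
    also have "\<dots> = H * \<rho> ^ n * (1 - \<rho> ^ Suc m) / (1 - \<rho>)"
      using \<rho> by (simp add: field_simps power_add)
    finally show ?case .
  qed simp
  have "summable (\<lambda>n. W (Suc n) - W n)"
  proof (rule summable_comparison_test)
    show "\<exists>N. \<forall>n\<ge>N. norm (W (Suc n) - W n) \<le> H * \<rho> ^ n" using D by auto
    show "summable (\<lambda>n. H * \<rho> ^ n)" using \<rho> by (intro summable_mult summable_geometric) auto
  qed
  then have "convergent (\<lambda>n. W n - W 0)"
    unfolding summable_iff_convergent sum_lessThan_telescope .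
  then have "convergent W"
    using convergent_add_const_right_iff[of W "- W 0"] by simp
  then have "W \<longlonglongrightarrow> lim W" by (simp add: convergent_LIMSEQ_iff)
  then have "(\<lambda>m. W (n + m)) \<longlonglongrightarrow> lim W"
    using LIMSEQ_ignore_initial_segment[of W "lim W" n] by (simp add: add.commute)
  then have lim: "(\<lambda>m. \<bar>W (n + m) - W n\<bar>) \<longlonglongrightarrow> \<bar>lim W - W n\<bar>"
    by (intro tendsto_intros)
  show ?thesis
  proof (rule LIMSEQ_le_const2[OF lim], intro exI allI impI)
    fix m :: nat
    have "H * \<rho> ^ n * (1 - \<rho> ^ m) / (1 - \<rho>) \<le> H * \<rho> ^ n * 1 / (1 - \<rho>)"
      using \<rho> H by (intro divide_right_mono mult_left_mono) auto
    then show "\<bar>W (n + m) - W n\<bar> \<le> H * \<rho> ^ n / (1 - \<rho>)"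
      using bound[of m] by simp
  qed
qed

context normalized_supercritical_wbp
begin

text \<open>A single random variable \<open>H\<close> in L_p with
  \<open>|W_(n+1) - W_n| \<le> H * \<rho> ^ n\<close> for all \<open>n\<close>, almost surely,
  yields both claims: the terms of the series are bounded by \<open>H\<close> times a convergent
  geometric series, so the series converges almost surely, and in L_p by dominated
  convergence.\<close>

lemma series_converges_sufficient:
  assumes a: "a > 0" and p: "p \<ge> 2" and r: "r > 0" "exp (a * p) * r < 1"
    and D: "\<And>n. (\<integral>\<^sup>+\<omega>. ennreal (\<bar>intrinsic_martingale L (Suc n) \<omega> - intrinsic_martingale L n \<omega>\<bar> powr p) \<partial>M)
      \<le> ennreal (K * r ^ n)"
    and K: "K \<ge> 0"
  shows "series_converges_in_Lp M p (fluctuation_term L a)"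
    and "AE \<omega> in M. summable (\<lambda>n. fluctuation_term L a n \<omega>)"
proof -
  let ?W = "intrinsic_martingale L"
  have p0: "p > 0" "p \<ge> 0" using p by auto
  have "r < exp (- (a * p))" using r(2) by (simp add: exp_minus field_simps)
  \<comment> \<open>The gap between \<open>r\<close> and the critical rate is split:
    \<open>r / s < 1\<close> makes \<open>G\<close> integrable, and
    \<open>s < exp (- (a * p))\<close> gives \<open>exp a * \<rho> < 1\<close>.\<close>
  then obtain s where s: "r < s" "s < exp (- (a * p))" using dense by blast
  define \<rho> where "\<rho> = s powr (1 / p)"
  have s0: "s > 0" using r s by simp
  have \<rho>p: "\<rho> powr p = s" using s0 p0 by (simp add: \<rho>_def powr_powr)
  have \<rho>0: "\<rho> > 0" using s0 by (simp add: \<rho>_def)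
  have "\<rho> < exp (- (a * p)) powr (1 / p)"
    unfolding \<rho>_def using s s0 p0 by (intro powr_less_mono2) auto
  also have "\<dots> = exp (- a)" using p0 by (simp add: exp_powr_real)
  finally have e\<rho>: "exp a * \<rho> < 1" by (simp add: exp_minus field_simps)
  \<comment> \<open>As \<open>a\<close> is positive, \<open>exp a * \<rho> < 1\<close> also keeps
    \<open>\<rho>\<close> itself below 1, which the tail estimate for \<open>W - W_n\<close>
    requires.\<close>
  have "exp a > 1" using a by simp
  then have "\<rho> * 1 < \<rho> * exp a" using \<rho>0 by (intro mult_strict_left_mono)
  then have \<rho>1: "\<rho> < 1" using e\<rho> by (simp add: mult.commute)
  \<comment> \<open>Each term of this sum controls one increment, so \<open>G powr (1 / p)\<close>
    dominates all of them at once, up to the factors \<open>\<rho> ^ n\<close>. Its mean is bounded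
    by a geometric series in \<open>r / s\<close>.\<close>
  define G where "G \<omega> = (\<Sum>n. ennreal (\<bar>?W (Suc n) \<omega> - ?W n \<omega>\<bar> powr p / s ^ n))" for \<omega>
  have [measurable]: "G \<in> borel_measurable M" unfolding G_def by measurable
  have "(\<integral>\<^sup>+\<omega>. G \<omega> \<partial>M) = (\<Sum>n. \<integral>\<^sup>+\<omega>. ennreal (\<bar>?W (Suc n) \<omega> - ?W n \<omega>\<bar> powr p / s ^ n) \<partial>M)"
    unfolding G_def by (rule nn_integral_suminf) measurable
  also have "\<dots> \<le> (\<Sum>n. ennreal (K * (r / s) ^ n))"
  proof (rule suminf_le)
    fix n
    have "(\<integral>\<^sup>+\<omega>. ennreal (\<bar>?W (Suc n) \<omega> - ?W n \<omega>\<bar> powr p / s ^ n) \<partial>M)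
        = (\<integral>\<^sup>+\<omega>. ennreal (\<bar>?W (Suc n) \<omega> - ?W n \<omega>\<bar> powr p) * ennreal (1 / s ^ n) \<partial>M)"
      using s0 by (intro nn_integral_cong) (simp flip: ennreal_mult)
    also have "\<dots> \<le> ennreal (K * r ^ n) * ennreal (1 / s ^ n)"
      by (subst nn_integral_multc) (auto intro!: mult_right_mono D)
    also have "\<dots> = ennreal (K * (r / s) ^ n)"
      using s0 r K by (simp add: power_divide flip: ennreal_mult)
    finally show "(\<integral>\<^sup>+\<omega>. ennreal (\<bar>?W (Suc n) \<omega> - ?W n \<omega>\<bar> powr p / s ^ n) \<partial>M) \<le> ennreal (K * (r / s) ^ n)" .
  qed auto
  also have "\<dots> = ennreal (\<Sum>n. K * (r / s) ^ n)"
    using s0 r s K by (intro suminf_ennreal2 summable_mult summable_geometric) auto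
  finally have G_int: "(\<integral>\<^sup>+\<omega>. G \<omega> \<partial>M) < \<infinity>"
    by (rule order.strict_trans1) simp
  then have "(\<integral>\<^sup>+\<omega>. G \<omega> \<partial>M) \<noteq> \<infinity>" by (rule less_imp_neq)
  then have G_fin: "AE \<omega> in M. G \<omega> \<noteq> \<infinity>"
    by (intro nn_integral_PInf_AE) auto
  define H where "H \<omega> = enn2real (G \<omega>) powr (1 / p)" for \<omega>
  have H_meas [measurable]: "H \<in> borel_measurable M" unfolding H_def by measurable
  have H0: "H \<omega> \<ge> 0" for \<omega> by (simp add: H_def)
  have Hp: "H \<omega> powr p = enn2real (G \<omega>)" for \<omega>
    using p0 by (simp add: H_def powr_powr)
  have H_int: "integrable M (\<lambda>\<omega>. H \<omega> powr p)"
    unfolding Hp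
  proof (rule integrableI_bounded)
    have "(\<integral>\<^sup>+\<omega>. ennreal (norm (enn2real (G \<omega>))) \<partial>M) = (\<integral>\<^sup>+\<omega>. G \<omega> \<partial>M)"
      using G_fin by (intro nn_integral_cong_AE) (auto simp: ennreal_enn2real less_top)
    then show "(\<integral>\<^sup>+\<omega>. ennreal (norm (enn2real (G \<omega>))) \<partial>M) < \<infinity>" using G_int by simp
  qed measurable
  \<comment> \<open>The factor \<open>1 / (1 - \<rho>)\<close> comes from the tail of the
    increments, the other one from summing \<open>(exp a * \<rho>) ^ n\<close>.\<close>
  define C where "C = 1 / ((1 - \<rho>) * (1 - exp a * \<rho>))"
  have C0: "C > 0" using \<rho>1 e\<rho> by (simp add: C_def)
  have increment: "\<bar>?W (Suc n) \<omega> - ?W n \<omega>\<bar> \<le> H \<omega> * \<rho> ^ n" if "G \<omega> \<noteq> \<infinity>" for n \<omega>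
  proof -
    have "ennreal (\<bar>?W (Suc n) \<omega> - ?W n \<omega>\<bar> powr p / s ^ n) \<le> G \<omega>"
      unfolding G_def using sum_le_suminf[of "\<lambda>n. ennreal (\<bar>?W (Suc n) \<omega> - ?W n \<omega>\<bar> powr p / s ^ n)" "{n}"] by simp
    also have "G \<omega> = ennreal (H \<omega> powr p)" using that by (simp add: Hp ennreal_enn2real less_top)
    finally have "\<bar>?W (Suc n) \<omega> - ?W n \<omega>\<bar> powr p / s ^ n \<le> H \<omega> powr p"
      by simp
    then have "\<bar>?W (Suc n) \<omega> - ?W n \<omega>\<bar> powr p \<le> H \<omega> powr p * s ^ n"
      using s0 by (simp add: pos_divide_le_eq)
    also have "s ^ n = (\<rho> ^ n) powr p"
      using \<rho>0 by (simp add: \<rho>p[symmetric] powr_powr powr_realpow[symmetric] mult.commute)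
    also have "H \<omega> powr p * (\<rho> ^ n) powr p = (H \<omega> * \<rho> ^ n) powr p"
      by (simp add: powr_mult)
    finally show ?thesis
      using powr_less_mono2[OF p0(1), of "H \<omega> * \<rho> ^ n" "\<bar>?W (Suc n) \<omega> - ?W n \<omega>\<bar>"] H0[of \<omega>] \<rho>0
      by (meson linorder_not_le mult_nonneg_nonneg less_imp_le zero_le_power)
  qed
  define B where "B n \<omega> = H \<omega> / (1 - \<rho>) * (exp a * \<rho>) ^ n" for n \<omega>
  have term_bound: "\<bar>fluctuation_term L a n \<omega>\<bar> \<le> B n \<omega>" if "G \<omega> \<noteq> \<infinity>" for n \<omega>
  proof -
    have "\<bar>fluctuation_term L a n \<omega>\<bar> = exp a ^ n * \<bar>lim (\<lambda>n. ?W n \<omega>) - ?W n \<omega>\<bar>"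
      by (simp add: fluctuation_term_def martingale_limit_def abs_mult exp_of_nat_mult[symmetric] mult.commute)
    also have "\<dots> \<le> exp a ^ n * (H \<omega> * \<rho> ^ n / (1 - \<rho>))"
      by (intro mult_left_mono geometric_increments_limit[OF \<rho>0 \<rho>1] increment[OF that]) auto
    also have "\<dots> = B n \<omega>" by (simp add: B_def power_mult_distrib)
    finally show ?thesis .
  qed
  have B_sums: "(\<lambda>n. B n \<omega>) sums (C * H \<omega>)" for \<omega>
  proof -
    have "(\<lambda>n. (exp a * \<rho>) ^ n) sums (1 / (1 - exp a * \<rho>))"
      using \<rho>0 e\<rho> by (intro geometric_sums) auto
    from sums_mult[OF this, of "H \<omega> / (1 - \<rho>)"] show ?thesis
      by (simp add: B_def C_def mult.commute)
  qed
  have B0: "B n \<omega> \<ge> 0" for n \<omega>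
    using H0[of \<omega>] \<rho>0 \<rho>1 by (simp add: B_def)
  have summ: "summable (\<lambda>n. fluctuation_term L a n \<omega>)" if "G \<omega> \<noteq> \<infinity>" for \<omega>
    using term_bound[OF that] sums_summable[OF B_sums[of \<omega>]]
    by (intro summable_comparison_test[of "\<lambda>n. fluctuation_term L a n \<omega>"]) auto
  show "AE \<omega> in M. summable (\<lambda>n. fluctuation_term L a n \<omega>)"
    using G_fin by eventually_elim (rule summ)
  define S where "S N \<omega> = (\<Sum>n<N. fluctuation_term L a n \<omega>)" for N \<omega>
  define X where "X \<omega> = (\<Sum>n. fluctuation_term L a n \<omega>)" for \<omega>
  have [measurable]: "S N \<in> borel_measurable M" for N unfolding S_def by measurable
  have [measurable]: "X \<in> borel_measurable M" unfolding X_def by measurable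
  have S_bound: "\<bar>S N \<omega>\<bar> \<le> C * H \<omega>" if "G \<omega> \<noteq> \<infinity>" for N \<omega>
  proof -
    have "\<bar>S N \<omega>\<bar> \<le> (\<Sum>n<N. B n \<omega>)"
      unfolding S_def using term_bound[OF that] by (intro order_trans[OF sum_abs sum_mono]) auto
    also have "\<dots> \<le> C * H \<omega>"
      using sum_le_suminf[OF sums_summable[OF B_sums[of \<omega>]], of "{..<N}"] B0 sums_unique[OF B_sums[of \<omega>]] by simp
    finally show ?thesis .
  qed
  have S_lim: "(\<lambda>N. S N \<omega>) \<longlonglongrightarrow> X \<omega>" if "G \<omega> \<noteq> \<infinity>" for \<omega>
    unfolding S_def X_def by (rule summable_LIMSEQ[OF summ[OF that]])
  have X_bound: "\<bar>X \<omega>\<bar> \<le> C * H \<omega>" if "G \<omega> \<noteq> \<infinity>" for \<omega>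
    by (rule LIMSEQ_le_const2[OF tendsto_rabs[OF S_lim[OF that]]]) (use S_bound[OF that] in auto)
  have CH_int: "integrable M (\<lambda>\<omega>. (C * H \<omega>) powr p)" "integrable M (\<lambda>\<omega>. (2 * C * H \<omega>) powr p)"
    using H_int by (simp_all add: powr_mult)
  have CH_meas [measurable]: "(\<lambda>\<omega>. C * H \<omega>) \<in> borel_measurable M" by measurable
  have S_Lp: "in_Lp M p (S N)" for N
    by (rule in_Lp_dominated[OF _ CH_meas CH_int(1) _ p0(2)])
       (use G_fin S_bound in \<open>auto elim!: eventually_mono\<close>)
  have X_Lp: "in_Lp M p X"
    by (rule in_Lp_dominated[OF _ CH_meas CH_int(1) _ p0(2)])
       (use G_fin X_bound in \<open>auto elim!: eventually_mono\<close>)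
  have "(\<lambda>N. \<integral>\<omega>. \<bar>S N \<omega> - X \<omega>\<bar> powr p \<partial>M) \<longlonglongrightarrow> (\<integral>\<omega>. 0 \<partial>M)"
  proof (rule integral_dominated_convergence)
    show "integrable M (\<lambda>\<omega>. (2 * C * H \<omega>) powr p)" by (rule CH_int)
    show "AE \<omega> in M. (\<lambda>N. \<bar>S N \<omega> - X \<omega>\<bar> powr p) \<longlonglongrightarrow> 0"
      using G_fin
    proof eventually_elim
      case (elim \<omega>)
      have "(\<lambda>N. \<bar>S N \<omega> - X \<omega>\<bar> powr p) \<longlonglongrightarrow> \<bar>X \<omega> - X \<omega>\<bar> powr p"
        using p0 by (intro tendsto_powr2 tendsto_rabs tendsto_diff tendsto_const S_lim[OF elim]) auto
      then show ?case by simp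
    qed
    show "AE \<omega> in M. norm (\<bar>S N \<omega> - X \<omega>\<bar> powr p) \<le> (2 * C * H \<omega>) powr p" for N
      using G_fin
    proof eventually_elim
      case (elim \<omega>)
      have "\<bar>S N \<omega> - X \<omega>\<bar> \<le> 2 * C * H \<omega>"
        using S_bound[OF elim, of N] X_bound[OF elim] by linarith
      then show ?case using p0 by (auto intro: powr_mono2)
    qed
  qed measurable
  then have "(\<lambda>N. (\<integral>\<omega>. \<bar>S N \<omega> - X \<omega>\<bar> powr p \<partial>M) powr (1 / p)) \<longlonglongrightarrow> 0 powr (1 / p)"
    using p0 by (intro tendsto_powr2) auto
  then show "series_converges_in_Lp M p (fluctuation_term L a)"
    unfolding series_converges_in_Lp_def converges_in_Lp_def
    using S_Lp X_Lp by (auto simp: S_def cong: in_Lp_cong)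
qed

end

section \<open>Necessity: the terms of an L_p-convergent series\<close>

lemma (in prob_space) series_terms_tendsto_0:
  assumes p: "p \<ge> 1"
    and S: "converges_in_Lp M p (\<lambda>N \<omega>. \<Sum>n<N. f n \<omega>)"
  shows "in_Lp M p (f n)" and "(\<lambda>n. expectation (\<lambda>\<omega>. \<bar>f n \<omega>\<bar> powr p)) \<longlonglongrightarrow> 0"
proof -
  define S where "S N \<omega> = (\<Sum>n<N. f n \<omega>)" for N \<omega>
  have S_Lp: "in_Lp M p (S N)" for N
    using S unfolding converges_in_Lp_def S_def by blast
  obtain X where X: "in_Lp M p X"
    and lim: "(\<lambda>N. (\<integral>\<omega>. \<bar>S N \<omega> - X \<omega>\<bar> powr p \<partial>M) powr (1 / p)) \<longlonglongrightarrow> 0"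
    using S unfolding converges_in_Lp_def S_def by blast
  have p0: "p > 0" "p \<ge> 0" using p by auto
  \<comment> \<open>Terms are differences of partial sums, and consecutive partial sums approach the
    same \<open>X\<close>.\<close>
  have f: "f n = (\<lambda>\<omega>. S (Suc n) \<omega> - S n \<omega>)" for n
    by (simp add: S_def)
  show "in_Lp M p (f n)"
    unfolding f by (intro in_Lp_diff S_Lp p0)
  define d where "d N = expectation (\<lambda>\<omega>. \<bar>S N \<omega> - X \<omega>\<bar> powr p)" for N
  have "(\<lambda>N. (d N powr (1 / p)) powr p) \<longlonglongrightarrow> 0 powr p"
    using lim p0 by (intro tendsto_powr2) (auto simp: d_def)
  then have d: "d \<longlonglongrightarrow> 0"
    using p0 by (simp add: powr_powr d_def [abs_def])
  show "(\<lambda>n. expectation (\<lambda>\<omega>. \<bar>f n \<omega>\<bar> powr p)) \<longlonglongrightarrow> 0"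
  proof (rule tendsto_sandwich[OF _ _ tendsto_const])
    have "(\<lambda>n. 2 powr p * (d (Suc n) + d n)) \<longlonglongrightarrow> 2 powr p * (0 + 0)"
      by (intro tendsto_intros d LIMSEQ_Suc)
    then show "(\<lambda>n. 2 powr p * (d (Suc n) + d n)) \<longlonglongrightarrow> 0" by simp
    have "expectation (\<lambda>\<omega>. \<bar>f n \<omega>\<bar> powr p) \<le> 2 powr p * (d (Suc n) + d n)" for n
      using expectation_diff_powr_le[OF in_Lp_diff[OF S_Lp X] in_Lp_diff[OF S_Lp X], of "Suc n" n] p0
      by (simp add: d_def f)
    then show "\<forall>\<^sub>F n in sequentially. expectation (\<lambda>\<omega>. \<bar>f n \<omega>\<bar> powr p) \<le> 2 powr p * (d (Suc n) + d n)"
      by simp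
  qed simp
qed

context normalized_supercritical_wbp
begin

text \<open>The scaled increments tend to 0 in L_p, hence in every lower moment, while
  \<open>increment_lower\<close> keeps their r-th moments above
  \<open>c * (exp (a * r) * m(r)) ^ n\<close>. The choices \<open>r = 2\<close> and
  \<open>r = p\<close> give the two moment conditions.\<close>

lemma series_converges_necessary:
  assumes nondeg: "prob {\<omega> \<in> space M. intrinsic_martingale L 1 \<omega> = 1} < 1"
    and p: "p \<ge> 2"
    and S: "series_converges_in_Lp M p (fluctuation_term L a)"
  shows "integrable M (\<lambda>\<omega>. intrinsic_martingale L n \<omega> powr p)"
    and "2 \<le> r \<Longrightarrow> r \<le> p \<Longrightarrow> ennreal (exp (a * r)) * moment_fun M L r < 1"
proof -
  let ?W = "intrinsic_martingale L" and ?f = "fluctuation_term L a"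
  have p0: "p \<ge> 1" "p \<ge> 0" using p by auto
  note f = series_terms_tendsto_0[OF p0(1) S[unfolded series_converges_in_Lp_def]]
  have f_eq: "martingale_limit L \<omega> - ?W n \<omega> = exp (- (a * real n)) * ?f n \<omega>" for n \<omega>
    by (simp add: fluctuation_term_def exp_minus field_simps)
  \<comment> \<open>The term with index 0 is \<open>W - 1\<close>, so W lies in L_p; each
    \<open>W_n\<close> is then recovered from W and the n-th term.\<close>
  have "in_Lp M p (\<lambda>\<omega>. ?f 0 \<omega> - (- 1))"
    by (intro in_Lp_diff f in_Lp_const p0)
  then have lim_Lp: "in_Lp M p (martingale_limit L)"
    by (rule in_Lp_cong[THEN iffD1, rotated]) (simp add: fluctuation_term_def intrinsic_martingale_0)
  have W_Lp: "in_Lp M p (?W n)" for n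
  proof -
    have "in_Lp M p (\<lambda>\<omega>. martingale_limit L \<omega> - exp (- (a * real n)) * ?f n \<omega>)"
      by (intro in_Lp_diff lim_Lp in_Lp_scale f p0)
    then show ?thesis unfolding f_eq[symmetric] by simp
  qed
  then show W_int: "integrable M (\<lambda>\<omega>. ?W n \<omega> powr p)" for n
    unfolding in_Lp_def by (simp add: intrinsic_martingale_nonneg)
  assume r: "2 \<le> r" "r \<le> p"
  have W_int_r: "integrable M (\<lambda>\<omega>. ?W n \<omega> powr r)" for n
    using integrable_abs_powr_mono[of "?W n" p r] W_Lp[of n] r
    by (simp add: in_Lp_def intrinsic_martingale_nonneg)
  define c where "c = 2 * ((1 / 2) powr r * expectation (\<lambda>\<omega>. \<bar>total_weight (\<lambda>i. L [] i \<omega>) - 1\<bar> powr r))"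
  have r1: "r \<ge> 1" using r by simp
  \<comment> \<open>Nondegeneracy enters here: a vanishing moment would mean \<open>W_1 = 1\<close>
    almost surely.\<close>
  have c: "c > 0"
  proof (rule ccontr)
    assume "\<not> c > 0"
    moreover have "0 \<le> expectation (\<lambda>\<omega>. \<bar>total_weight (\<lambda>i. L [] i \<omega>) - 1\<bar> powr r)" by simp
    ultimately have "expectation (\<lambda>\<omega>. \<bar>total_weight (\<lambda>i. L [] i \<omega>) - 1\<bar> powr r) = 0"
      by (simp add: c_def zero_less_mult_iff)
    then have "AE \<omega> in M. \<bar>total_weight (\<lambda>i. L [] i \<omega>) - 1\<bar> powr r = 0"
      using integrable_offspring_centered[OF r1 W_int_r] by (subst (asm) integral_nonneg_eq_0_iff_AE) auto
    then have "AE \<omega> in M. ?W 1 \<omega> = 1"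
      using AE_space by eventually_elim (simp only: intrinsic_martingale_1, simp)
    then have "prob {\<omega> \<in> space M. ?W 1 \<omega> = 1} = 1"
      by (intro prob_Collect_eq_1[THEN iffD2]) simp_all
    with nondeg show False by simp
  qed
  \<comment> \<open>In this combination of consecutive terms the limit W cancels.\<close>
  define y where "y n \<omega> = ?f n \<omega> - exp (- a) * ?f (Suc n) \<omega>" for n \<omega>
  have y_eq: "y n \<omega> = exp (a * real n) * (?W (Suc n) \<omega> - ?W n \<omega>)" for n \<omega>
  proof -
    have "exp (- a) * exp (a * real (Suc n)) = exp (- a + a * real (Suc n))"
      by (simp only: exp_add)
    also have "- a + a * real (Suc n) = a * real n"
      by (simp add: algebra_simps)
    finally have "exp (- a) * ?f (Suc n) \<omega> = exp (a * real n) * (martingale_limit L \<omega> - ?W (Suc n) \<omega>)"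
      unfolding fluctuation_term_def by (simp only: mult.assoc[symmetric])
    then show ?thesis by (simp add: y_def fluctuation_term_def algebra_simps)
  qed
  have y_Lp: "in_Lp M p (y n)" for n
    unfolding y_def by (intro in_Lp_diff in_Lp_scale f p0)
  have y_lim: "(\<lambda>n. expectation (\<lambda>\<omega>. \<bar>y n \<omega>\<bar> powr p)) \<longlonglongrightarrow> 0"
  proof (rule tendsto_sandwich[OF _ _ tendsto_const])
    let ?e = "\<lambda>n. expectation (\<lambda>\<omega>. \<bar>?f n \<omega>\<bar> powr p)"
    have "(\<lambda>n. 2 powr p * (?e n + exp (- a) powr p * ?e (Suc n))) \<longlonglongrightarrow> 2 powr p * (0 + exp (- a) powr p * 0)"
      by (intro tendsto_intros f(2) LIMSEQ_Suc[OF f(2)])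
    then show "(\<lambda>n. 2 powr p * (?e n + exp (- a) powr p * ?e (Suc n))) \<longlonglongrightarrow> 0" by simp
    have "expectation (\<lambda>\<omega>. \<bar>y n \<omega>\<bar> powr p) \<le> 2 powr p * (?e n + exp (- a) powr p * ?e (Suc n))" for n
      using expectation_diff_powr_le[OF f(1) in_Lp_scale[OF f(1)] p0(2), of n "exp (- a)" "Suc n"]
      by (simp add: y_def abs_mult powr_mult)
    then show "\<forall>\<^sub>F n in sequentially. expectation (\<lambda>\<omega>. \<bar>y n \<omega>\<bar> powr p) \<le> 2 powr p * (?e n + exp (- a) powr p * ?e (Suc n))"
      by simp
  qed simp
  \<comment> \<open>With this level the bounded part costs exactly half of \<open>c\<close>; the
    p-th moment of \<open>y n\<close> has to stay within the other half.\<close>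
  define l where "l = (c / 2) powr (1 / r)"
  have l: "l > 0" "l powr r = c / 2"
    using c r by (simp_all add: l_def powr_powr)
  have "\<forall>\<^sub>F n in sequentially. expectation (\<lambda>\<omega>. \<bar>y n \<omega>\<bar> powr p) < c / 2 / l powr (r - p)"
    using c l by (intro order_tendstoD(2)[OF y_lim]) simp
  then obtain n where n: "expectation (\<lambda>\<omega>. \<bar>y n \<omega>\<bar> powr p) < c / 2 / l powr (r - p)"
    using eventually_happens'[OF sequentially_bot] by blast
  have "expectation (\<lambda>\<omega>. \<bar>y n \<omega>\<bar> powr r) \<le> l powr r + l powr (r - p) * expectation (\<lambda>\<omega>. \<bar>y n \<omega>\<bar> powr p)"
    using r l by (intro expectation_powr_le_powr y_Lp) auto
  also have "\<dots> < c / 2 + c / 2"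
  proof -
    have "l powr (r - p) > 0" using l by simp
    then have "l powr (r - p) * expectation (\<lambda>\<omega>. \<bar>y n \<omega>\<bar> powr p) < c / 2"
      using n by (simp only: pos_less_divide_eq mult.commute)
    then show ?thesis using l by linarith
  qed
  finally have y_less: "expectation (\<lambda>\<omega>. \<bar>y n \<omega>\<bar> powr r) < c" by simp
  let ?q = "ennreal (exp (a * r)) * moment_fun M L r"
  have "ennreal c * ?q ^ n = ennreal (exp (a * real n) powr r) * (ennreal c * moment_fun M L r ^ n)"
  proof -
    have "ennreal (exp (a * r)) ^ n = ennreal (exp (a * real n) powr r)"
      by (simp add: ennreal_power exp_powr_real mult_ac flip: exp_of_nat_mult)
    then show ?thesis by (simp add: power_mult_distrib mult_ac)
  qed
  also have "\<dots> \<le> ennreal (exp (a * real n) powr r) * (\<integral>\<^sup>+\<omega>. ennreal (\<bar>?W (Suc n) \<omega> - ?W n \<omega>\<bar> powr r) \<partial>M)"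
    unfolding c_def by (intro mult_left_mono increment_lower r W_int_r) auto
  also have "\<dots> = (\<integral>\<^sup>+\<omega>. ennreal (\<bar>y n \<omega>\<bar> powr r) \<partial>M)"
    by (subst nn_integral_cmult[symmetric]) (auto simp: y_eq abs_mult powr_mult simp flip: ennreal_mult)
  also have "\<dots> = ennreal (expectation (\<lambda>\<omega>. \<bar>y n \<omega>\<bar> powr r))"
    using integrable_abs_powr_mono[of "y n" p r] y_Lp[of n] r
    by (intro nn_integral_eq_integral) (auto simp: in_Lp_def)
  also have "\<dots> < ennreal c"
    using y_less by (intro ennreal_lessI) (use c in auto)
  finally have less: "ennreal c * ?q ^ n < ennreal c" .
  \<comment> \<open>A single index \<open>n\<close> suffices: if \<open>?q\<close> were at least 1,
    so would be all its powers.\<close>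
  show "?q < 1"
  proof (rule ccontr)
    assume "\<not> ?q < 1"
    then have "1 \<le> ?q ^ n" by (intro one_le_power) simp
    then have "ennreal c * 1 \<le> ennreal c * ?q ^ n" by (rule mult_left_mono) simp
    with less show False by simp
  qed
qed

lemma fluctuation_series_criterion:
  assumes nondeg: "prob {\<omega> \<in> space M. intrinsic_martingale L 1 \<omega> = 1} < 1"
    and a: "a > 0" and p: "p \<ge> 2"
  shows "series_converges_in_Lp M p (fluctuation_term L a) \<longleftrightarrow>
      integrable M (\<lambda>\<omega>. intrinsic_martingale L 1 \<omega> powr p) \<and>
      ennreal (exp (a * 2)) * moment_fun M L 2 < 1 \<and> ennreal (exp (a * p)) * moment_fun M L p < 1"
    and "series_converges_in_Lp M p (fluctuation_term L a) \<Longrightarrow>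
      AE \<omega> in M. summable (\<lambda>n. fluctuation_term L a n \<omega>)"
proof -
  have suff: "series_converges_in_Lp M p (fluctuation_term L a) \<and>
      (AE \<omega> in M. summable (\<lambda>n. fluctuation_term L a n \<omega>))"
    if int: "integrable M (\<lambda>\<omega>. intrinsic_martingale L 1 \<omega> powr p)"
      and m: "ennreal (exp (a * 2)) * moment_fun M L 2 < 1" "ennreal (exp (a * p)) * moment_fun M L p < 1"
  proof -
    have "moment_fun M L 2 \<noteq> \<infinity>" "moment_fun M L p \<noteq> \<infinity>"
      using m by (auto simp: ennreal_mult_top)
    then obtain m2 mp where m2: "moment_fun M L 2 = ennreal m2" "m2 \<ge> 0"
      and mp: "moment_fun M L p = ennreal mp" "mp \<ge> 0"
      by (metis ennreal_cases infinity_ennreal_def)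
    have "exp (a * 2) * m2 < 1" "exp (a * p) * mp < 1"
      using m m2 mp by (simp_all add: ennreal_less_one_iff flip: ennreal_mult)
    then have *: "m2 < exp (- (a * 2))" "mp < exp (- (a * p))"
      by (simp_all add: exp_minus field_simps)
    \<comment> \<open>Raising the condition on m(2) to the power p/2 puts both conditions on the
      common scale \<open>exp (- (a * p))\<close>, so that one rate \<open>r\<close> fits below this
      bound and above both moments.\<close>
    have "m2 powr (p / 2) < exp (- (a * 2)) powr (p / 2)"
      using * m2 p by (intro powr_less_mono2) auto
    then have "max (m2 powr (p / 2)) mp < exp (- (a * p))"
      using * by (simp add: exp_powr_real)
    then obtain r where r: "max (m2 powr (p / 2)) mp < r" "r < exp (- (a * p))"
      using dense by blast
    then have r': "m2 powr (p / 2) < r" "mp < r" "r > 0" using mp by auto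
    have er: "exp (a * p) * r < 1"
      using r by (simp add: exp_minus field_simps)
    obtain K where K: "K \<ge> 0" "\<And>n. (\<integral>\<^sup>+\<omega>. ennreal (\<bar>intrinsic_martingale L (Suc n) \<omega> - intrinsic_martingale L n \<omega>\<bar> powr p) \<partial>M)
        \<le> ennreal (K * r ^ n)"
      using increment_upper[OF p int m2 r'(1) mp r'(2)] by metis
    show ?thesis
      using series_converges_sufficient[OF a p r'(3) er K(2) K(1)] by blast
  qed
  note necc = series_converges_necessary[OF nondeg p]
  show "series_converges_in_Lp M p (fluctuation_term L a) \<longleftrightarrow>
      integrable M (\<lambda>\<omega>. intrinsic_martingale L 1 \<omega> powr p) \<and>
      ennreal (exp (a * 2)) * moment_fun M L 2 < 1 \<and> ennreal (exp (a * p)) * moment_fun M L p < 1"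
    using suff necc p by blast
  show "AE \<omega> in M. summable (\<lambda>n. fluctuation_term L a n \<omega>)"
    if "series_converges_in_Lp M p (fluctuation_term L a)"
    using suff necc p that by blast
qed

end

theorem theorem1p4:
  fixes M :: "'a measure" and L :: "nat list \<Rightarrow> nat \<Rightarrow> 'a \<Rightarrow> real" and a p :: real
  assumes "normalized_supercritical_wbp M L"
    and "measure M {\<omega> \<in> space M. intrinsic_martingale L 1 \<omega> = 1} < 1"
    and "a > 0" and "p \<ge> 2"
  shows "(series_converges_in_Lp M p (fluctuation_term L a) \<longleftrightarrow>
            (\<integral>\<^sup>+\<omega>. ennreal (intrinsic_martingale L 1 \<omega> powr p) \<partial>M) < \<infinity> \<and>
            ennreal (exp a) * max (ennreal_powr (moment_fun M L 2) (1 / 2))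
                                  (ennreal_powr (moment_fun M L p) (1 / p)) < 1)
       \<and> (series_converges_in_Lp M p (fluctuation_term L a) \<longrightarrow>
            (AE \<omega> in M. summable (\<lambda>n. fluctuation_term L a n \<omega>)))"
proof -
  interpret normalized_supercritical_wbp M L by (rule assms(1))
  have "integrable M (\<lambda>\<omega>. intrinsic_martingale L 1 \<omega> powr p)
      \<longleftrightarrow> (\<integral>\<^sup>+\<omega>. ennreal (intrinsic_martingale L 1 \<omega> powr p) \<partial>M) < \<infinity>"
    by (simp add: integrable_iff_bounded)
  moreover have "ennreal (exp a) * max x y < 1 \<longleftrightarrow> ennreal (exp a) * x < 1 \<and> ennreal (exp a) * y < 1" for x y
  proof -
    have "ennreal (exp a) * x \<le> ennreal (exp a) * y" if "x \<le> y" for x y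
      using that by (rule mult_left_mono) simp
    from this[of x y] this[of y x] linear[of x y] show ?thesis
      by (auto simp: max_def intro: order.strict_trans1)
  qed
  ultimately show ?thesis
    using fluctuation_series_criterion[OF assms(2-4)] assms(4)
    by (simp add: exp_mult_ennreal_powr_less_1)
qed

end
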